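(* Let $\mathcal M$ be a strict right module C$^*$-category over a strict C$^*$-tensor category $\mathcal C$. Take an object $M\in\mathcal M$ and consider the unital C$^*$-algebra $A=\operatorname{End}(M)$. Then the following defines a weak unitary tensor functor $F\colon\mathcal C\to\operatorname{Corr}A$: $$F(U)=\operatorname{Mor}(M,M\otimes U),$$ with the right $A$-module structure on $F(U)$ given by composition of morphisms, the left $A$-module structure given by $aX=(a\otimes\iota)X$, and the inner product given by $\langle X,Y\rangle=X^*Y$; the action of $F$ on morphisms is defined by $F(T)X=(\iota\otimes T)X$; and $$F_2\colon F(U)\otimes_AF(V)\to F(U\otimes V)$$ is given by $X\otimes Y\mapsto(X\otimes\iota)Y$.
   Context: **Module categories.** Given a strict C$^*$-tensor category $\mathcal C$ with unit object $\mathbf 1$, a strict right $\mathcal C$-module C$^*$-category is a C$^*$-category $\mathcal M$ with a bilinear unitary (i.e. $*$-preserving) functor $\otimes\colon\mathcal M\times\mathcal C\to\mathcal M$ such that $(M\otimes U)\otimes V=M\otimes(U\otimes V)$ and $M\otimes\mathbf 1=M$ (with identity morphisms as the structure isomorphisms). C$^*$-categories are tacitly assumed to have subobjects: for every projection $p\in\operatorname{End}(M)$ there are an object $N$ and an isometry $v\in\operatorname{Mor}(N,M)$ with $vv^*=p$. **Correspondences.** $\operatorname{Corr}A$ is the C$^*$-tensor category of C$^*$-correspondences over $A$: right Hilbert $A$-modules (inner products linear in the second variable) with a nondegenerate left action of $A$ by adjointable operators; morphisms are adjointable $A$-bilinear maps; the tensor product is the (completed) internal tensor product $\otimes_A$.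 **Weak unitary tensor functors.** A weak unitary tensor functor $\mathcal C\to\operatorname{Corr}A$ is a linear functor $F\colon\mathcal C\to\operatorname{Corr}A$ together with natural $A$-bilinear isometries $F_2=F_{2,U,V}\colon F(U)\otimes_AF(V)\to F(U\otimes V)$ (not required to be adjointable) such that: (i) $F(\mathbf 1)=A$; (ii) $F(T)^*=F(T^* )$ for every morphism $T$; (iii) $F_2\colon A\otimes_AF(U)\to F(U)$ maps $a\otimes X$ into $aX$, and $F_2\colon F(U)\otimes_AA\to F(U)$ maps $X\otimes a$ into $Xa$; (iv) $F_2(F_2\otimes\iota)=F_2(\iota\otimes F_2)$ as maps $F(U)\otimes_AF(V)\otimes_AF(W)\to F(U\otimes V\otimes W)$; (v) for all objects $U,V$ and every $X\in F(U)$ the right $A$-linear map $S_X=S_{X,V}\colon F(V)\to F(U\otimes V)$, $S_XY=F_2(X\otimes Y)$, is adjointable, and $S_X^*F_2=F_2(S_X^*\otimes\iota)$ as maps $F(U\otimes V)\otimes_AF(W)\to F(V\otimes W)$ for all $W$. *)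

theory Defs
  imports
    "HOL-Analysis.Abstract_Metric_Spaces"
    "HOL-Algebra.Module"
begin

section \<open>Banach spaces and unital C*-algebras on carrier sets\<close>

text \<open>
  Complex vector spaces are modules in the sense of \<^locale>\<open>module\<close> over the ring of complex
  numbers; the multiplication and unit fields of a module record carry no meaning for them.
\<close>

definition complex_ring :: "complex ring" where
  "complex_ring = \<lparr>carrier = UNIV, monoid.mult = (*), one = 1, ring.zero = 0, add = (+)\<rparr>"

record 'x normed_space = "(complex, 'x) module" +
  nrm :: "'x \<Rightarrow> real"

text \<open>
  The locale \<^locale>\<open>Metric_space\<close> demands symmetry of the distance on the whole type, which fails
  off the carrier for the distances used here; hence completeness is spelled out.
\<close>

definition cauchy_complete :: "'x set \<Rightarrow> ('x \<Rightarrow> 'x \<Rightarrow> real) \<Rightarrow> bool" where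
  "cauchy_complete S d \<longleftrightarrow>
    (\<forall>s. (\<forall>n. s n \<in> S) \<and> (\<forall>e>0. \<exists>N::nat. \<forall>m\<ge>N. \<forall>n\<ge>N. d (s m) (s n) < e) \<longrightarrow>
         (\<exists>x\<in>S. (\<lambda>n. d (s n) x) \<longlonglongrightarrow> 0))"

locale banach_space_on =
  fixes V :: "('x, 'b) normed_space_scheme" (structure)
  assumes complex_module: "module complex_ring V"
    and nrm_nonneg: "x \<in> carrier V \<Longrightarrow> 0 \<le> nrm V x"
    and nrm_eq_0_iff: "x \<in> carrier V \<Longrightarrow> nrm V x = 0 \<longleftrightarrow> x = \<zero>"
    and nrm_triangle:
      "\<lbrakk>x \<in> carrier V; y \<in> carrier V\<rbrakk> \<Longrightarrow> nrm V (x \<oplus> y) \<le> nrm V x + nrm V y"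
    and nrm_smult: "x \<in> carrier V \<Longrightarrow> nrm V (c \<odot> x) = cmod c * nrm V x"
    and complete: "cauchy_complete (carrier V) (\<lambda>x y. nrm V (x \<ominus> y))"

record 'a star_algebra = "'a normed_space" +
  star :: "'a \<Rightarrow> 'a"

locale cstar_algebra =
  fixes A :: "('a, 'b) star_algebra_scheme" (structure)
  assumes ring: "ring A"
    and banach: "banach_space_on A"
    and smult_mult_left:
      "\<lbrakk>a \<in> carrier A; b \<in> carrier A\<rbrakk> \<Longrightarrow> (c \<odot> a) \<otimes> b = c \<odot> (a \<otimes> b)"
    and smult_mult_right:
      "\<lbrakk>a \<in> carrier A; b \<in> carrier A\<rbrakk> \<Longrightarrow> a \<otimes> (c \<odot> b) = c \<odot> (a \<otimes> b)"
    and star_closed: "a \<in> carrier A \<Longrightarrow> star A a \<in> carrier A"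
    and star_star: "a \<in> carrier A \<Longrightarrow> star A (star A a) = a"
    and star_add:
      "\<lbrakk>a \<in> carrier A; b \<in> carrier A\<rbrakk> \<Longrightarrow> star A (a \<oplus> b) = star A a \<oplus> star A b"
    and star_smult: "a \<in> carrier A \<Longrightarrow> star A (c \<odot> a) = cnj c \<odot> star A a"
    and star_mult:
      "\<lbrakk>a \<in> carrier A; b \<in> carrier A\<rbrakk> \<Longrightarrow> star A (a \<otimes> b) = star A b \<otimes> star A a"
    and nrm_mult:
      "\<lbrakk>a \<in> carrier A; b \<in> carrier A\<rbrakk> \<Longrightarrow> nrm A (a \<otimes> b) \<le> nrm A a * nrm A b"
    and cstar_identity: "a \<in> carrier A \<Longrightarrow> nrm A (star A a \<otimes> a) = (nrm A a)\<^sup>2"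

definition positive_elem :: "('a, 'b) star_algebra_scheme \<Rightarrow> 'a \<Rightarrow> bool" where
  "positive_elem A a \<longleftrightarrow> (\<exists>b\<in>carrier A. a = star A b \<otimes>\<^bsub>A\<^esub> b)"


section \<open>C*-categories\<close>

text \<open>
  Morphism spaces of a category may be taken to be pairwise disjoint, so composition, the
  involution and tensor products of morphisms are not indexed by objects.  Since
  \<open>Mor C U V\<close> is itself a normed space, addition, scalars and norms are indexed.
\<close>

record ('o, 'm) star_category =
  Ob :: "'o set"
  Mor :: "'o \<Rightarrow> 'o \<Rightarrow> 'm normed_space"
  idm :: "'o \<Rightarrow> 'm"
  cmp :: "'m \<Rightarrow> 'm \<Rightarrow> 'm"  (infixl \<open>\<diamondop>\<index>\<close> 70)
  dag :: "'m \<Rightarrow> 'm"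

abbreviation mors :: "('o, 'm, 'z) star_category_scheme \<Rightarrow> 'o \<Rightarrow> 'o \<Rightarrow> 'm set" where
  "mors C U V \<equiv> carrier (Mor C U V)"

definition End_alg :: "('o, 'm, 'z) star_category_scheme \<Rightarrow> 'o \<Rightarrow> 'm star_algebra" where
  "End_alg C U =
    \<lparr>carrier = mors C U U, monoid.mult = cmp C, one = idm C U,
     ring.zero = \<zero>\<^bsub>Mor C U U\<^esub>, add = add (Mor C U U), smult = smult (Mor C U U),
     nrm = nrm (Mor C U U), star = dag C\<rparr>"

text \<open>C*-categories with subobjects.\<close>

locale cstar_category =
  fixes C :: "('o, 'm, 'z) star_category_scheme" (structure)
  assumes banach: "\<lbrakk>U \<in> Ob C; V \<in> Ob C\<rbrakk> \<Longrightarrow> banach_space_on (Mor C U V)"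
    and id_closed: "U \<in> Ob C \<Longrightarrow> idm C U \<in> mors C U U"
    and cmp_closed:
      "\<lbrakk>U \<in> Ob C; V \<in> Ob C; W \<in> Ob C; S \<in> mors C V W; T \<in> mors C U V\<rbrakk>
        \<Longrightarrow> S \<diamondop> T \<in> mors C U W"
    and cmp_assoc:
      "\<lbrakk>U \<in> Ob C; V \<in> Ob C; W \<in> Ob C; Z \<in> Ob C;
        R \<in> mors C W Z; S \<in> mors C V W; T \<in> mors C U V\<rbrakk>
        \<Longrightarrow> (R \<diamondop> S) \<diamondop> T = R \<diamondop> (S \<diamondop> T)"
    and id_left: "\<lbrakk>U \<in> Ob C; V \<in> Ob C; T \<in> mors C U V\<rbrakk> \<Longrightarrow> idm C V \<diamondop> T = T"
    and id_right: "\<lbrakk>U \<in> Ob C; V \<in> Ob C; T \<in> mors C U V\<rbrakk> \<Longrightarrow> T \<diamondop> idm C U = T"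
    and cmp_add_left:
      "\<lbrakk>U \<in> Ob C; V \<in> Ob C; W \<in> Ob C; S \<in> mors C V W; S' \<in> mors C V W; T \<in> mors C U V\<rbrakk>
        \<Longrightarrow> (S \<oplus>\<^bsub>Mor C V W\<^esub> S') \<diamondop> T = (S \<diamondop> T) \<oplus>\<^bsub>Mor C U W\<^esub> (S' \<diamondop> T)"
    and cmp_add_right:
      "\<lbrakk>U \<in> Ob C; V \<in> Ob C; W \<in> Ob C; S \<in> mors C V W; T \<in> mors C U V; T' \<in> mors C U V\<rbrakk>
        \<Longrightarrow> S \<diamondop> (T \<oplus>\<^bsub>Mor C U V\<^esub> T') = (S \<diamondop> T) \<oplus>\<^bsub>Mor C U W\<^esub> (S \<diamondop> T')"
    and cmp_smult_left:
      "\<lbrakk>U \<in> Ob C; V \<in> Ob C; W \<in> Ob C; S \<in> mors C V W; T \<in> mors C U V\<rbrakk>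
        \<Longrightarrow> (c \<odot>\<^bsub>Mor C V W\<^esub> S) \<diamondop> T = c \<odot>\<^bsub>Mor C U W\<^esub> (S \<diamondop> T)"
    and cmp_smult_right:
      "\<lbrakk>U \<in> Ob C; V \<in> Ob C; W \<in> Ob C; S \<in> mors C V W; T \<in> mors C U V\<rbrakk>
        \<Longrightarrow> S \<diamondop> (c \<odot>\<^bsub>Mor C U V\<^esub> T) = c \<odot>\<^bsub>Mor C U W\<^esub> (S \<diamondop> T)"
    and nrm_cmp:
      "\<lbrakk>U \<in> Ob C; V \<in> Ob C; W \<in> Ob C; S \<in> mors C V W; T \<in> mors C U V\<rbrakk>
        \<Longrightarrow> nrm (Mor C U W) (S \<diamondop> T) \<le> nrm (Mor C V W) S * nrm (Mor C U V) T"
    and dag_closed: "\<lbrakk>U \<in> Ob C; V \<in> Ob C; T \<in> mors C U V\<rbrakk> \<Longrightarrow> dag C T \<in> mors C V U"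
    and dag_dag: "\<lbrakk>U \<in> Ob C; V \<in> Ob C; T \<in> mors C U V\<rbrakk> \<Longrightarrow> dag C (dag C T) = T"
    and dag_add:
      "\<lbrakk>U \<in> Ob C; V \<in> Ob C; S \<in> mors C U V; T \<in> mors C U V\<rbrakk>
        \<Longrightarrow> dag C (S \<oplus>\<^bsub>Mor C U V\<^esub> T) = dag C S \<oplus>\<^bsub>Mor C V U\<^esub> dag C T"
    and dag_smult:
      "\<lbrakk>U \<in> Ob C; V \<in> Ob C; T \<in> mors C U V\<rbrakk>
        \<Longrightarrow> dag C (c \<odot>\<^bsub>Mor C U V\<^esub> T) = cnj c \<odot>\<^bsub>Mor C V U\<^esub> dag C T"
    and dag_cmp:
      "\<lbrakk>U \<in> Ob C; V \<in> Ob C; W \<in> Ob C; S \<in> mors C V W; T \<in> mors C U V\<rbrakk>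
        \<Longrightarrow> dag C (S \<diamondop> T) = dag C T \<diamondop> dag C S"
    and cstar_identity:
      "\<lbrakk>U \<in> Ob C; V \<in> Ob C; T \<in> mors C U V\<rbrakk>
        \<Longrightarrow> nrm (Mor C U U) (dag C T \<diamondop> T) = (nrm (Mor C U V) T)\<^sup>2"
    and dag_cmp_positive:
      "\<lbrakk>U \<in> Ob C; V \<in> Ob C; T \<in> mors C U V\<rbrakk>
        \<Longrightarrow> positive_elem (End_alg C U) (dag C T \<diamondop> T)"
    and subobjects:
      "\<lbrakk>U \<in> Ob C; p \<in> mors C U U; p \<diamondop> p = p; dag C p = p\<rbrakk>
        \<Longrightarrow> \<exists>N\<in>Ob C. \<exists>v\<in>mors C N U. dag C v \<diamondop> v = idm C N \<and> v \<diamondop> dag C v = p"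

text \<open>Bilinear unitary (that is, *-preserving) functors \<open>C \<times> D \<rightarrow> E\<close>.\<close>

locale bilinear_unitary_functor =
  fixes C :: "('o1, 'm1, 'z1) star_category_scheme"
    and D :: "('o2, 'm2, 'z2) star_category_scheme"
    and E :: "('o3, 'm3, 'z3) star_category_scheme"
    and ob :: "'o1 \<Rightarrow> 'o2 \<Rightarrow> 'o3"
    and mor :: "'m1 \<Rightarrow> 'm2 \<Rightarrow> 'm3"
  assumes ob_closed: "\<lbrakk>U \<in> Ob C; V \<in> Ob D\<rbrakk> \<Longrightarrow> ob U V \<in> Ob E"
    and mor_closed:
      "\<lbrakk>U \<in> Ob C; U' \<in> Ob C; V \<in> Ob D; V' \<in> Ob D; S \<in> mors C U U'; T \<in> mors D V V'\<rbrakk>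
        \<Longrightarrow> mor S T \<in> mors E (ob U V) (ob U' V')"
    and mor_id: "\<lbrakk>U \<in> Ob C; V \<in> Ob D\<rbrakk> \<Longrightarrow> mor (idm C U) (idm D V) = idm E (ob U V)"
    and mor_cmp:
      "\<lbrakk>U \<in> Ob C; U' \<in> Ob C; U'' \<in> Ob C; V \<in> Ob D; V' \<in> Ob D; V'' \<in> Ob D;
        S' \<in> mors C U' U''; S \<in> mors C U U'; T' \<in> mors D V' V''; T \<in> mors D V V'\<rbrakk>
        \<Longrightarrow> mor (S' \<diamondop>\<^bsub>C\<^esub> S) (T' \<diamondop>\<^bsub>D\<^esub> T) = mor S' T' \<diamondop>\<^bsub>E\<^esub> mor S T"
    and mor_add_left:
      "\<lbrakk>U \<in> Ob C; U' \<in> Ob C; V \<in> Ob D; V' \<in> Ob D;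
        S \<in> mors C U U'; S' \<in> mors C U U'; T \<in> mors D V V'\<rbrakk>
        \<Longrightarrow> mor (S \<oplus>\<^bsub>Mor C U U'\<^esub> S') T = mor S T \<oplus>\<^bsub>Mor E (ob U V) (ob U' V')\<^esub> mor S' T"
    and mor_add_right:
      "\<lbrakk>U \<in> Ob C; U' \<in> Ob C; V \<in> Ob D; V' \<in> Ob D;
        S \<in> mors C U U'; T \<in> mors D V V'; T' \<in> mors D V V'\<rbrakk>
        \<Longrightarrow> mor S (T \<oplus>\<^bsub>Mor D V V'\<^esub> T') = mor S T \<oplus>\<^bsub>Mor E (ob U V) (ob U' V')\<^esub> mor S T'"
    and mor_smult_left:
      "\<lbrakk>U \<in> Ob C; U' \<in> Ob C; V \<in> Ob D; V' \<in> Ob D; S \<in> mors C U U'; T \<in> mors D V V'\<rbrakk>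
        \<Longrightarrow> mor (c \<odot>\<^bsub>Mor C U U'\<^esub> S) T = c \<odot>\<^bsub>Mor E (ob U V) (ob U' V')\<^esub> mor S T"
    and mor_smult_right:
      "\<lbrakk>U \<in> Ob C; U' \<in> Ob C; V \<in> Ob D; V' \<in> Ob D; S \<in> mors C U U'; T \<in> mors D V V'\<rbrakk>
        \<Longrightarrow> mor S (c \<odot>\<^bsub>Mor D V V'\<^esub> T) = c \<odot>\<^bsub>Mor E (ob U V) (ob U' V')\<^esub> mor S T"
    and mor_dag:
      "\<lbrakk>U \<in> Ob C; U' \<in> Ob C; V \<in> Ob D; V' \<in> Ob D; S \<in> mors C U U'; T \<in> mors D V V'\<rbrakk>
        \<Longrightarrow> mor (dag C S) (dag D T) = dag E (mor S T)"

record ('o, 'm) tensor_category = "('o, 'm) star_category" +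
  tob :: "'o \<Rightarrow> 'o \<Rightarrow> 'o"
  tmor :: "'m \<Rightarrow> 'm \<Rightarrow> 'm"
  unit :: 'o

locale strict_cstar_tensor_category = cstar_category C
  for C :: "('o, 'm, 'z) tensor_category_scheme" (structure) +
  assumes tensor: "bilinear_unitary_functor C C C (tob C) (tmor C)"
    and unit_closed: "unit C \<in> Ob C"
    and tob_assoc:
      "\<lbrakk>U \<in> Ob C; V \<in> Ob C; W \<in> Ob C\<rbrakk> \<Longrightarrow> tob C (tob C U V) W = tob C U (tob C V W)"
    and tob_unit_left: "U \<in> Ob C \<Longrightarrow> tob C (unit C) U = U"
    and tob_unit_right: "U \<in> Ob C \<Longrightarrow> tob C U (unit C) = U"
    and tmor_assoc:
      "\<lbrakk>U \<in> Ob C; U' \<in> Ob C; V \<in> Ob C; V' \<in> Ob C; W \<in> Ob C; W' \<in> Ob C;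
        R \<in> mors C U U'; S \<in> mors C V V'; T \<in> mors C W W'\<rbrakk>
        \<Longrightarrow> tmor C (tmor C R S) T = tmor C R (tmor C S T)"
    and tmor_unit_left:
      "\<lbrakk>U \<in> Ob C; V \<in> Ob C; T \<in> mors C U V\<rbrakk> \<Longrightarrow> tmor C (idm C (unit C)) T = T"
    and tmor_unit_right:
      "\<lbrakk>U \<in> Ob C; V \<in> Ob C; T \<in> mors C U V\<rbrakk> \<Longrightarrow> tmor C T (idm C (unit C)) = T"

record ('p, 'n, 'o, 'm) module_category = "('p, 'n) star_category" +
  actob :: "'p \<Rightarrow> 'o \<Rightarrow> 'p"
  actmor :: "'n \<Rightarrow> 'm \<Rightarrow> 'n"

locale strict_right_module_cstar_category =
  tensor_cat: strict_cstar_tensor_category C + cstar_category \<M>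
  for C :: "('o, 'm, 'z) tensor_category_scheme"
    and \<M> :: "('p, 'n, 'o, 'm, 'y) module_category_scheme" +
  assumes act: "bilinear_unitary_functor \<M> C \<M> (actob \<M>) (actmor \<M>)"
    and actob_assoc:
      "\<lbrakk>M \<in> Ob \<M>; U \<in> Ob C; V \<in> Ob C\<rbrakk>
        \<Longrightarrow> actob \<M> (actob \<M> M U) V = actob \<M> M (tob C U V)"
    and actob_unit: "M \<in> Ob \<M> \<Longrightarrow> actob \<M> M (unit C) = M"
    and actmor_assoc:
      "\<lbrakk>M \<in> Ob \<M>; M' \<in> Ob \<M>; U \<in> Ob C; U' \<in> Ob C; V \<in> Ob C; V' \<in> Ob C;
        R \<in> mors \<M> M M'; S \<in> mors C U U'; T \<in> mors C V V'\<rbrakk>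
        \<Longrightarrow> actmor \<M> (actmor \<M> R S) T = actmor \<M> R (tmor C S T)"
    and actmor_unit:
      "\<lbrakk>M \<in> Ob \<M>; M' \<in> Ob \<M>; R \<in> mors \<M> M M'\<rbrakk>
        \<Longrightarrow> actmor \<M> R (idm C (unit C)) = R"


section \<open>C*-correspondences over a unital C*-algebra\<close>

definition lsum :: "('x, 'b) ring_scheme \<Rightarrow> ('t \<Rightarrow> 'x) \<Rightarrow> 't list \<Rightarrow> 'x" where
  "lsum G f ts = foldr (\<lambda>t s. f t \<oplus>\<^bsub>G\<^esub> s) ts \<zero>\<^bsub>G\<^esub>"

record ('a, 'x) corr = "(complex, 'x) module" +
  ip :: "'x \<Rightarrow> 'x \<Rightarrow> 'a"
  ract :: "'x \<Rightarrow> 'a \<Rightarrow> 'x"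
  lact :: "'a \<Rightarrow> 'x \<Rightarrow> 'x"

definition hnorm :: "'a star_algebra \<Rightarrow> ('a, 'x) corr \<Rightarrow> 'x \<Rightarrow> real" where
  "hnorm A E x = sqrt (nrm A (ip E x x))"

locale right_hilbert_module = cstar_algebra A
  for A :: "'a star_algebra" and E :: "('a, 'x) corr" (structure) +
  assumes complex_module: "module complex_ring E"
    and ract_closed: "\<lbrakk>x \<in> carrier E; a \<in> carrier A\<rbrakk> \<Longrightarrow> ract E x a \<in> carrier E"
    and ract_add_left:
      "\<lbrakk>x \<in> carrier E; y \<in> carrier E; a \<in> carrier A\<rbrakk>
        \<Longrightarrow> ract E (x \<oplus> y) a = ract E x a \<oplus> ract E y a"
    and ract_add_right:
      "\<lbrakk>x \<in> carrier E; a \<in> carrier A; b \<in> carrier A\<rbrakk>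
        \<Longrightarrow> ract E x (a \<oplus>\<^bsub>A\<^esub> b) = ract E x a \<oplus> ract E x b"
    and ract_smult_left:
      "\<lbrakk>x \<in> carrier E; a \<in> carrier A\<rbrakk> \<Longrightarrow> ract E (c \<odot> x) a = c \<odot> ract E x a"
    and ract_smult_right:
      "\<lbrakk>x \<in> carrier E; a \<in> carrier A\<rbrakk> \<Longrightarrow> ract E x (c \<odot>\<^bsub>A\<^esub> a) = c \<odot> ract E x a"
    and ract_mult:
      "\<lbrakk>x \<in> carrier E; a \<in> carrier A; b \<in> carrier A\<rbrakk>
        \<Longrightarrow> ract E x (a \<otimes>\<^bsub>A\<^esub> b) = ract E (ract E x a) b"
    and ract_one: "x \<in> carrier E \<Longrightarrow> ract E x \<one>\<^bsub>A\<^esub> = x"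
    and ip_closed: "\<lbrakk>x \<in> carrier E; y \<in> carrier E\<rbrakk> \<Longrightarrow> ip E x y \<in> carrier A"
    and ip_add:
      "\<lbrakk>x \<in> carrier E; y \<in> carrier E; z \<in> carrier E\<rbrakk>
        \<Longrightarrow> ip E x (y \<oplus> z) = ip E x y \<oplus>\<^bsub>A\<^esub> ip E x z"
    and ip_smult:
      "\<lbrakk>x \<in> carrier E; y \<in> carrier E\<rbrakk> \<Longrightarrow> ip E x (c \<odot> y) = c \<odot>\<^bsub>A\<^esub> ip E x y"
    and ip_ract:
      "\<lbrakk>x \<in> carrier E; y \<in> carrier E; a \<in> carrier A\<rbrakk>
        \<Longrightarrow> ip E x (ract E y a) = ip E x y \<otimes>\<^bsub>A\<^esub> a"
    and ip_star: "\<lbrakk>x \<in> carrier E; y \<in> carrier E\<rbrakk> \<Longrightarrow> star A (ip E x y) = ip E y x"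
    and ip_positive: "x \<in> carrier E \<Longrightarrow> positive_elem A (ip E x x)"
    and ip_definite: "\<lbrakk>x \<in> carrier E; ip E x x = \<zero>\<^bsub>A\<^esub>\<rbrakk> \<Longrightarrow> x = \<zero>"
    and complete: "cauchy_complete (carrier E) (\<lambda>x y. hnorm A E (x \<ominus> y))"

definition is_adjoint ::
  "('a, 'x) corr \<Rightarrow> ('a, 'y) corr \<Rightarrow> ('x \<Rightarrow> 'y) \<Rightarrow> ('y \<Rightarrow> 'x) \<Rightarrow> bool" where
  "is_adjoint E G T S \<longleftrightarrow>
    T \<in> carrier E \<rightarrow> carrier G \<and> S \<in> carrier G \<rightarrow> carrier E \<and>
    (\<forall>x\<in>carrier E. \<forall>y\<in>carrier G. ip G (T x) y = ip E x (S y))"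

definition adjointable :: "('a, 'x) corr \<Rightarrow> ('a, 'y) corr \<Rightarrow> ('x \<Rightarrow> 'y) \<Rightarrow> bool" where
  "adjointable E G T \<longleftrightarrow> (\<exists>S. is_adjoint E G T S)"

definition adjoint_of :: "('a, 'x) corr \<Rightarrow> ('a, 'y) corr \<Rightarrow> ('x \<Rightarrow> 'y) \<Rightarrow> 'y \<Rightarrow> 'x" where
  "adjoint_of E G T y =
    (THE x. x \<in> carrier E \<and> (\<forall>z\<in>carrier E. ip G (T z) y = ip E z x))"

text \<open>
  The left action is a *-homomorphism into the adjointable operators; linearity of each
  operator \<open>lact E a\<close> is a consequence of adjointability.
\<close>

locale correspondence = right_hilbert_module A E
  for A :: "'a star_algebra" and E :: "('a, 'x) corr" (structure) +
  assumes lact_adjoint: "a \<in> carrier A \<Longrightarrow> is_adjoint E E (lact E a) (lact E (star A a))"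
    and lact_add:
      "\<lbrakk>a \<in> carrier A; b \<in> carrier A; x \<in> carrier E\<rbrakk>
        \<Longrightarrow> lact E (a \<oplus>\<^bsub>A\<^esub> b) x = lact E a x \<oplus> lact E b x"
    and lact_smult:
      "\<lbrakk>a \<in> carrier A; x \<in> carrier E\<rbrakk> \<Longrightarrow> lact E (c \<odot>\<^bsub>A\<^esub> a) x = c \<odot> lact E a x"
    and lact_mult:
      "\<lbrakk>a \<in> carrier A; b \<in> carrier A; x \<in> carrier E\<rbrakk>
        \<Longrightarrow> lact E (a \<otimes>\<^bsub>A\<^esub> b) x = lact E a (lact E b x)"
    and lact_nondegenerate:
      "\<lbrakk>x \<in> carrier E; 0 < e\<rbrakk>
        \<Longrightarrow> \<exists>ts\<in>lists (carrier A \<times> carrier E).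
              hnorm A E (x \<ominus> lsum E (\<lambda>(a, y). lact E a y) ts) < e"

definition bimodule_map ::
  "'a star_algebra \<Rightarrow> ('a, 'x) corr \<Rightarrow> ('a, 'y) corr \<Rightarrow> ('x \<Rightarrow> 'y) \<Rightarrow> bool" where
  "bimodule_map A E G T \<longleftrightarrow>
    T \<in> carrier E \<rightarrow> carrier G \<and>
    (\<forall>x\<in>carrier E. \<forall>y\<in>carrier E. T (x \<oplus>\<^bsub>E\<^esub> y) = T x \<oplus>\<^bsub>G\<^esub> T y) \<and>
    (\<forall>c. \<forall>x\<in>carrier E. T (c \<odot>\<^bsub>E\<^esub> x) = c \<odot>\<^bsub>G\<^esub> T x) \<and>
    (\<forall>x\<in>carrier E. \<forall>a\<in>carrier A. T (ract E x a) = ract G (T x) a) \<and>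
    (\<forall>a\<in>carrier A. \<forall>x\<in>carrier E. T (lact E a x) = lact G a (T x))"

definition corr_morphism ::
  "'a star_algebra \<Rightarrow> ('a, 'x) corr \<Rightarrow> ('a, 'y) corr \<Rightarrow> ('x \<Rightarrow> 'y) \<Rightarrow> bool" where
  "corr_morphism A E G T \<longleftrightarrow> bimodule_map A E G T \<and> adjointable E G T"

definition isometric :: "('a, 'x) corr \<Rightarrow> ('a, 'y) corr \<Rightarrow> ('x \<Rightarrow> 'y) \<Rightarrow> bool" where
  "isometric E G T \<longleftrightarrow>
    (\<forall>x\<in>carrier E. \<forall>y\<in>carrier E. ip G (T x) (T y) = ip E x y)"

definition corr_of_algebra :: "'a star_algebra \<Rightarrow> ('a, 'a) corr" where
  "corr_of_algebra A =
    \<lparr>carrier = carrier A, monoid.mult = monoid.mult A, one = one A, ring.zero = ring.zero A,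
     add = add A, smult = smult A, ip = (\<lambda>a b. star A a \<otimes>\<^bsub>A\<^esub> b),
     ract = monoid.mult A, lact = monoid.mult A\<rparr>"

text \<open>
  Equality of correspondences: the operations are only compared on the carriers, their values
  outside being irrelevant.
\<close>

definition corr_eq :: "'a star_algebra \<Rightarrow> ('a, 'x) corr \<Rightarrow> ('a, 'x) corr \<Rightarrow> bool" where
  "corr_eq A E G \<longleftrightarrow>
    carrier E = carrier G \<and> \<zero>\<^bsub>E\<^esub> = \<zero>\<^bsub>G\<^esub> \<and>
    (\<forall>x\<in>carrier E. \<forall>y\<in>carrier E. x \<oplus>\<^bsub>E\<^esub> y = x \<oplus>\<^bsub>G\<^esub> y \<and> ip E x y = ip G x y) \<and>
    (\<forall>c. \<forall>x\<in>carrier E. c \<odot>\<^bsub>E\<^esub> x = c \<odot>\<^bsub>G\<^esub> x) \<and>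
    (\<forall>a\<in>carrier A. \<forall>x\<in>carrier E. ract E x a = ract G x a \<and> lact E a x = lact G a x)"


section \<open>The internal tensor product\<close>

text \<open>
  The internal tensor product of \<open>E\<close> and \<open>E'\<close> is the separated completion of the space of
  formal finite sums of pairs \<open>(x, y)\<close>, written as lists, for the semi-inner product determined by
  \<open>\<langle>x \<otimes> y, x' \<otimes> y'\<rangle> = \<langle>y, \<langle>x, x'\<rangle> y'\<rangle>\<close>.  The relations of the algebraic tensor product over
  \<open>A\<close> are among the null vectors.  Elements of the completion are classes of
  Cauchy sequences of formal sums; \<open>cls_rep\<close> picks a representing sequence.
\<close>

type_synonym ('x, 'y) tens = "(nat \<Rightarrow> ('x \<times> 'y) list) set"

definition pre_ip :: "'a star_algebra \<Rightarrow> ('a, 'x) corr \<Rightarrow> ('a, 'y) corr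
    \<Rightarrow> ('x \<times> 'y) list \<Rightarrow> ('x \<times> 'y) list \<Rightarrow> 'a" where
  "pre_ip A E E' ts us =
    lsum A (\<lambda>(x, y). lsum A (\<lambda>(x', y'). ip E' y (lact E' (ip E x x') y')) us) ts"

definition pre_dist :: "'a star_algebra \<Rightarrow> ('a, 'x) corr \<Rightarrow> ('a, 'y) corr
    \<Rightarrow> ('x \<times> 'y) list \<Rightarrow> ('x \<times> 'y) list \<Rightarrow> real" where
  "pre_dist A E E' ts us =
    (let ds = ts @ map (\<lambda>(x, y). (\<ominus>\<^bsub>E\<^esub> x, y)) us in sqrt (nrm A (pre_ip A E E' ds ds)))"

definition cauchy_sums :: "'a star_algebra \<Rightarrow> ('a, 'x) corr \<Rightarrow> ('a, 'y) corr
    \<Rightarrow> (nat \<Rightarrow> ('x \<times> 'y) list) set" where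
  "cauchy_sums A E E' =
    {s. (\<forall>n. s n \<in> lists (carrier E \<times> carrier E')) \<and>
        (\<forall>e>0. \<exists>N. \<forall>m\<ge>N. \<forall>n\<ge>N. pre_dist A E E' (s m) (s n) < e)}"

definition null_rel :: "'a star_algebra \<Rightarrow> ('a, 'x) corr \<Rightarrow> ('a, 'y) corr
    \<Rightarrow> ((nat \<Rightarrow> ('x \<times> 'y) list) \<times> (nat \<Rightarrow> ('x \<times> 'y) list)) set" where
  "null_rel A E E' =
    {(s, t). s \<in> cauchy_sums A E E' \<and> t \<in> cauchy_sums A E E' \<and>
             (\<lambda>n. pre_dist A E E' (s n) (t n)) \<longlonglongrightarrow> 0}"

definition tcls :: "'a star_algebra \<Rightarrow> ('a, 'x) corr \<Rightarrow> ('a, 'y) corr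
    \<Rightarrow> (nat \<Rightarrow> ('x \<times> 'y) list) \<Rightarrow> ('x, 'y) tens" where
  "tcls A E E' s = null_rel A E E' `` {s}"

definition cls_rep :: "('x, 'y) tens \<Rightarrow> nat \<Rightarrow> ('x \<times> 'y) list" where
  "cls_rep P = (SOME s. s \<in> P)"

definition nlim :: "'a star_algebra \<Rightarrow> (nat \<Rightarrow> 'a) \<Rightarrow> 'a" where
  "nlim A f = (THE a. a \<in> carrier A \<and> (\<lambda>n. nrm A (f n \<ominus>\<^bsub>A\<^esub> a)) \<longlonglongrightarrow> 0)"

definition itensor ::
  "'a star_algebra \<Rightarrow> ('a, 'x) corr \<Rightarrow> ('a, 'y) corr \<Rightarrow> ('a, ('x, 'y) tens) corr" where
  "itensor A E E' =
    \<lparr>carrier = cauchy_sums A E E' // null_rel A E E',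
     monoid.mult = undefined, one = undefined,
     ring.zero = tcls A E E' (\<lambda>n. []),
     add = (\<lambda>P Q. tcls A E E' (\<lambda>n. cls_rep P n @ cls_rep Q n)),
     smult = (\<lambda>c P. tcls A E E' (\<lambda>n. map (\<lambda>(x, y). (c \<odot>\<^bsub>E\<^esub> x, y)) (cls_rep P n))),
     ip = (\<lambda>P Q. nlim A (\<lambda>n. pre_ip A E E' (cls_rep P n) (cls_rep Q n))),
     ract = (\<lambda>P a. tcls A E E' (\<lambda>n. map (\<lambda>(x, y). (x, ract E' y a)) (cls_rep P n))),
     lact = (\<lambda>a P. tcls A E E' (\<lambda>n. map (\<lambda>(x, y). (lact E a x, y)) (cls_rep P n)))\<rparr>"

definition elem_tensor :: "'a star_algebra \<Rightarrow> ('a, 'x) corr \<Rightarrow> ('a, 'y) corr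
    \<Rightarrow> 'x \<Rightarrow> 'y \<Rightarrow> ('x, 'y) tens" where
  "elem_tensor A E E' x y = tcls A E E' (\<lambda>n. [(x, y)])"

text \<open>
  The map \<open>f \<otimes> g\<close> from the tensor product of \<open>E\<close> and \<open>E'\<close> to that of \<open>G\<close> and \<open>G'\<close>, meaningful
  for bounded right linear \<open>f\<close> and bounded bilinear \<open>g\<close>.
\<close>

definition tensor_map :: "'a star_algebra \<Rightarrow> ('a, 'v) corr \<Rightarrow> ('a, 'w) corr
    \<Rightarrow> ('x \<Rightarrow> 'v) \<Rightarrow> ('y \<Rightarrow> 'w) \<Rightarrow> ('x, 'y) tens \<Rightarrow> ('v, 'w) tens" where
  "tensor_map A G G' f g P = tcls A G G' (\<lambda>n. map (map_prod f g) (cls_rep P n))"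

text \<open>
  The canonical unitary \<open>(E \<otimes> E') \<otimes> E'' \<rightarrow> E \<otimes> (E' \<otimes> E'')\<close>; it is determined by its values on
  elementary tensors.
\<close>

definition is_associator ::
  "'a star_algebra \<Rightarrow> ('a, 'x) corr \<Rightarrow> ('a, 'y) corr \<Rightarrow> ('a, 'z) corr
    \<Rightarrow> ((('x, 'y) tens, 'z) tens \<Rightarrow> ('x, ('y, 'z) tens) tens) \<Rightarrow> bool" where
  "is_associator A E E' E'' \<alpha> \<longleftrightarrow>
    bimodule_map A (itensor A (itensor A E E') E'') (itensor A E (itensor A E' E'')) \<alpha> \<and>
    isometric (itensor A (itensor A E E') E'') (itensor A E (itensor A E' E'')) \<alpha> \<and>
    \<alpha> ` carrier (itensor A (itensor A E E') E'') = carrier (itensor A E (itensor A E' E'')) \<and>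
    (\<forall>x\<in>carrier E. \<forall>y\<in>carrier E'. \<forall>z\<in>carrier E''.
      \<alpha> (elem_tensor A (itensor A E E') E'' (elem_tensor A E E' x y) z) =
      elem_tensor A E (itensor A E' E'') x (elem_tensor A E' E'' y z))"


section \<open>Weak unitary tensor functors\<close>

text \<open>
  Because \<open>F(1) = A\<close>, the elements of \<open>A\<close> and of all correspondences \<open>F(U)\<close> have a common type.
\<close>

locale weak_unitary_tensor_functor =
  strict_cstar_tensor_category C + cstar_algebra A
  for C :: "('o, 'm, 'z) tensor_category_scheme"
    and A :: "'a star_algebra"
    and F :: "'o \<Rightarrow> ('a, 'a) corr"
    and Fm :: "'m \<Rightarrow> 'a \<Rightarrow> 'a"
    and F2 :: "'o \<Rightarrow> 'o \<Rightarrow> ('a, 'a) tens \<Rightarrow> 'a" +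
  assumes F_corr: "U \<in> Ob C \<Longrightarrow> correspondence A (F U)"
    and Fm_morphism:
      "\<lbrakk>U \<in> Ob C; V \<in> Ob C; T \<in> mors C U V\<rbrakk> \<Longrightarrow> corr_morphism A (F U) (F V) (Fm T)"
    and Fm_id: "\<lbrakk>U \<in> Ob C; x \<in> carrier (F U)\<rbrakk> \<Longrightarrow> Fm (idm C U) x = x"
    and Fm_cmp:
      "\<lbrakk>U \<in> Ob C; V \<in> Ob C; W \<in> Ob C; S \<in> mors C V W; T \<in> mors C U V; x \<in> carrier (F U)\<rbrakk>
        \<Longrightarrow> Fm (S \<diamondop>\<^bsub>C\<^esub> T) x = Fm S (Fm T x)"
    and Fm_add:
      "\<lbrakk>U \<in> Ob C; V \<in> Ob C; S \<in> mors C U V; T \<in> mors C U V; x \<in> carrier (F U)\<rbrakk>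
        \<Longrightarrow> Fm (S \<oplus>\<^bsub>Mor C U V\<^esub> T) x = Fm S x \<oplus>\<^bsub>F V\<^esub> Fm T x"
    and Fm_smult:
      "\<lbrakk>U \<in> Ob C; V \<in> Ob C; T \<in> mors C U V; x \<in> carrier (F U)\<rbrakk>
        \<Longrightarrow> Fm (c \<odot>\<^bsub>Mor C U V\<^esub> T) x = c \<odot>\<^bsub>F V\<^esub> Fm T x"
    and F2_bimodule_map:
      "\<lbrakk>U \<in> Ob C; V \<in> Ob C\<rbrakk>
        \<Longrightarrow> bimodule_map A (itensor A (F U) (F V)) (F (tob C U V)) (F2 U V)"
    and F2_isometric:
      "\<lbrakk>U \<in> Ob C; V \<in> Ob C\<rbrakk>
        \<Longrightarrow> isometric (itensor A (F U) (F V)) (F (tob C U V)) (F2 U V)"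
    and F2_natural:
      "\<lbrakk>U \<in> Ob C; U' \<in> Ob C; V \<in> Ob C; V' \<in> Ob C; S \<in> mors C U U'; T \<in> mors C V V';
        t \<in> carrier (itensor A (F U) (F V))\<rbrakk>
        \<Longrightarrow> F2 U' V' (tensor_map A (F U') (F V') (Fm S) (Fm T) t) =
            Fm (tmor C S T) (F2 U V t)"
    and F_unit: "corr_eq A (F (unit C)) (corr_of_algebra A)"
    and Fm_dag:
      "\<lbrakk>U \<in> Ob C; V \<in> Ob C; T \<in> mors C U V\<rbrakk>
        \<Longrightarrow> is_adjoint (F U) (F V) (Fm T) (Fm (dag C T))"
    and F2_unit_left:
      "\<lbrakk>U \<in> Ob C; a \<in> carrier A; x \<in> carrier (F U)\<rbrakk>
        \<Longrightarrow> F2 (unit C) U (elem_tensor A (F (unit C)) (F U) a x) = lact (F U) a x"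
    and F2_unit_right:
      "\<lbrakk>U \<in> Ob C; x \<in> carrier (F U); a \<in> carrier A\<rbrakk>
        \<Longrightarrow> F2 U (unit C) (elem_tensor A (F U) (F (unit C)) x a) = ract (F U) x a"
    and F2_assoc:
      "\<lbrakk>U \<in> Ob C; V \<in> Ob C; W \<in> Ob C\<rbrakk>
        \<Longrightarrow> \<exists>\<alpha>. is_associator A (F U) (F V) (F W) \<alpha> \<and>
              (\<forall>t\<in>carrier (itensor A (itensor A (F U) (F V)) (F W)).
                F2 (tob C U V) W
                  (tensor_map A (F (tob C U V)) (F W) (F2 U V) (\<lambda>z. z) t) =
                F2 U (tob C V W)
                  (tensor_map A (F U) (F (tob C V W)) (\<lambda>x. x) (F2 V W) (\<alpha> t)))"
    and F2_left_adjointable: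
      "\<lbrakk>U \<in> Ob C; V \<in> Ob C; x \<in> carrier (F U)\<rbrakk>
        \<Longrightarrow> adjointable (F V) (F (tob C U V)) (\<lambda>y. F2 U V (elem_tensor A (F U) (F V) x y))"
    and F2_left_adjoint:
      "\<lbrakk>U \<in> Ob C; V \<in> Ob C; W \<in> Ob C; x \<in> carrier (F U);
        t \<in> carrier (itensor A (F (tob C U V)) (F W))\<rbrakk>
        \<Longrightarrow> adjoint_of (F (tob C V W)) (F (tob C U (tob C V W)))
              (\<lambda>y. F2 U (tob C V W) (elem_tensor A (F U) (F (tob C V W)) x y))
              (F2 (tob C U V) W t) =
            F2 V W
              (tensor_map A (F V) (F W)
                (adjoint_of (F V) (F (tob C U V))
                  (\<lambda>y. F2 U V (elem_tensor A (F U) (F V) x y)))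
                (\<lambda>z. z) t)"


section \<open>The functor defined by an object of a module category\<close>

definition module_functor_ob ::
  "('p, 'n, 'o, 'm, 'y) module_category_scheme \<Rightarrow> ('o, 'm, 'z) tensor_category_scheme
    \<Rightarrow> 'p \<Rightarrow> 'o \<Rightarrow> ('n, 'n) corr" where
  "module_functor_ob \<M> C M U =
    \<lparr>carrier = mors \<M> M (actob \<M> M U), monoid.mult = undefined, one = undefined,
     ring.zero = \<zero>\<^bsub>Mor \<M> M (actob \<M> M U)\<^esub>,
     add = add (Mor \<M> M (actob \<M> M U)),
     smult = smult (Mor \<M> M (actob \<M> M U)),
     ip = (\<lambda>X Y. dag \<M> X \<diamondop>\<^bsub>\<M>\<^esub> Y),
     ract = (\<lambda>X a. X \<diamondop>\<^bsub>\<M>\<^esub> a),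
     lact = (\<lambda>a X. actmor \<M> a (idm C U) \<diamondop>\<^bsub>\<M>\<^esub> X)\<rparr>"

definition module_functor_mor ::
  "('p, 'n, 'o, 'm, 'y) module_category_scheme \<Rightarrow> 'p \<Rightarrow> 'm \<Rightarrow> 'n \<Rightarrow> 'n" where
  "module_functor_mor \<M> M T X = actmor \<M> (idm \<M> M) T \<diamondop>\<^bsub>\<M>\<^esub> X"

end

theory Submission
  imports Defs
begin

text \<open>The obstacle is the completion. Elements of \<open>itensor\<close> are classes of Cauchy
  sequences and its operations choose representatives, so a direct proof that it is a Hilbert module
  would be laborious. Instead each statement about it is carried along the injective map
  \<open>realize\<close> into a space of morphisms, where it becomes an identity between
  compositions; strictness makes the targets of the two bracketings literally equal. The norm bound
  has to be derived, because the axioms of a bilinear functor are algebraic and contain no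
  continuity. It makes the left action of A continuous, and it is decisive where a tensor factor is
  itself an element of a completion: such a factor P is only a limit of finite sums, and membership
  of (P \<otimes> \<iota>)Z in a closed span survives this limit because P \<mapsto> (P \<otimes>
  \<iota>)Z is continuous.\<close>

text \<open>
  For formal sums \<open>s = \<Sum> X\<^sub>i \<otimes> Y\<^sub>i\<close> of elements of \<open>F(U)\<close> and \<open>F(V)\<close> put
  \<open>ev(s) = \<Sum> (X\<^sub>i \<otimes> \<iota>)Y\<^sub>i\<close>; since \<open>\<otimes>\<close> is a *-functor, \<open>ev(s)\<^sup>*ev(t)\<close> is exactly the
  semi-inner product \<open>\<langle>s, t\<rangle>\<close>.  Hence \<open>ev\<close> identifies \<open>F(U) \<otimes>\<^sub>A F(V)\<close> isometrically with
  a closed subspace of \<open>F(U \<otimes> V)\<close>, and \<open>F\<^sub>2\<close> is this identification.  For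
  associativity, both triple tensor products are identified with the closed span of the elements
  \<open>(X \<otimes> \<iota>)(Y \<otimes> \<iota>)Z\<close> of \<open>F(U \<otimes> V \<otimes> W)\<close>, and comparing the two identifications yields
  the associator.  That the two closed spans agree rests on the bound \<open>\<parallel>X \<otimes> \<iota>\<parallel> \<le> \<parallel>X\<parallel>\<close>, an
  instance of the contractivity of *-homomorphisms.
\<close>

section \<open>Normed spaces on carrier sets\<close>

text \<open>The locale facts speak of the record \<open>complex_ring\<close>. Its operations are
  unfolded here once, so that later steps calculate with ordinary complex numbers.\<close>

lemma module_complex_ringD:
  assumes "module complex_ring V"
  shows "abelian_group V"
    and "x \<in> carrier V \<Longrightarrow> c \<odot>\<^bsub>V\<^esub> x \<in> carrier V"
    and "\<lbrakk>x \<in> carrier V; y \<in> carrier V\<rbrakk> \<Longrightarrow> c \<odot>\<^bsub>V\<^esub> (x \<oplus>\<^bsub>V\<^esub> y) = c \<odot>\<^bsub>V\<^esub> x \<oplus>\<^bsub>V\<^esub> c \<odot>\<^bsub>V\<^esub> y"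
    and "x \<in> carrier V \<Longrightarrow> (c + d) \<odot>\<^bsub>V\<^esub> x = c \<odot>\<^bsub>V\<^esub> x \<oplus>\<^bsub>V\<^esub> d \<odot>\<^bsub>V\<^esub> x"
    and "x \<in> carrier V \<Longrightarrow> (c * d) \<odot>\<^bsub>V\<^esub> x = c \<odot>\<^bsub>V\<^esub> (d \<odot>\<^bsub>V\<^esub> x)"
    and "x \<in> carrier V \<Longrightarrow> 1 \<odot>\<^bsub>V\<^esub> x = x"
proof -
  interpret module complex_ring V by fact
  show "abelian_group V" ..
  show "x \<in> carrier V \<Longrightarrow> c \<odot>\<^bsub>V\<^esub> x \<in> carrier V"
    using smult_closed[of c x] by (simp add: complex_ring_def)
  show "\<lbrakk>x \<in> carrier V; y \<in> carrier V\<rbrakk> \<Longrightarrow> c \<odot>\<^bsub>V\<^esub> (x \<oplus>\<^bsub>V\<^esub> y) = c \<odot>\<^bsub>V\<^esub> x \<oplus>\<^bsub>V\<^esub> c \<odot>\<^bsub>V\<^esub> y"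
    using smult_r_distr[of c x y] by (simp add: complex_ring_def)
  show "x \<in> carrier V \<Longrightarrow> (c + d) \<odot>\<^bsub>V\<^esub> x = c \<odot>\<^bsub>V\<^esub> x \<oplus>\<^bsub>V\<^esub> d \<odot>\<^bsub>V\<^esub> x"
    using smult_l_distr[of c d x] by (simp add: complex_ring_def)
  show "x \<in> carrier V \<Longrightarrow> (c * d) \<odot>\<^bsub>V\<^esub> x = c \<odot>\<^bsub>V\<^esub> (d \<odot>\<^bsub>V\<^esub> x)"
    using smult_assoc1[of c d x] by (simp add: complex_ring_def)
  show "x \<in> carrier V \<Longrightarrow> 1 \<odot>\<^bsub>V\<^esub> x = x"
    using smult_one[of x] by (simp add: complex_ring_def)
qed

text \<open>The norm is a parameter and not a record field because two kinds of norm are served: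
  \<open>nrm A\<close> on a C*-algebra, and \<open>hnorm A G\<close> on a Hilbert module, where it
  is derived from the inner product.\<close>

locale normed_vector_space_on = abelian_group V
  for V :: "(complex, 'x, 'b) module_scheme" (structure) +
  fixes N :: "'x \<Rightarrow> real"
  assumes complex_module: "module complex_ring V"
    and N_nonneg: "x \<in> carrier V \<Longrightarrow> 0 \<le> N x"
    and N_eq_0_iff: "x \<in> carrier V \<Longrightarrow> N x = 0 \<longleftrightarrow> x = \<zero>"
    and N_triangle: "\<lbrakk>x \<in> carrier V; y \<in> carrier V\<rbrakk> \<Longrightarrow> N (x \<oplus> y) \<le> N x + N y"
    and N_smult: "x \<in> carrier V \<Longrightarrow> N (c \<odot> x) = cmod c * N x"
begin

lemmas smult_closed = module_complex_ringD(2)[OF complex_module]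
  and smult_add = module_complex_ringD(3)[OF complex_module]
  and add_smult = module_complex_ringD(4)[OF complex_module]
  and mult_smult = module_complex_ringD(5)[OF complex_module]
  and smult_one = module_complex_ringD(6)[OF complex_module]

lemma zero_smult: "x \<in> carrier V \<Longrightarrow> 0 \<odot> x = \<zero>"
  using add_smult[of x 0 0] smult_closed[of x 0]
  by (metis add.r_cancel_one' add_0)

lemma minus_eq_smult: "x \<in> carrier V \<Longrightarrow> \<ominus> x = (-1) \<odot> x"
  using add_smult[of x "-1" 1] smult_closed[of x "-1"]
  by (simp add: smult_one zero_smult minus_equality)

lemma smult_minus: "x \<in> carrier V \<Longrightarrow> c \<odot> (\<ominus> x) = \<ominus> (c \<odot> x)"
  by (simp add: minus_eq_smult smult_closed flip: mult_smult)

lemma N_zero: "N \<zero> = 0"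
  by (simp add: N_eq_0_iff)

lemma N_minus: "x \<in> carrier V \<Longrightarrow> N (\<ominus> x) = N x"
  by (simp add: minus_eq_smult N_smult)

lemma minus_self: "x \<in> carrier V \<Longrightarrow> x \<ominus> x = \<zero>"
  by (simp add: minus_eq r_neg)

lemma minus_eq_zeroD: "\<lbrakk>x \<in> carrier V; y \<in> carrier V; x \<ominus> y = \<zero>\<rbrakk> \<Longrightarrow> x = y"
  by (metis a_inv_closed minus_eq minus_equality minus_minus)

lemma minus_commute: "\<lbrakk>x \<in> carrier V; y \<in> carrier V\<rbrakk> \<Longrightarrow> \<ominus> (x \<ominus> y) = y \<ominus> x"
  by (simp add: minus_eq minus_add a_comm)

lemma minus_split:
  assumes "x \<in> carrier V" "y \<in> carrier V" "z \<in> carrier V"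
  shows "x \<ominus> z = (x \<ominus> y) \<oplus> (y \<ominus> z)"
  using assms by (simp add: minus_eq a_assoc r_neg1)

lemma minus_add_add:
  assumes "x \<in> carrier V" "y \<in> carrier V" "x' \<in> carrier V" "y' \<in> carrier V"
  shows "(x \<oplus> y) \<ominus> (x' \<oplus> y') = (x \<ominus> x') \<oplus> (y \<ominus> y')"
  using assms by (simp add: minus_eq minus_add a_ac)

lemma N_minus_commute: "\<lbrakk>x \<in> carrier V; y \<in> carrier V\<rbrakk> \<Longrightarrow> N (x \<ominus> y) = N (y \<ominus> x)"
  by (metis N_minus minus_closed minus_commute)

lemma N_minus_triangle:
  "\<lbrakk>x \<in> carrier V; y \<in> carrier V; z \<in> carrier V\<rbrakk> \<Longrightarrow> N (x \<ominus> z) \<le> N (x \<ominus> y) + N (y \<ominus> z)"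
  using N_triangle[of "x \<ominus> y" "y \<ominus> z"] by (simp flip: minus_split)

lemma N_minus_le: "\<lbrakk>x \<in> carrier V; y \<in> carrier V\<rbrakk> \<Longrightarrow> N (x \<ominus> y) \<le> N x + N y"
  using N_triangle[of x "\<ominus> y"] by (simp add: minus_eq N_minus)

lemma smult_diff: "\<lbrakk>x \<in> carrier V; y \<in> carrier V\<rbrakk> \<Longrightarrow> c \<odot> (x \<ominus> y) = c \<odot> x \<ominus> c \<odot> y"
  by (simp add: minus_eq smult_add smult_minus)

text \<open>Convergence is expressed through norms of differences, which are meaningful only on the
  carrier. Membership of the terms and of the limit is therefore part of the notion.\<close>

definition converges :: "(nat \<Rightarrow> 'x) \<Rightarrow> 'x \<Rightarrow> bool" where
  "converges s x \<longleftrightarrow> (\<forall>n. s n \<in> carrier V) \<and> x \<in> carrier V \<and> (\<lambda>n. N (s n \<ominus> x)) \<longlonglongrightarrow> 0"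

definition cauchy :: "(nat \<Rightarrow> 'x) \<Rightarrow> bool" where
  "cauchy s \<longleftrightarrow> (\<forall>n. s n \<in> carrier V) \<and> (\<forall>e>0. \<exists>K. \<forall>m\<ge>K. \<forall>n\<ge>K. N (s m \<ominus> s n) < e)"

lemma convergesD: "converges s x \<Longrightarrow> s n \<in> carrier V" "converges s x \<Longrightarrow> x \<in> carrier V"
  by (auto simp: converges_def)

lemma convergesI:
  assumes "\<And>n. s n \<in> carrier V" "x \<in> carrier V" "\<And>n. N (s n \<ominus> x) \<le> f n" "f \<longlonglongrightarrow> 0"
  shows "converges s x"
  unfolding converges_def
  using assms by (intro conjI allI tendsto_sandwich[OF _ _ tendsto_const assms(4)] always_eventually)
    (auto intro: N_nonneg)

lemma converges_const: "x \<in> carrier V \<Longrightarrow> converges (\<lambda>n. x) x"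
  by (simp add: converges_def minus_self N_zero)

lemma converges_close:
  assumes "converges s x" "\<And>n. t n \<in> carrier V" "(\<lambda>n. N (s n \<ominus> t n)) \<longlonglongrightarrow> 0"
  shows "converges t x"
proof (rule convergesI[where f = "\<lambda>n. N (s n \<ominus> t n) + N (s n \<ominus> x)"])
  show "N (t n \<ominus> x) \<le> N (s n \<ominus> t n) + N (s n \<ominus> x)" for n
    using N_minus_triangle[of "t n" "s n" x] assms(1,2)
    by (metis convergesD N_minus_commute)
  show "(\<lambda>n. N (s n \<ominus> t n) + N (s n \<ominus> x)) \<longlonglongrightarrow> 0"
    using tendsto_add[OF assms(3), of "\<lambda>n. N (s n \<ominus> x)" 0] assms(1) by (simp add: converges_def)
qed (use assms in \<open>auto simp: converges_def\<close>)

text \<open>Cauchy sequences will be identified when their distance tends to 0; for convergent ones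
  this means equal limits. The case of equal sequences is uniqueness of limits.\<close>

lemma converges_minus_iff:
  assumes "converges s x" "converges t y"
  shows "(\<lambda>n. N (s n \<ominus> t n)) \<longlonglongrightarrow> 0 \<longleftrightarrow> x = y"
proof -
  note c = convergesD[OF assms(1)] convergesD[OF assms(2)]
  have b: "(\<lambda>n. N (s n \<ominus> x) + N (t n \<ominus> y)) \<longlonglongrightarrow> 0"
    using tendsto_add[of "\<lambda>n. N (s n \<ominus> x)" 0 _ "\<lambda>n. N (t n \<ominus> y)" 0] assms
    by (simp add: converges_def)
  show ?thesis
  proof
    assume l: "(\<lambda>n. N (s n \<ominus> t n)) \<longlonglongrightarrow> 0"
    have *: "N (x \<ominus> y) \<le> N (s n \<ominus> t n) + (N (s n \<ominus> x) + N (t n \<ominus> y))" for n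
    proof -
      have "N (x \<ominus> y) \<le> N (x \<ominus> s n) + (N (s n \<ominus> t n) + N (t n \<ominus> y))"
        using N_minus_triangle[of x "s n" y] N_minus_triangle[of "s n" "t n" y] c by auto
      then show ?thesis using N_minus_commute[of x "s n"] c by simp
    qed
    have "N (x \<ominus> y) \<le> 0 + 0"
      by (rule LIMSEQ_le_const[OF tendsto_add[OF l b]]) (use * in blast)
    then have "N (x \<ominus> y) = 0"
      using N_nonneg[OF minus_closed[OF c(2) c(4)]] by linarith
    then have "x \<ominus> y = \<zero>"
      using N_eq_0_iff[OF minus_closed[OF c(2) c(4)]] by blast
    then show "x = y"
      by (rule minus_eq_zeroD[OF c(2) c(4)])
  next
    assume [simp]: "x = y"
    show "(\<lambda>n. N (s n \<ominus> t n)) \<longlonglongrightarrow> 0"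
    proof (rule tendsto_sandwich[OF _ _ tendsto_const b]; intro always_eventually allI)
      show "N (s n \<ominus> t n) \<le> N (s n \<ominus> x) + N (t n \<ominus> y)" for n
        using N_minus_triangle[of "s n" x "t n"] N_minus_commute[of x "t n"] c by simp
    qed (use c in \<open>auto intro: N_nonneg\<close>)
  qed
qed

lemma converges_unique: "\<lbrakk>converges s x; converges s y\<rbrakk> \<Longrightarrow> x = y"
  using converges_minus_iff[of s x s y]
  by (simp add: convergesD minus_self N_zero)

lemma converges_add:
  assumes "converges s x" "converges t y"
  shows "converges (\<lambda>n. s n \<oplus> t n) (x \<oplus> y)"
proof (rule convergesI[where f = "\<lambda>n. N (s n \<ominus> x) + N (t n \<ominus> y)"])
  note c = convergesD[OF assms(1)] convergesD[OF assms(2)]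
  show "N ((s n \<oplus> t n) \<ominus> (x \<oplus> y)) \<le> N (s n \<ominus> x) + N (t n \<ominus> y)" for n
    using c by (simp add: minus_add_add N_triangle)
  show "(\<lambda>n. N (s n \<ominus> x) + N (t n \<ominus> y)) \<longlonglongrightarrow> 0"
    using tendsto_add[of "\<lambda>n. N (s n \<ominus> x)" 0 _ "\<lambda>n. N (t n \<ominus> y)" 0] assms
    by (simp add: converges_def)
qed (use assms in \<open>auto simp: converges_def\<close>)

lemma converges_smult: "converges s x \<Longrightarrow> converges (\<lambda>n. c \<odot> s n) (c \<odot> x)"
  by (auto simp: converges_def smult_closed N_smult tendsto_mult_right_zero simp flip: smult_diff)

lemma converges_Suc: "converges s x \<Longrightarrow> converges (\<lambda>n. s (Suc n)) x"
  using LIMSEQ_Suc[of "\<lambda>n. N (s n \<ominus> x)" 0] by (auto simp: converges_def)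

lemma converges_tendsto_N:
  assumes "converges s x"
  shows "(\<lambda>n. N (s n)) \<longlonglongrightarrow> N x"
proof (rule LIM_zero_cancel, rule Lim_null_comparison)
  have "\<bar>N (s n) - N x\<bar> \<le> N (s n \<ominus> x)" for n
  proof -
    note c = convergesD[OF assms]
    have "(s n \<ominus> x) \<oplus> x = s n" "(x \<ominus> s n) \<oplus> s n = x"
      using c by (simp_all add: minus_eq a_assoc l_neg)
    then have "N (s n) \<le> N (s n \<ominus> x) + N x" "N x \<le> N (x \<ominus> s n) + N (s n)"
      using N_triangle[of "s n \<ominus> x" x] N_triangle[of "x \<ominus> s n" "s n"] c by simp_all
    then show ?thesis using N_minus_commute[of x "s n"] c by auto
  qed
  then show "\<forall>\<^sub>F n in sequentially. norm (N (s n) - N x) \<le> N (s n \<ominus> x)" by simp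
qed (use assms in \<open>auto simp: converges_def\<close>)

lemma converges_cauchy:
  assumes "converges s x"
  shows "cauchy s"
  unfolding cauchy_def
proof (intro conjI allI impI)
  note c = convergesD[OF assms]
  fix e :: real assume "e > 0"
  then obtain K where K: "\<And>n. n \<ge> K \<Longrightarrow> norm (N (s n \<ominus> x) - 0) < e / 2"
    using assms unfolding converges_def by (meson half_gt_zero LIMSEQ_D)
  have "N (s m \<ominus> s n) < e" if "m \<ge> K" "n \<ge> K" for m n
    using N_minus_triangle[of "s m" x "s n"] N_minus_commute[of x "s n"] K[OF that(1)] K[OF that(2)] c
    by auto
  then show "\<exists>K. \<forall>m\<ge>K. \<forall>n\<ge>K. N (s m \<ominus> s n) < e" by blast
qed (use assms convergesD in auto)

end

lemma normed_vector_space_onI: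
  assumes "banach_space_on V"
  shows "normed_vector_space_on V (nrm V)"
proof -
  interpret banach_space_on V by fact
  interpret abelian_group V using module_complex_ringD(1)[OF complex_module] .
  show ?thesis
    by (intro normed_vector_space_on.intro normed_vector_space_on_axioms.intro abelian_group_axioms
      complex_module nrm_nonneg nrm_eq_0_iff nrm_triangle nrm_smult)
qed

text \<open>The bound is applied to \<open>s n\<close> minus \<open>x\<close>. This serves for the
  two actions of A and for the maps between ambient correspondences in
  \<open>tensor_map_realize\<close>.\<close>

lemma converges_image:
  assumes "normed_vector_space_on V N" "normed_vector_space_on W N'"
    and T: "T \<in> carrier V \<rightarrow> carrier W"
    and diff: "\<And>x y. \<lbrakk>x \<in> carrier V; y \<in> carrier V\<rbrakk> \<Longrightarrow> T (x \<ominus>\<^bsub>V\<^esub> y) = T x \<ominus>\<^bsub>W\<^esub> T y"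
    and bound: "\<And>x. x \<in> carrier V \<Longrightarrow> N' (T x) \<le> K * N x"
    and s: "normed_vector_space_on.converges V N s x"
  shows "normed_vector_space_on.converges W N' (\<lambda>n. T (s n)) (T x)"
proof -
  interpret V: normed_vector_space_on V N by fact
  interpret W: normed_vector_space_on W N' by fact
  note c = V.convergesD[OF s]
  show ?thesis
  proof (rule W.convergesI[where f = "\<lambda>n. K * N (s n \<ominus>\<^bsub>V\<^esub> x)"])
    show "N' (T (s n) \<ominus>\<^bsub>W\<^esub> T x) \<le> K * N (s n \<ominus>\<^bsub>V\<^esub> x)" for n
      using bound[of "s n \<ominus>\<^bsub>V\<^esub> x"] c by (simp add: diff)
    show "(\<lambda>n. K * N (s n \<ominus>\<^bsub>V\<^esub> x)) \<longlonglongrightarrow> 0"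
      using s by (auto simp: V.converges_def intro: tendsto_mult_right_zero)
  qed (use c T in auto)
qed

text \<open>T 0 equals its own double, and T(-x) + T x = T 0. Limits involve differences, whereas
  the maps at hand are known to respect sums.\<close>

lemma additive_diff:
  assumes "module complex_ring V" "module complex_ring W"
    and T: "T \<in> carrier V \<rightarrow> carrier W"
    and "\<And>x y. \<lbrakk>x \<in> carrier V; y \<in> carrier V\<rbrakk> \<Longrightarrow> T (x \<oplus>\<^bsub>V\<^esub> y) = T x \<oplus>\<^bsub>W\<^esub> T y"
  shows "T \<zero>\<^bsub>V\<^esub> = \<zero>\<^bsub>W\<^esub>"
    and "x \<in> carrier V \<Longrightarrow> T (\<ominus>\<^bsub>V\<^esub> x) = \<ominus>\<^bsub>W\<^esub> T x"
    and "\<lbrakk>x \<in> carrier V; y \<in> carrier V\<rbrakk> \<Longrightarrow> T (x \<ominus>\<^bsub>V\<^esub> y) = T x \<ominus>\<^bsub>W\<^esub> T y"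
proof -
  interpret V: abelian_group V using module_complex_ringD(1)[OF assms(1)] .
  interpret W: abelian_group W using module_complex_ringD(1)[OF assms(2)] .
  show z: "T \<zero>\<^bsub>V\<^esub> = \<zero>\<^bsub>W\<^esub>"
    by (metis V.l_zero V.zero_closed W.add.r_cancel_one' T assms(4) funcset_mem)
  show m: "T (\<ominus>\<^bsub>V\<^esub> x) = \<ominus>\<^bsub>W\<^esub> T x" if "x \<in> carrier V" for x
  proof -
    have "T (\<ominus>\<^bsub>V\<^esub> x) \<oplus>\<^bsub>W\<^esub> T x = \<zero>\<^bsub>W\<^esub>"
      using assms(4)[of "\<ominus>\<^bsub>V\<^esub> x" x] that by (simp add: z V.l_neg)
    then show ?thesis
      using that funcset_mem[OF T that] funcset_mem[OF T V.a_inv_closed[OF that]]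
      by (metis W.minus_equality)
  qed
  show "\<lbrakk>x \<in> carrier V; y \<in> carrier V\<rbrakk> \<Longrightarrow> T (x \<ominus>\<^bsub>V\<^esub> y) = T x \<ominus>\<^bsub>W\<^esub> T y"
    by (simp add: V.minus_eq W.minus_eq assms(4) m)
qed

section \<open>Contractivity of *-homomorphisms\<close>

context normed_vector_space_on
begin

lemma cauchy_convergent:
  assumes "cauchy_complete (carrier V) (\<lambda>x y. N (x \<ominus> y))" "cauchy s"
  shows "\<exists>x. converges s x"
proof -
  have s: "\<forall>n. s n \<in> carrier V" "\<forall>e>0. \<exists>K. \<forall>m\<ge>K. \<forall>n\<ge>K. N (s m \<ominus> s n) < e"
    using assms(2) by (auto simp: cauchy_def)
  then obtain x where "x \<in> carrier V" "(\<lambda>n. N (s n \<ominus> x)) \<longlonglongrightarrow> 0"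
    using assms(1)[unfolded cauchy_complete_def, THEN spec[of _ s]] by blast
  then show ?thesis using s(1) unfolding converges_def by blast
qed

lemma cauchy_geometric:
  assumes s: "\<And>n. s n \<in> carrier V" and step: "\<And>n. N (s (Suc n) \<ominus> s n) \<le> r ^ n"
    and r: "0 \<le> r" "r < 1"
  shows "cauchy s"
proof -
  \<comment> \<open>The right-hand side is the partial geometric sum r^n + ... + r^(n+k-1), kept in
    closed form so that the induction telescopes.\<close>
  have le: "N (s (n + k) \<ominus> s n) \<le> (r ^ n - r ^ (n + k)) / (1 - r)" for n k
  proof (induction k)
    case 0
    then show ?case using s by (simp add: minus_self N_zero)
  next
    case (Suc k)
    have "N (s (n + Suc k) \<ominus> s n) \<le> N (s (Suc (n + k)) \<ominus> s (n + k)) + N (s (n + k) \<ominus> s n)"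
      using N_minus_triangle[OF s s s] by simp
    also have "\<dots> \<le> r ^ (n + k) + (r ^ n - r ^ (n + k)) / (1 - r)"
      using step Suc.IH by (intro add_mono)
    also have "\<dots> = (r ^ n - r ^ (n + Suc k)) / (1 - r)"
      using r by (simp add: field_simps)
    finally show ?case .
  qed
  have close: "N (s m \<ominus> s n) \<le> r ^ n / (1 - r)" if "m \<ge> n" for m n
  proof -
    obtain k where "m = n + k" using \<open>m \<ge> n\<close> le_Suc_ex by blast
    then have "N (s m \<ominus> s n) \<le> (r ^ n - r ^ (n + k)) / (1 - r)"
      using le[of n k] by simp
    also have "\<dots> \<le> r ^ n / (1 - r)"
      using r by (intro divide_right_mono) auto
    finally show ?thesis .
  qed
  show ?thesis
    unfolding cauchy_def
  proof (intro conjI allI impI)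
    fix e :: real assume "e > 0"
    then have "e * (1 - r) > 0" using r by simp
    then obtain K where K: "r ^ K < e * (1 - r)"
      using real_arch_pow_inv[of "e * (1 - r)" r] r by blast
    have "N (s m \<ominus> s n) < e" if "m \<ge> K" "n \<ge> K" "m \<ge> n" for m n
    proof -
      have "r ^ n \<le> r ^ K" using that r by (intro power_decreasing) auto
      then have "r ^ n / (1 - r) < e" using K r by (simp add: field_simps)
      then show ?thesis using close[OF \<open>m \<ge> n\<close>] by linarith
    qed
    then have "N (s m \<ominus> s n) < e" if "m \<ge> K" "n \<ge> K" for m n
      using that N_minus_commute[OF s s, of m n] by (metis nat_le_linear)
    then show "\<exists>K. \<forall>m\<ge>K. \<forall>n\<ge>K. N (s m \<ominus> s n) < e" by blast
  qed (rule s)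
qed

end

section \<open>Involution, limits and square roots in a C*-algebra\<close>

context cstar_algebra
begin

sublocale alg: ring A
  by (rule ring)

sublocale alg: normed_vector_space_on A "nrm A"
  by (rule normed_vector_space_onI[OF banach])

text \<open>The C*-identity and submultiplicativity bound the square of \<open>nrm A b\<close> by
  \<open>nrm A (star A b) * nrm A b\<close>. Cancel one factor and apply the result to an element
  and to its adjoint.\<close>

lemma nrm_star: "a \<in> carrier A \<Longrightarrow> nrm A (star A a) = nrm A a"
proof -
  have le: "nrm A b \<le> nrm A (star A b)" if b: "b \<in> carrier A" for b
  proof (cases "nrm A b = 0")
    case True
    then show ?thesis using alg.N_nonneg[OF star_closed[OF b]] by simp
  next
    case False
    have "nrm A b * nrm A b \<le> nrm A (star A b) * nrm A b"
      using nrm_mult[OF star_closed[OF b] b] cstar_identity[OF b] by (simp add: power2_eq_square)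
    then show ?thesis using False alg.N_nonneg[OF b] by simp
  qed
  show "a \<in> carrier A \<Longrightarrow> nrm A (star A a) = nrm A a"
    using le[of a] le[of "star A a"] star_closed[of a] star_star[of a] by simp
qed

text \<open>Evaluate the adjoint of \<open>star A \<one> \<otimes> \<one>\<close> in two
  ways.\<close>

lemma star_one: "star A \<one> = \<one>"
proof -
  have "star A \<one> = star A (star A \<one> \<otimes> \<one>)"
    by (subst star_mult) (simp_all add: star_closed star_star)
  then show ?thesis by (simp add: star_closed star_star)
qed

lemma nrm_one_le: "nrm A \<one> \<le> 1"
proof -
  have "nrm A \<one> = nrm A \<one> * nrm A \<one>"
    using cstar_identity[of \<one>] by (simp add: star_one power2_eq_square)
  then show ?thesis by (metis mult_cancel_right2 zero_le_one order.refl)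
qed

lemma star_diff:
  assumes "a \<in> carrier A" "b \<in> carrier A"
  shows "star A (a \<ominus> b) = star A a \<ominus> star A b"
  using assms by (simp add: alg.minus_eq star_add star_closed alg.minus_eq_smult star_smult alg.smult_closed)

lemma converges_star:
  assumes "alg.converges s a"
  shows "alg.converges (\<lambda>n. star A (s n)) (star A a)"
  using assms by (auto simp: alg.converges_def star_closed nrm_star simp flip: star_diff)

lemma converges_mult:
  assumes s: "alg.converges s a" and t: "alg.converges t b"
  shows "alg.converges (\<lambda>n. s n \<otimes> t n) (a \<otimes> b)"
proof (rule alg.convergesI)
  note c = alg.convergesD[OF s] alg.convergesD[OF t]
  show "s n \<otimes> t n \<in> carrier A" "a \<otimes> b \<in> carrier A" for n
    using c by auto
  show "nrm A (s n \<otimes> t n \<ominus> a \<otimes> b)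
      \<le> nrm A (s n \<ominus> a) * nrm A (t n) + nrm A a * nrm A (t n \<ominus> b)" for n
  proof -
    have "s n \<otimes> t n \<ominus> a \<otimes> b = (s n \<ominus> a) \<otimes> t n \<oplus> a \<otimes> (t n \<ominus> b)"
      using c(1)[of n] c(2) c(3)[of n] c(4)
      by (simp add: alg.minus_eq alg.l_distr alg.r_distr alg.l_minus alg.r_minus alg.a_assoc alg.r_neg1)
    then show ?thesis
      using alg.N_triangle[of "(s n \<ominus> a) \<otimes> t n" "a \<otimes> (t n \<ominus> b)"]
        nrm_mult[of "s n \<ominus> a" "t n"] nrm_mult[of a "t n \<ominus> b"] c by auto
  qed
  show "(\<lambda>n. nrm A (s n \<ominus> a) * nrm A (t n) + nrm A a * nrm A (t n \<ominus> b)) \<longlonglongrightarrow> 0"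
    using tendsto_add[OF tendsto_mult[OF _ alg.converges_tendsto_N[OF t], of "\<lambda>n. nrm A (s n \<ominus> a)" 0]
        tendsto_mult_right_zero[of "\<lambda>n. nrm A (t n \<ominus> b)" _ "nrm A a"]] s t
    by (simp add: alg.converges_def)
qed

text \<open>The root is d = 1 - e where 2e = k + e^2, since then (1 - e)^2 = 1 - k. The map e
  \<mapsto> (k + e^2)/2 preserves the ball of radius r = nrm k < 1 and has Lipschitz constant r
  there, so e is the limit of its iterates from 0. These are real polynomials in k, hence
  selfadjoint and commuting with whatever commutes with k; both properties pass to the
  limit.\<close>

lemma sqrt_one_minus:
  assumes k: "k \<in> carrier A" "star A k = k" "nrm A k < 1"
    and h: "h \<in> carrier A" "h \<otimes> k = k \<otimes> h"
  obtains d where "d \<in> carrier A" "star A d = d" "d \<otimes> d = \<one> \<ominus> k" "h \<otimes> d = d \<otimes> h"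
proof -
  define r where "r = nrm A k"
  have r: "0 \<le> r" "r < 1" using k by (auto simp: r_def alg.N_nonneg)
  define step where "step e = (1 / 2) \<odot> (k \<oplus> e \<otimes> e)" for e
  define s where "s n = (step ^^ n) \<zero>" for n
  have s_Suc: "s (Suc n) = step (s n)" for n by (simp add: s_def)
  have inv: "s n \<in> carrier A \<and> star A (s n) = s n \<and> h \<otimes> s n = s n \<otimes> h \<and> nrm A (s n) \<le> r" for n
  proof (induction n)
    case 0
    have "star A \<zero> = \<zero>"
      using star_smult[of \<zero> 0] by (simp add: alg.zero_smult star_closed)
    then show ?case using r h by (simp add: s_def alg.N_zero)
  next
    case (Suc n)
    then have s: "s n \<in> carrier A" "star A (s n) = s n" "h \<otimes> s n = s n \<otimes> h" "nrm A (s n) \<le> r"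
      by auto
    have "h \<otimes> (s n \<otimes> s n) = (s n \<otimes> s n) \<otimes> h"
      using s h by (metis alg.m_assoc)
    then have "h \<otimes> step (s n) = step (s n) \<otimes> h"
      using s h k by (simp add: step_def smult_mult_left smult_mult_right alg.l_distr alg.r_distr)
    moreover have "nrm A (step (s n)) \<le> r"
    proof -
      have "nrm A (k \<oplus> s n \<otimes> s n) \<le> nrm A k + nrm A (s n) * nrm A (s n)"
        using alg.N_triangle[of k "s n \<otimes> s n"] nrm_mult[OF s(1) s(1)] s k by simp
      \<comment> \<open>One factor \<open>nrm A (s n)\<close> is estimated by r and the other by 1;
        the factor 1/2 in \<open>step\<close> then brings r + r back to r.\<close>
      also have "\<dots> \<le> r + r * 1"
        unfolding r_def[symmetric] using s r by (intro add_mono mult_mono) (auto simp: alg.N_nonneg)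
      finally show ?thesis
        using s k by (simp add: step_def alg.N_smult)
    qed
    ultimately show ?case
      using s k by (simp add: s_Suc step_def star_smult star_add star_mult alg.smult_closed)
  qed
  then have sc: "s n \<in> carrier A" and sn: "nrm A (s n) \<le> r" for n by auto
  have lip: "nrm A (step (s m) \<ominus> step (s n)) \<le> r * nrm A (s m \<ominus> s n)" for m n
  proof -
    have "step (s m) \<ominus> step (s n) = (1 / 2) \<odot> ((k \<oplus> s m \<otimes> s m) \<ominus> (k \<oplus> s n \<otimes> s n))"
      using sc k by (simp add: step_def alg.smult_diff)
    \<comment> \<open>This form of a difference of squares does not require \<open>s m\<close> and
      \<open>s n\<close> to commute. Each summand costs a factor r, and the 1/2 in
      \<open>step\<close> halves their sum.\<close>
    moreover have "(k \<oplus> s m \<otimes> s m) \<ominus> (k \<oplus> s n \<otimes> s n) = s m \<otimes> (s m \<ominus> s n) \<oplus> (s m \<ominus> s n) \<otimes> s n"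
      using sc[of m] sc[of n] k
      by (simp add: alg.minus_add_add alg.minus_self)
        (simp add: alg.minus_eq alg.l_distr alg.r_distr alg.l_minus alg.r_minus alg.a_assoc alg.r_neg1)
    moreover have "nrm A (s m \<otimes> (s m \<ominus> s n) \<oplus> (s m \<ominus> s n) \<otimes> s n)
        \<le> nrm A (s m) * nrm A (s m \<ominus> s n) + nrm A (s m \<ominus> s n) * nrm A (s n)"
      using alg.N_triangle[of "s m \<otimes> (s m \<ominus> s n)" "(s m \<ominus> s n) \<otimes> s n"]
        nrm_mult[of "s m" "s m \<ominus> s n"] nrm_mult[of "s m \<ominus> s n" "s n"] sc by fastforce
    moreover have "\<dots> \<le> r * nrm A (s m \<ominus> s n) + nrm A (s m \<ominus> s n) * r"
      using sn sc by (intro add_mono mult_mono) (auto simp: alg.N_nonneg r)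
    ultimately show ?thesis
      using sc by (simp add: alg.N_smult)
  qed
  have "nrm A (s (Suc n) \<ominus> s n) \<le> r ^ n" for n
  proof (induction n)
    case 0
    show ?case using alg.N_minus_le[OF sc sc, of 1 0] sn[of 1] r by (simp add: s_def alg.N_zero)
  next
    case (Suc n)
    have "nrm A (s (Suc (Suc n)) \<ominus> s (Suc n)) \<le> r * nrm A (s (Suc n) \<ominus> s n)"
      using lip[of "Suc n" n] by (simp add: s_Suc)
    also have "\<dots> \<le> r * r ^ n" using Suc r by (intro mult_left_mono)
    finally show ?case by simp
  qed
  then have "alg.cauchy s" using alg.cauchy_geometric sc r by blast
  then obtain e where e: "alg.converges s e"
    using alg.cauchy_convergent banach_space_on.complete[OF banach] by blast
  have ec: "e \<in> carrier A" using e by (rule alg.convergesD)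
  have "alg.converges (\<lambda>n. step (s n)) (step e)"
    unfolding step_def
    by (intro alg.converges_smult alg.converges_add alg.converges_const converges_mult e k)
  \<comment> \<open>The shifted sequence converges both to \<open>e\<close> and to
    \<open>step e\<close>.\<close>
  then have "step e = e"
    using alg.converges_unique alg.converges_Suc[OF e] by (simp add: s_Suc)
  then have "2 \<odot> e = k \<oplus> e \<otimes> e"
    using ec k alg.mult_smult[of "k \<oplus> e \<otimes> e" 2 "1 / 2"] by (simp add: step_def alg.smult_one)
  then have ee: "e \<oplus> e = k \<oplus> e \<otimes> e"
    using ec alg.add_smult[of e 1 1] by (simp add: alg.smult_one)
  have "star A e = e"
    using alg.converges_unique[OF converges_star[OF e]] e inv by simp
  moreover have "h \<otimes> e = e \<otimes> h"
    using alg.converges_unique[OF converges_mult[OF alg.converges_const[OF h(1)] e]]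
      converges_mult[OF e alg.converges_const[OF h(1)]] inv by simp
  moreover have "(\<one> \<ominus> e) \<otimes> (\<one> \<ominus> e) = \<one> \<ominus> k"
  proof -
    have "(\<one> \<ominus> e) \<otimes> (\<one> \<ominus> e) = \<one> \<oplus> e \<otimes> e \<ominus> (e \<oplus> e)"
      using ec by (simp add: alg.minus_eq alg.l_distr alg.r_distr alg.l_minus alg.r_minus alg.minus_add alg.a_ac)
    also have "\<dots> = (e \<otimes> e \<oplus> \<one>) \<ominus> (e \<otimes> e \<oplus> k)"
      using ec k ee by (simp add: alg.a_comm)
    also have "\<dots> = \<one> \<ominus> k"
      using ec k by (simp add: alg.minus_add_add alg.minus_self)
    finally show ?thesis .
  qed
  ultimately show ?thesis
    using that[of "\<one> \<ominus> e"] ec h star_diff[of \<one> e]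
    by (simp add: star_one alg.minus_eq alg.l_distr alg.r_distr alg.l_minus alg.r_minus)
qed

end

text \<open>\<open>nlim\<close> is a definite description, which uniqueness of limits makes
  computable. It enters through the inner product of \<open>itensor\<close>.\<close>

lemma nlim_eq:
  assumes "cstar_algebra A" "normed_vector_space_on.converges A (nrm A) s a"
  shows "nlim A s = a"
proof -
  interpret cstar_algebra A by fact
  have s: "s n \<in> carrier A" for n using assms(2) by (rule alg.convergesD)
  show ?thesis
    unfolding nlim_def
  proof (rule the_equality)
    show "a \<in> carrier A \<and> (\<lambda>n. nrm A (s n \<ominus>\<^bsub>A\<^esub> a)) \<longlonglongrightarrow> 0"
      using assms(2) by (simp add: alg.converges_def)
    fix b assume "b \<in> carrier A \<and> (\<lambda>n. nrm A (s n \<ominus>\<^bsub>A\<^esub> b)) \<longlonglongrightarrow> 0"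
    then have "alg.converges s b" using s by (simp add: alg.converges_def)
    then show "b = a" using assms(2) by (rule alg.converges_unique)
  qed
qed

text \<open>
  A selfadjoint contraction \<open>h\<close> is the real part of the unitary \<open>h + \<i>\<surd>(1 - h\<^sup>2)\<close>, and unitaries
  have norm at most 1; this avoids the spectral radius.
\<close>

lemma star_homomorphism_contractive:
  assumes "cstar_algebra A" "cstar_algebra B"
    and closed: "\<pi> \<in> carrier A \<rightarrow> carrier B"
    and add: "\<And>a b. \<lbrakk>a \<in> carrier A; b \<in> carrier A\<rbrakk> \<Longrightarrow> \<pi> (a \<oplus>\<^bsub>A\<^esub> b) = \<pi> a \<oplus>\<^bsub>B\<^esub> \<pi> b"
    and smult: "\<And>c a. a \<in> carrier A \<Longrightarrow> \<pi> (c \<odot>\<^bsub>A\<^esub> a) = c \<odot>\<^bsub>B\<^esub> \<pi> a"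
    and mult: "\<And>a b. \<lbrakk>a \<in> carrier A; b \<in> carrier A\<rbrakk> \<Longrightarrow> \<pi> (a \<otimes>\<^bsub>A\<^esub> b) = \<pi> a \<otimes>\<^bsub>B\<^esub> \<pi> b"
    and one: "\<pi> \<one>\<^bsub>A\<^esub> = \<one>\<^bsub>B\<^esub>"
    and star: "\<And>a. a \<in> carrier A \<Longrightarrow> \<pi> (star A a) = star B (\<pi> a)"
    and a: "a \<in> carrier A"
  shows "nrm B (\<pi> a) \<le> nrm A a"
proof -
  interpret A: cstar_algebra A by fact
  interpret B: cstar_algebra B by fact
  have [simp]: "\<pi> a \<in> carrier B" if "a \<in> carrier A" for a
    using closed that by auto
  \<comment> \<open>The strict inequality makes the norm of h^2 less than 1, as the root of 1 - h^2
    requires. Rescaling in \<open>selfadj\<close> removes the restriction.\<close>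
  have selfadj1: "nrm B (\<pi> h) \<le> 1" if h: "h \<in> carrier A" "star A h = h" "nrm A h < 1" for h
  proof -
    have "nrm A (h \<otimes>\<^bsub>A\<^esub> h) < 1"
      using A.cstar_identity[OF h(1)] h A.alg.N_nonneg[OF h(1)] by (simp add: power_less_one_iff)
    then obtain d where d: "d \<in> carrier A" "star A d = d"
      "d \<otimes>\<^bsub>A\<^esub> d = \<one>\<^bsub>A\<^esub> \<ominus>\<^bsub>A\<^esub> h \<otimes>\<^bsub>A\<^esub> h" "h \<otimes>\<^bsub>A\<^esub> d = d \<otimes>\<^bsub>A\<^esub> h"
      using A.sqrt_one_minus[of "h \<otimes>\<^bsub>A\<^esub> h" h] h by (auto simp: A.star_mult A.alg.m_assoc)
    define u where "u = h \<oplus>\<^bsub>A\<^esub> \<i> \<odot>\<^bsub>A\<^esub> d"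
    have u: "u \<in> carrier A" using h d by (simp add: u_def A.alg.smult_closed)
    have su: "star A u = h \<oplus>\<^bsub>A\<^esub> (-\<i>) \<odot>\<^bsub>A\<^esub> d"
      using h d by (simp add: u_def A.alg.smult_closed A.star_add A.star_smult)
    \<comment> \<open>The mixed terms \<i>hd and -\<i>dh cancel because d commutes with h; what
      remains is h^2 + d^2 = 1.\<close>
    have "star A u \<otimes>\<^bsub>A\<^esub> u = h \<otimes>\<^bsub>A\<^esub> h \<oplus>\<^bsub>A\<^esub> (\<i> \<odot>\<^bsub>A\<^esub> (h \<otimes>\<^bsub>A\<^esub> d)
        \<oplus>\<^bsub>A\<^esub> ((-\<i>) \<odot>\<^bsub>A\<^esub> (h \<otimes>\<^bsub>A\<^esub> d) \<oplus>\<^bsub>A\<^esub> d \<otimes>\<^bsub>A\<^esub> d))"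
      using h d(1,2) d(4)[symmetric] unfolding su unfolding u_def
      by (simp add: A.alg.smult_closed A.alg.l_distr A.alg.r_distr A.smult_mult_left
          A.smult_mult_right A.alg.smult_add A.alg.a_ac A.alg.smult_one flip: A.alg.mult_smult)
    also have "\<dots> = h \<otimes>\<^bsub>A\<^esub> h \<oplus>\<^bsub>A\<^esub> ((\<i> + -\<i>) \<odot>\<^bsub>A\<^esub> (h \<otimes>\<^bsub>A\<^esub> d) \<oplus>\<^bsub>A\<^esub> d \<otimes>\<^bsub>A\<^esub> d)"
      using h(1) d(1) A.alg.add_smult[of "h \<otimes>\<^bsub>A\<^esub> d" \<i> "-\<i>"]
      by (simp add: A.alg.smult_closed A.alg.a_assoc)
    also have "\<dots> = \<one>\<^bsub>A\<^esub>"
      using h(1) d(1,3)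
      by (simp add: A.alg.zero_smult A.alg.minus_eq A.alg.a_lcomm A.alg.r_neg)
    finally have "star B (\<pi> u) \<otimes>\<^bsub>B\<^esub> \<pi> u = \<one>\<^bsub>B\<^esub>"
      using u by (simp add: one A.star_closed flip: star mult)
    then have "(nrm B (\<pi> u))\<^sup>2 \<le> 1"
      using B.cstar_identity[of "\<pi> u"] B.nrm_one_le u by simp
    then have nu: "nrm B (\<pi> u) \<le> 1"
      using B.alg.N_nonneg[of "\<pi> u"] u by (simp add: power_le_one_iff)
    \<comment> \<open>h is the mean of u and its adjoint. Their images have norm at most 1, hence so
      has the image of h.\<close>
    have "u \<oplus>\<^bsub>A\<^esub> star A u = 2 \<odot>\<^bsub>A\<^esub> h"
    proof -
      have "u \<oplus>\<^bsub>A\<^esub> star A u = (h \<oplus>\<^bsub>A\<^esub> h) \<oplus>\<^bsub>A\<^esub> (\<i> \<odot>\<^bsub>A\<^esub> d \<oplus>\<^bsub>A\<^esub> (-\<i>) \<odot>\<^bsub>A\<^esub> d)"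
        unfolding su unfolding u_def using h(1) d(1) by (simp add: A.alg.smult_closed A.alg.a_ac)
      also have "\<dots> = 2 \<odot>\<^bsub>A\<^esub> h"
        using h(1) d(1) A.alg.add_smult[of d \<i> "-\<i>", symmetric] A.alg.add_smult[of h 1 1]
        by (simp add: A.alg.zero_smult A.alg.smult_one)
      finally show ?thesis .
    qed
    then have "2 \<odot>\<^bsub>B\<^esub> \<pi> h = \<pi> u \<oplus>\<^bsub>B\<^esub> star B (\<pi> u)"
      using h(1) u by (simp add: A.star_closed flip: smult star add)
    then have "nrm B (2 \<odot>\<^bsub>B\<^esub> \<pi> h) \<le> nrm B (\<pi> u) + nrm B (\<pi> u)"
      using B.alg.N_triangle[of "\<pi> u" "star B (\<pi> u)"] u by (simp add: B.nrm_star B.star_closed)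
    then show ?thesis
      using nu h(1) by (simp add: B.alg.N_smult)
  qed
  have selfadj: "nrm B (\<pi> h) \<le> nrm A h" if h: "h \<in> carrier A" "star A h = h" for h
  proof (rule field_le_epsilon)
    fix e :: real assume "e > 0"
    \<comment> \<open>Dividing by a number slightly above the norm puts h into the open unit ball,
      and it stays positive when h = 0.\<close>
    define t where "t = nrm A h + e"
    have t: "t > 0" "nrm A h < t" using A.alg.N_nonneg[OF h(1)] \<open>e > 0\<close> by (auto simp: t_def)
    have "nrm B (\<pi> (complex_of_real (1 / t) \<odot>\<^bsub>A\<^esub> h)) \<le> 1"
      by (rule selfadj1) (use h t in \<open>simp_all add: A.alg.smult_closed A.star_smult A.alg.N_smult norm_divide\<close>)
    then show "nrm B (\<pi> h) \<le> nrm A h + e"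
      using h t by (simp add: smult B.alg.N_smult norm_divide t_def[symmetric])
  qed
  \<comment> \<open>A general a is reduced to the selfadjoint product of its adjoint with a, by the
    C*-identity in both algebras.\<close>
  have "(nrm B (\<pi> a))\<^sup>2 = nrm B (\<pi> (star A a \<otimes>\<^bsub>A\<^esub> a))"
    using a B.cstar_identity[of "\<pi> a"] by (simp add: mult star A.star_closed)
  also have "\<dots> \<le> nrm A (star A a \<otimes>\<^bsub>A\<^esub> a)"
    by (rule selfadj) (simp_all add: a A.star_closed A.star_mult A.star_star)
  also have "\<dots> = (nrm A a)\<^sup>2"
    by (rule A.cstar_identity[OF a])
  finally show ?thesis
    using A.alg.N_nonneg[OF a] by (rule power2_le_imp_le)
qed

section \<open>Correspondences as normed spaces\<close>

lemma lsum_Nil: "lsum G f [] = \<zero>\<^bsub>G\<^esub>"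
  by (simp add: lsum_def)

lemma lsum_Cons: "lsum G f (t # ts) = f t \<oplus>\<^bsub>G\<^esub> lsum G f ts"
  by (simp add: lsum_def)

lemma lsum_cong: "(\<And>t. t \<in> set ts \<Longrightarrow> f t = g t) \<Longrightarrow> lsum G f ts = lsum G g ts"
  by (induction ts) (simp_all add: lsum_Nil lsum_Cons)

context abelian_monoid
begin

lemma lsum_closed: "(\<And>t. t \<in> set ts \<Longrightarrow> f t \<in> carrier G) \<Longrightarrow> lsum G f ts \<in> carrier G"
  by (induction ts) (simp_all add: lsum_Nil lsum_Cons)

lemma lsum_append:
  assumes "\<And>t. t \<in> set (ts @ us) \<Longrightarrow> f t \<in> carrier G"
  shows "lsum G f (ts @ us) = lsum G f ts \<oplus> lsum G f us"
  using assms by (induction ts) (simp_all add: lsum_Nil lsum_Cons lsum_closed a_assoc)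

end

lemma cring_complex_ring: "cring complex_ring"
proof (rule cringI)
  show "abelian_group complex_ring"
    by (rule abelian_groupI) (auto simp: complex_ring_def algebra_simps intro: exI[of _ "- x" for x])
  show "comm_monoid complex_ring"
    by unfold_locales (auto simp: complex_ring_def algebra_simps)
qed (auto simp: complex_ring_def algebra_simps)

context right_hilbert_module
begin

lemma abelian_group_E: "abelian_group E"
  by (rule module_complex_ringD(1)[OF complex_module])

lemma ip_add_left:
  assumes "x \<in> carrier E" "y \<in> carrier E" "z \<in> carrier E"
  shows "ip E (x \<oplus> y) z = ip E x z \<oplus>\<^bsub>A\<^esub> ip E y z"
proof -
  interpret E: abelian_group E by (rule abelian_group_E)
  have "ip E (x \<oplus> y) z = star A (ip E z (x \<oplus> y))"
    using assms by (simp add: ip_star)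
  then show ?thesis
    using assms by (simp add: ip_add star_add ip_closed ip_star)
qed

lemma ip_smult_left:
  assumes "x \<in> carrier E" "y \<in> carrier E"
  shows "ip E (c \<odot> x) y = cnj c \<odot>\<^bsub>A\<^esub> ip E x y"
proof -
  have "ip E (c \<odot> x) y = star A (ip E y (c \<odot> x))"
    using assms module_complex_ringD(2)[OF complex_module] by (simp add: ip_star)
  then show ?thesis
    using assms by (simp add: ip_smult star_smult ip_closed ip_star)
qed

lemma ip_ract_left:
  assumes "x \<in> carrier E" "y \<in> carrier E" "a \<in> carrier A"
  shows "ip E (ract E x a) y = star A a \<otimes>\<^bsub>A\<^esub> ip E x y"
proof -
  have "ip E (ract E x a) y = star A (ip E y (ract E x a))"
    using assms by (simp add: ip_star ract_closed)
  then show ?thesis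
    using assms by (simp add: ip_ract star_mult ip_closed ip_star)
qed

lemma hnorm_power2: "x \<in> carrier E \<Longrightarrow> (hnorm A E x)\<^sup>2 = nrm A (ip E x x)"
  by (simp add: hnorm_def alg.N_nonneg ip_closed)

lemma hnorm_nonneg: "x \<in> carrier E \<Longrightarrow> 0 \<le> hnorm A E x"
  by (simp add: hnorm_def alg.N_nonneg ip_closed)

lemma hnorm_ract:
  assumes "x \<in> carrier E" "a \<in> carrier A"
  shows "hnorm A E (ract E x a) \<le> nrm A a * hnorm A E x"
proof (rule power2_le_imp_le)
  have "(hnorm A E (ract E x a))\<^sup>2 = nrm A ((star A a \<otimes>\<^bsub>A\<^esub> ip E x x) \<otimes>\<^bsub>A\<^esub> a)"
    using assms by (simp add: hnorm_power2 ract_closed ip_ract ip_ract_left)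
  also have "\<dots> \<le> nrm A (star A a \<otimes>\<^bsub>A\<^esub> ip E x x) * nrm A a"
    using assms by (simp add: nrm_mult star_closed ip_closed)
  also have "\<dots> \<le> (nrm A (star A a) * nrm A (ip E x x)) * nrm A a"
    using assms by (intro mult_right_mono nrm_mult) (simp_all add: star_closed ip_closed alg.N_nonneg)
  also have "\<dots> = (nrm A a * hnorm A E x)\<^sup>2"
    using assms by (simp add: nrm_star hnorm_power2 power_mult_distrib power2_eq_square[of "nrm A a"])
  finally show "(hnorm A E (ract E x a))\<^sup>2 \<le> (nrm A a * hnorm A E x)\<^sup>2" .
qed (use assms in \<open>simp add: alg.N_nonneg hnorm_nonneg\<close>)

end

text \<open>
  Both additional properties hold for every correspondence; for spaces of morphisms in a
  C*-category they are immediate, so assuming them saves the general theory of positive elements.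
\<close>

locale normed_correspondence = correspondence A G
  for A :: "'a star_algebra" and G :: "('a, 'g) corr" (structure) +
  assumes cauchy_schwarz:
      "\<lbrakk>x \<in> carrier G; y \<in> carrier G\<rbrakk> \<Longrightarrow> nrm A (ip G x y) \<le> hnorm A G x * hnorm A G y"
    and hnorm_lact:
      "\<lbrakk>a \<in> carrier A; x \<in> carrier G\<rbrakk> \<Longrightarrow> hnorm A G (lact G a x) \<le> nrm A a * hnorm A G x"

text \<open>For the triangle inequality the squared norm of a sum is expanded into four inner
  products, and Cauchy-Schwarz bounds the mixed ones.\<close>

lemma (in normed_correspondence) normed_vector_space_on_G:
  "normed_vector_space_on G (hnorm A G)"
proof -
  interpret G: abelian_group G by (rule abelian_group_E)
  show ?thesis
  proof (intro normed_vector_space_on.intro normed_vector_space_on_axioms.intro)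
    show "abelian_group G" ..
    show "Module.module complex_ring G" by (rule complex_module)
    fix x y c assume x: "x \<in> carrier G"
    show "0 \<le> hnorm A G x" using x by (rule hnorm_nonneg)
    have z: "ip G \<zero> \<zero> = \<zero>\<^bsub>A\<^esub>"
      using ip_add[of \<zero> \<zero> \<zero>] alg.add.r_cancel_one'[of "ip G \<zero> \<zero>" "ip G \<zero> \<zero>"] ip_closed[of \<zero> \<zero>]
      by (metis G.zero_closed G.l_zero)
    show "hnorm A G x = 0 \<longleftrightarrow> x = \<zero>"
      using x ip_definite[of x] z
      by (auto simp: hnorm_def alg.N_eq_0_iff ip_closed alg.N_zero)
    show "hnorm A G (c \<odot> x) = cmod c * hnorm A G x"
      using x by (simp add: hnorm_def ip_smult ip_smult_left alg.N_smult ip_closed alg.smult_closed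
          module_complex_ringD(2)[OF complex_module] real_sqrt_mult norm_mult flip: alg.mult_smult)
    assume y: "y \<in> carrier G"
    have "(hnorm A G (x \<oplus> y))\<^sup>2 \<le> (hnorm A G x + hnorm A G y)\<^sup>2"
    proof -
      have "(hnorm A G (x \<oplus> y))\<^sup>2
          = nrm A ((ip G x x \<oplus>\<^bsub>A\<^esub> ip G y x) \<oplus>\<^bsub>A\<^esub> (ip G x y \<oplus>\<^bsub>A\<^esub> ip G y y))"
        using x y by (simp add: hnorm_power2 ip_add ip_add_left)
      also have "\<dots> \<le> (nrm A (ip G x x) + nrm A (ip G y x)) + (nrm A (ip G x y) + nrm A (ip G y y))"
        using x y by (intro order.trans[OF alg.N_triangle] add_mono alg.N_triangle)
          (simp_all add: ip_closed)
      also have "\<dots> \<le> ((hnorm A G x)\<^sup>2 + hnorm A G y * hnorm A G x)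
          + (hnorm A G x * hnorm A G y + (hnorm A G y)\<^sup>2)"
        using x y by (intro add_mono cauchy_schwarz) (simp_all add: hnorm_power2)
      also have "\<dots> = (hnorm A G x + hnorm A G y)\<^sup>2"
        by (simp add: power2_sum)
      finally show ?thesis .
    qed
    then show "hnorm A G (x \<oplus> y) \<le> hnorm A G x + hnorm A G y"
      by (rule power2_le_imp_le) (simp add: x y hnorm_nonneg)
  qed
qed

context normed_correspondence
begin

sublocale mod: normed_vector_space_on G "hnorm A G"
  by (rule normed_vector_space_on_G)

text \<open>Inner products in the completed tensor product are limits along representatives; this
  joint continuity evaluates them.\<close>

lemma converges_ip:
  assumes s: "mod.converges s x" and t: "mod.converges t y"
  shows "alg.converges (\<lambda>n. ip G (s n) (t n)) (ip G x y)"
proof (rule alg.convergesI)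
  note c = mod.convergesD[OF s] mod.convergesD[OF t]
  show "ip G (s n) (t n) \<in> carrier A" "ip G x y \<in> carrier A" for n
    using c by (auto intro: ip_closed)
  show "nrm A (ip G (s n) (t n) \<ominus>\<^bsub>A\<^esub> ip G x y)
      \<le> hnorm A G (s n \<ominus> x) * hnorm A G (t n) + hnorm A G x * hnorm A G (t n \<ominus> y)" for n
  proof -
    have "ip G (s n) (t n) = ip G (s n \<ominus> x) (t n) \<oplus>\<^bsub>A\<^esub> ip G x (t n)"
      using ip_add_left[of "s n \<ominus> x" x "t n"] c(1)[of n] c(2) c(3)[of n]
      by (simp add: mod.minus_eq mod.a_assoc mod.l_neg)
    moreover have "ip G x (t n) = ip G x (t n \<ominus> y) \<oplus>\<^bsub>A\<^esub> ip G x y"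
      using ip_add[of x "t n \<ominus> y" y] c(2) c(3)[of n] c(4)
      by (simp add: mod.minus_eq mod.a_assoc mod.l_neg)
    ultimately have "ip G (s n) (t n) \<ominus>\<^bsub>A\<^esub> ip G x y
        = ip G (s n \<ominus> x) (t n) \<oplus>\<^bsub>A\<^esub> ip G x (t n \<ominus> y)"
      using c(1)[of n] c(2) c(3)[of n] c(4)
      by (simp add: alg.minus_eq alg.a_assoc alg.r_neg ip_closed)
    then have "nrm A (ip G (s n) (t n) \<ominus>\<^bsub>A\<^esub> ip G x y)
        \<le> nrm A (ip G (s n \<ominus> x) (t n)) + nrm A (ip G x (t n \<ominus> y))"
      using c(1)[of n] c(2) c(3)[of n] c(4) by (simp add: alg.N_triangle ip_closed)
    also have "\<dots> \<le> hnorm A G (s n \<ominus> x) * hnorm A G (t n) + hnorm A G x * hnorm A G (t n \<ominus> y)"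
      using c(1)[of n] c(2) c(3)[of n] c(4) by (intro add_mono cauchy_schwarz) auto
    finally show ?thesis .
  qed
  show "(\<lambda>n. hnorm A G (s n \<ominus> x) * hnorm A G (t n) + hnorm A G x * hnorm A G (t n \<ominus> y)) \<longlonglongrightarrow> 0"
    using tendsto_add[OF tendsto_mult[OF _ mod.converges_tendsto_N[OF t], of "\<lambda>n. hnorm A G (s n \<ominus> x)" 0]
        tendsto_mult_right_zero[of "\<lambda>n. hnorm A G (t n \<ominus> y)" _ "hnorm A G x"]] s t
    by (simp add: mod.converges_def)
qed

lemma converges_ract:
  assumes "mod.converges s x" "a \<in> carrier A"
  shows "mod.converges (\<lambda>n. ract G (s n) a) (ract G x a)"
proof (rule converges_image[OF mod.normed_vector_space_on_axioms mod.normed_vector_space_on_axioms,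
      where T = "\<lambda>x. ract G x a" and K = "nrm A a"])
  show T: "(\<lambda>x. ract G x a) \<in> carrier G \<rightarrow> carrier G"
    using assms by (auto intro: ract_closed)
  show "ract G (x \<ominus> y) a = ract G x a \<ominus> ract G y a" if "x \<in> carrier G" "y \<in> carrier G" for x y
    using additive_diff(3)[OF complex_module complex_module T] that assms(2) by (simp add: ract_add_left)
qed (use assms hnorm_ract in auto)

lemma lact_closed: "\<lbrakk>a \<in> carrier A; x \<in> carrier G\<rbrakk> \<Longrightarrow> lact G a x \<in> carrier G"
  using lact_adjoint[of a] by (auto simp: is_adjoint_def)

lemma ip_eq_imp_eq:
  assumes "x \<in> carrier G" "y \<in> carrier G" "\<And>z. z \<in> carrier G \<Longrightarrow> ip G z x = ip G z y"
  shows "x = y"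
proof (rule mod.minus_eq_zeroD[OF assms(1,2)])
  have "ip G (x \<ominus> y) (x \<ominus> y) = ip G (x \<ominus> y) x \<oplus>\<^bsub>A\<^esub> (-1) \<odot>\<^bsub>A\<^esub> ip G (x \<ominus> y) y"
    using assms(1,2)
    by (simp add: mod.minus_eq ip_add) (simp add: mod.minus_eq_smult mod.smult_closed ip_smult)
  also have "\<dots> = \<zero>\<^bsub>A\<^esub>"
    using assms by (simp add: ip_closed alg.r_neg flip: alg.minus_eq_smult)
  finally show "x \<ominus> y = \<zero>"
    using assms(1,2) by (intro ip_definite) auto
qed

text \<open>\<open>adjoint_of\<close> is a definite description. Inner products separate vectors, so
  any adjoint agrees with it on the carrier.\<close>

lemma adjoint_of_eq:
  assumes "is_adjoint G H T S" "y \<in> carrier H"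
  shows "adjoint_of G H T y = S y"
  unfolding adjoint_of_def
proof (rule the_equality)
  show S: "S y \<in> carrier G \<and> (\<forall>z\<in>carrier G. ip H (T z) y = ip G z (S y))"
    using assms by (auto simp: is_adjoint_def)
  fix x assume "x \<in> carrier G \<and> (\<forall>z\<in>carrier G. ip H (T z) y = ip G z x)"
  then show "x = S y" using S by (intro ip_eq_imp_eq) auto
qed

text \<open>Additivity in the vector is no axiom of a correspondence. It follows by testing against
  all vectors and moving a to the other side of the inner product.\<close>

lemma lact_add_right:
  assumes a: "a \<in> carrier A" and x: "x \<in> carrier G" and y: "y \<in> carrier G"
  shows "lact G a (x \<oplus> y) = lact G a x \<oplus> lact G a y"
proof -
  have adj: "ip G (lact G a u) v = ip G u (lact G (star A a) v)" "ip G v (lact G a u) = ip G (lact G (star A a) v) u"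
    if "u \<in> carrier G" "v \<in> carrier G" for u v
    using lact_adjoint[OF a] lact_adjoint[OF star_closed[OF a]] that a
    by (auto simp: is_adjoint_def star_star)
  show ?thesis
    using a x y by (intro ip_eq_imp_eq) (simp_all add: lact_closed star_closed adj ip_add)
qed

lemma converges_lact:
  assumes "mod.converges s x" "a \<in> carrier A"
  shows "mod.converges (\<lambda>n. lact G a (s n)) (lact G a x)"
proof (rule converges_image[OF mod.normed_vector_space_on_axioms mod.normed_vector_space_on_axioms,
      where T = "lact G a" and K = "nrm A a"])
  show T: "lact G a \<in> carrier G \<rightarrow> carrier G"
    using assms by (auto intro: lact_closed)
  show "lact G a (x \<ominus> y) = lact G a x \<ominus> lact G a y" if "x \<in> carrier G" "y \<in> carrier G" for x y
    using additive_diff(3)[OF complex_module complex_module T] that assms(2) by (simp add: lact_add_right)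
qed (use assms hnorm_lact in auto)

text \<open>These closure properties match the way elements of a completed tensor product arise:
  finite sums of elementary tensors, then limits. Scalars are absorbed into the elementary
  tensors.\<close>

definition closed_submonoid :: "'g set \<Rightarrow> bool" where
  "closed_submonoid S \<longleftrightarrow> \<zero> \<in> S \<and> (\<forall>x\<in>S. \<forall>y\<in>S. x \<oplus> y \<in> S) \<and>
    (\<forall>s x. (\<forall>n. s n \<in> S) \<and> mod.converges s x \<longrightarrow> x \<in> S)"

end

section \<open>Realizations of the internal tensor product\<close>

lemma (in normed_correspondence) closed_submonoid_limit:
  "\<lbrakk>closed_submonoid S; \<And>n. s n \<in> S; mod.converges s x\<rbrakk> \<Longrightarrow> x \<in> S"
  unfolding closed_submonoid_def
  by (elim conjE, erule allE[of _ s], erule allE[of _ x]) simp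

(* Keeps membership in lists folded for induction; auto would turn it into a bounded quantifier. *)
declare in_listsI [rule del] in_listsD [rule del]

text \<open>
  A balanced map \<open>ev\<close> whose target reproduces the inner products of elementary tensors: it
  identifies the internal tensor product with the closed span of its image.
\<close>

locale tensor_realization = normed_correspondence A G
  for A :: "'a star_algebra" and G :: "('a, 'g) corr" (structure) +
  fixes E :: "('a, 'x) corr" and E' :: "('a, 'y) corr" and ev :: "'x \<Rightarrow> 'y \<Rightarrow> 'g"
  assumes ev_closed: "\<lbrakk>x \<in> carrier E; y \<in> carrier E'\<rbrakk> \<Longrightarrow> ev x y \<in> carrier G"
    and ev_ip: "\<lbrakk>x \<in> carrier E; y \<in> carrier E'; x' \<in> carrier E; y' \<in> carrier E'\<rbrakk>
      \<Longrightarrow> ip G (ev x y) (ev x' y') = ip E' y (lact E' (ip E x x') y')"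
    and minus_closed: "x \<in> carrier E \<Longrightarrow> \<ominus>\<^bsub>E\<^esub> x \<in> carrier E"
    and ev_minus: "\<lbrakk>x \<in> carrier E; y \<in> carrier E'\<rbrakk> \<Longrightarrow> ev (\<ominus>\<^bsub>E\<^esub> x) y = \<ominus> ev x y"
    and smult_closed: "x \<in> carrier E \<Longrightarrow> c \<odot>\<^bsub>E\<^esub> x \<in> carrier E"
    and ev_smult: "\<lbrakk>x \<in> carrier E; y \<in> carrier E'\<rbrakk> \<Longrightarrow> ev (c \<odot>\<^bsub>E\<^esub> x) y = c \<odot> ev x y"
    and ract_closed': "\<lbrakk>y \<in> carrier E'; a \<in> carrier A\<rbrakk> \<Longrightarrow> ract E' y a \<in> carrier E'"
    and ev_ract: "\<lbrakk>x \<in> carrier E; y \<in> carrier E'; a \<in> carrier A\<rbrakk>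
      \<Longrightarrow> ev x (ract E' y a) = ract G (ev x y) a"
    and lact_closed': "\<lbrakk>x \<in> carrier E; a \<in> carrier A\<rbrakk> \<Longrightarrow> lact E a x \<in> carrier E"
    and ev_lact: "\<lbrakk>x \<in> carrier E; y \<in> carrier E'; a \<in> carrier A\<rbrakk>
      \<Longrightarrow> ev (lact E a x) y = lact G a (ev x y)"
begin

definition ev_sum :: "('x \<times> 'y) list \<Rightarrow> 'g" where
  "ev_sum ts = lsum G (\<lambda>(x, y). ev x y) ts"

abbreviation formal_sums :: "('x \<times> 'y) list set" where
  "formal_sums \<equiv> lists (carrier E \<times> carrier E')"

abbreviation T :: "('a, ('x, 'y) tens) corr" where
  "T \<equiv> itensor A E E'"

lemma ev_sum_Nil: "ev_sum [] = \<zero>"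
  by (simp add: ev_sum_def lsum_Nil)

lemma ev_sum_Cons: "ev_sum ((x, y) # ts) = ev x y \<oplus> ev_sum ts"
  by (simp add: ev_sum_def lsum_Cons)

lemma ev_sum_closed: "ts \<in> formal_sums \<Longrightarrow> ev_sum ts \<in> carrier G"
  unfolding ev_sum_def by (rule mod.lsum_closed) (auto simp: in_lists_conv_set intro: ev_closed)

lemma ev_sum_append: "\<lbrakk>ts \<in> formal_sums; us \<in> formal_sums\<rbrakk> \<Longrightarrow> ev_sum (ts @ us) = ev_sum ts \<oplus> ev_sum us"
  unfolding ev_sum_def by (rule mod.lsum_append) (auto simp: in_lists_conv_set intro: ev_closed)

text \<open>Here h is the operation on \<open>G\<close> induced by changing a formal sum entry by
  entry: negation, a scalar, or one of the two actions.\<close>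

lemma ev_sum_map:
  assumes h0: "h \<zero> = \<zero>"
    and hadd: "\<And>g g'. \<lbrakk>g \<in> carrier G; g' \<in> carrier G\<rbrakk> \<Longrightarrow> h (g \<oplus> g') = h g \<oplus> h g'"
    and hev: "\<And>x y. \<lbrakk>x \<in> carrier E; y \<in> carrier E'\<rbrakk> \<Longrightarrow> h (ev x y) = ev (f x y) (f' x y)"
    and ts: "ts \<in> formal_sums"
  shows "ev_sum (map (\<lambda>(x, y). (f x y, f' x y)) ts) = h (ev_sum ts)"
  using ts by (induction ts) (auto simp: ev_sum_Nil ev_sum_Cons h0 hadd hev ev_closed ev_sum_closed)

text \<open>On elementary tensors this is \<open>ev_ip\<close>, and both sides are biadditive. The
  inner induction runs over \<open>us\<close>, the outer one over \<open>ts\<close>.\<close>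

lemma pre_ip_eq:
  assumes ts: "ts \<in> formal_sums" and us: "us \<in> formal_sums"
  shows "pre_ip A E E' ts us = ip G (ev_sum ts) (ev_sum us)"
proof -
  have z: "ip G g \<zero> = \<zero>\<^bsub>A\<^esub>" "ip G \<zero> g = \<zero>\<^bsub>A\<^esub>" if "g \<in> carrier G" for g
    using ip_smult[of g \<zero> 0] ip_smult_left[of \<zero> g 0] that
    by (simp_all add: mod.zero_smult alg.zero_smult ip_closed)
  have "lsum A (\<lambda>(x', y'). ip E' y (lact E' (ip E x x') y')) us = ip G (ev x y) (ev_sum us)"
    if "x \<in> carrier E" "y \<in> carrier E'" for x y
    using us that
    by (induction us) (auto simp: lsum_Nil lsum_Cons ev_sum_Nil ev_sum_Cons z ev_ip ip_add ev_closed ev_sum_closed)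
  then have "pre_ip A E E' ts us = lsum A (\<lambda>(x, y). ip G (ev x y) (ev_sum us)) ts"
    unfolding pre_ip_def using ts by (intro lsum_cong) (auto simp: in_lists_conv_set)
  also have "\<dots> = ip G (ev_sum ts) (ev_sum us)"
    using ts us
    by (induction ts) (auto simp: lsum_Nil lsum_Cons ev_sum_Nil ev_sum_Cons z ip_add_left ev_closed ev_sum_closed)
  finally show ?thesis .
qed

text \<open>\<open>pre_dist\<close> forms a difference by appending the second sum with negated
  first entries; \<open>ev_minus\<close> carries the signs out.\<close>

lemma pre_dist_eq:
  assumes "ts \<in> formal_sums" "us \<in> formal_sums"
  shows "pre_dist A E E' ts us = hnorm A G (ev_sum ts \<ominus> ev_sum us)"
proof -
  let ?us = "map (\<lambda>(x, y). (\<ominus>\<^bsub>E\<^esub> x, y)) us"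
  have us: "?us \<in> formal_sums" using assms(2) by (auto simp: in_lists_conv_set intro: minus_closed)
  have "ev_sum ?us = \<ominus> ev_sum us"
    by (rule ev_sum_map) (use assms mod.minus_add in \<open>auto simp: ev_minus mod.a_comm\<close>)
  then have "ev_sum (ts @ ?us) = ev_sum ts \<ominus> ev_sum us"
    using assms us by (simp add: ev_sum_append mod.minus_eq)
  moreover have "ts @ ?us \<in> formal_sums" using assms(1) us by auto
  ultimately show ?thesis
    unfolding pre_dist_def Let_def hnorm_def by (simp only: pre_ip_eq)
qed

text \<open>\<open>G\<close> is complete, so the points of the completion can be found inside
  \<open>G\<close> as limits of evaluated sums.\<close>

lemma cauchy_sums_iff:
  "s \<in> cauchy_sums A E E' \<longleftrightarrow> (\<forall>n. s n \<in> formal_sums) \<and> (\<exists>g. mod.converges (\<lambda>n. ev_sum (s n)) g)"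
proof -
  have "s \<in> cauchy_sums A E E' \<longleftrightarrow> (\<forall>n. s n \<in> formal_sums) \<and> mod.cauchy (\<lambda>n. ev_sum (s n))"
    unfolding cauchy_sums_def mod.cauchy_def
    by (auto simp: pre_dist_eq ev_sum_closed)
  then show ?thesis
    using mod.cauchy_convergent[OF complete] mod.converges_cauchy by blast
qed

definition ev_lim :: "(nat \<Rightarrow> ('x \<times> 'y) list) \<Rightarrow> 'g" where
  "ev_lim s = (THE g. mod.converges (\<lambda>n. ev_sum (s n)) g)"

lemma ev_lim_eq: "mod.converges (\<lambda>n. ev_sum (s n)) g \<Longrightarrow> ev_lim s = g"
  unfolding ev_lim_def using mod.converges_unique by blast

lemma converges_ev_lim:
  "s \<in> cauchy_sums A E E' \<Longrightarrow> mod.converges (\<lambda>n. ev_sum (s n)) (ev_lim s)"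
  using cauchy_sums_iff ev_lim_eq by auto

lemma null_rel_iff:
  "(s, t) \<in> null_rel A E E' \<longleftrightarrow>
    s \<in> cauchy_sums A E E' \<and> t \<in> cauchy_sums A E E' \<and> ev_lim s = ev_lim t"
proof (cases "s \<in> cauchy_sums A E E' \<and> t \<in> cauchy_sums A E E'")
  case True
  then have "pre_dist A E E' (s n) (t n) = hnorm A G (ev_sum (s n) \<ominus> ev_sum (t n))" for n
    by (intro pre_dist_eq) (auto simp: cauchy_sums_iff)
  then show ?thesis
    using True mod.converges_minus_iff[OF converges_ev_lim converges_ev_lim, of s t]
    by (simp add: null_rel_def)
qed (auto simp: null_rel_def)

text \<open>By \<open>null_rel_iff\<close> this is the kernel relation of
  \<open>ev_lim\<close>.\<close>

lemma equiv_null_rel: "equiv (cauchy_sums A E E') (null_rel A E E')"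
  by (rule equivI) (auto simp: null_rel_iff refl_on_def sym_on_def trans_on_def)

section \<open>The isometric embedding of the completed tensor product\<close>

definition realize :: "('x, 'y) tens \<Rightarrow> 'g" where
  "realize P = ev_lim (cls_rep P)"

lemma carrier_itensor: "carrier T = cauchy_sums A E E' // null_rel A E E'"
  by (simp add: itensor_def)

lemma cls_rep_cauchy:
  assumes "P \<in> carrier T"
  shows "cls_rep P \<in> cauchy_sums A E E'" "tcls A E E' (cls_rep P) = P"
proof -
  have "cls_rep P \<in> P"
    unfolding cls_rep_def using assms equiv_Eps_in[OF equiv_null_rel] by (simp add: carrier_itensor)
  then show "cls_rep P \<in> cauchy_sums A E E'" "tcls A E E' (cls_rep P) = P"
    using assms in_quotient_imp_subset[OF equiv_null_rel] Equiv_Relations.quotient_eq_iff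
      equiv_class_eq_iff[OF equiv_null_rel]
    unfolding tcls_def carrier_itensor quotient_def
    by (auto simp: null_rel_iff)
qed

lemma cls_rep_sums: "P \<in> carrier T \<Longrightarrow> cls_rep P n \<in> formal_sums"
  using cls_rep_cauchy(1) cauchy_sums_iff by blast

lemma converges_realize:
  "P \<in> carrier T \<Longrightarrow> mod.converges (\<lambda>n. ev_sum (cls_rep P n)) (realize P)"
  unfolding realize_def by (intro converges_ev_lim cls_rep_cauchy)

lemma realize_closed: "P \<in> carrier T \<Longrightarrow> realize P \<in> carrier G"
  using converges_realize by (rule mod.convergesD)

lemma realize_inj:
  assumes "P \<in> carrier T" "Q \<in> carrier T" "realize P = realize Q"
  shows "P = Q"
proof -
  have "tcls A E E' (cls_rep P) = tcls A E E' (cls_rep Q)"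
    unfolding tcls_def
    by (rule equiv_class_eq[OF equiv_null_rel])
      (use assms cls_rep_cauchy in \<open>simp add: null_rel_iff realize_def\<close>)
  then show ?thesis using assms cls_rep_cauchy by simp
qed

text \<open>The operations of \<open>itensor\<close> are classes of sequences built from chosen
  representatives. Such a class is realized by the limit of any sequence defining it, so the choice
  made by \<open>cls_rep\<close> drops out.\<close>

lemma tcls_realize:
  assumes "\<And>n. s n \<in> formal_sums" "mod.converges (\<lambda>n. ev_sum (s n)) g"
  shows "tcls A E E' s \<in> carrier T" "realize (tcls A E E' s) = g"
proof -
  have s: "s \<in> cauchy_sums A E E'" using assms cauchy_sums_iff by blast
  then show c: "tcls A E E' s \<in> carrier T"
    by (simp add: carrier_itensor tcls_def quotientI)
  have "(s, cls_rep (tcls A E E' s)) \<in> null_rel A E E'"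
    using eq_equiv_class[OF _ equiv_null_rel cls_rep_cauchy(1)[OF c]] cls_rep_cauchy(2)[OF c]
    unfolding tcls_def by metis
  then show "realize (tcls A E E' s) = g"
    using ev_lim_eq[OF assms(2)] by (simp add: realize_def null_rel_iff)
qed

text \<open>Common form of the scalar multiplication and the two actions, which change formal sums
  entry by entry; h is the continuous additive map of \<open>G\<close> that induces the
  change.\<close>

lemma tcls_map_realize:
  assumes h: "h \<in> carrier G \<rightarrow> carrier G"
    and hadd: "\<And>g g'. \<lbrakk>g \<in> carrier G; g' \<in> carrier G\<rbrakk> \<Longrightarrow> h (g \<oplus> g') = h g \<oplus> h g'"
    and hlim: "\<And>s g. mod.converges s g \<Longrightarrow> mod.converges (\<lambda>n. h (s n)) (h g)"
    and f: "\<And>x y. \<lbrakk>x \<in> carrier E; y \<in> carrier E'\<rbrakk> \<Longrightarrow> f x y \<in> carrier E \<and> f' x y \<in> carrier E'"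
    and hev: "\<And>x y. \<lbrakk>x \<in> carrier E; y \<in> carrier E'\<rbrakk> \<Longrightarrow> h (ev x y) = ev (f x y) (f' x y)"
    and P: "P \<in> carrier T"
  defines "Q \<equiv> tcls A E E' (\<lambda>n. map (\<lambda>(x, y). (f x y, f' x y)) (cls_rep P n))"
  shows "Q \<in> carrier T" "realize Q = h (realize P)"
proof -
  have "map (\<lambda>(x, y). (f x y, f' x y)) (cls_rep P n) \<in> formal_sums" for n
    using cls_rep_sums[OF P, of n] f by (force simp: in_lists_conv_set)
  moreover have "ev_sum (map (\<lambda>(x, y). (f x y, f' x y)) (cls_rep P n)) = h (ev_sum (cls_rep P n))" for n
    using additive_diff(1)[OF complex_module complex_module h hadd] hadd hev cls_rep_sums[OF P]
    by (intro ev_sum_map) auto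
  ultimately show "Q \<in> carrier T" "realize Q = h (realize P)"
    unfolding Q_def using hlim[OF converges_realize[OF P]]
    by (intro tcls_realize[where g = "h (realize P)"]; simp)+
qed

section \<open>Operations and inner product of the tensor product in realized form\<close>

lemma itensor_zero: "\<zero>\<^bsub>T\<^esub> \<in> carrier T" "realize \<zero>\<^bsub>T\<^esub> = \<zero>"
proof -
  have eq: "\<zero>\<^bsub>T\<^esub> = tcls A E E' (\<lambda>n. [])"
    by (simp add: itensor_def)
  show "\<zero>\<^bsub>T\<^esub> \<in> carrier T" "realize \<zero>\<^bsub>T\<^esub> = \<zero>"
    unfolding eq by (rule tcls_realize[where g = \<zero>]; simp add: ev_sum_Nil mod.converges_const)+
qed

lemma itensor_add:
  assumes "P \<in> carrier T" "Q \<in> carrier T"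
  shows "P \<oplus>\<^bsub>T\<^esub> Q \<in> carrier T" "realize (P \<oplus>\<^bsub>T\<^esub> Q) = realize P \<oplus> realize Q"
proof -
  have eq: "P \<oplus>\<^bsub>T\<^esub> Q = tcls A E E' (\<lambda>n. cls_rep P n @ cls_rep Q n)"
    by (simp add: itensor_def)
  have "cls_rep P n @ cls_rep Q n \<in> formal_sums"
    "ev_sum (cls_rep P n @ cls_rep Q n) = ev_sum (cls_rep P n) \<oplus> ev_sum (cls_rep Q n)" for n
    using cls_rep_sums[OF assms(1)] cls_rep_sums[OF assms(2)] ev_sum_append by simp_all
  then show "P \<oplus>\<^bsub>T\<^esub> Q \<in> carrier T" "realize (P \<oplus>\<^bsub>T\<^esub> Q) = realize P \<oplus> realize Q"
    unfolding eq using mod.converges_add[OF converges_realize[OF assms(1)] converges_realize[OF assms(2)]]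
    by (intro tcls_realize[where g = "realize P \<oplus> realize Q"]; simp)+
qed

lemma itensor_smult:
  assumes "P \<in> carrier T"
  shows "c \<odot>\<^bsub>T\<^esub> P \<in> carrier T" "realize (c \<odot>\<^bsub>T\<^esub> P) = c \<odot> realize P"
proof -
  have eq: "c \<odot>\<^bsub>T\<^esub> P = tcls A E E' (\<lambda>n. map (\<lambda>(x, y). (c \<odot>\<^bsub>E\<^esub> x, y)) (cls_rep P n))"
    by (simp add: itensor_def)
  show "c \<odot>\<^bsub>T\<^esub> P \<in> carrier T" "realize (c \<odot>\<^bsub>T\<^esub> P) = c \<odot> realize P"
    unfolding eq
    by (rule tcls_map_realize[where h = "\<lambda>g. c \<odot> g"];
        use assms in \<open>auto simp: mod.smult_closed mod.smult_add smult_closed ev_smult intro: mod.converges_smult\<close>)+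
qed

lemma itensor_ract:
  assumes "P \<in> carrier T" "a \<in> carrier A"
  shows "ract T P a \<in> carrier T" "realize (ract T P a) = ract G (realize P) a"
proof -
  have eq: "ract T P a = tcls A E E' (\<lambda>n. map (\<lambda>(x, y). (x, ract E' y a)) (cls_rep P n))"
    by (simp add: itensor_def)
  show "ract T P a \<in> carrier T" "realize (ract T P a) = ract G (realize P) a"
    unfolding eq
    by (rule tcls_map_realize[where h = "\<lambda>g. ract G g a"];
        use assms in \<open>auto simp: ract_closed ract_add_left ract_closed' ev_ract intro: converges_ract\<close>)+
qed

lemma itensor_lact:
  assumes "P \<in> carrier T" "a \<in> carrier A"
  shows "lact T a P \<in> carrier T" "realize (lact T a P) = lact G a (realize P)"
proof -
  have eq: "lact T a P = tcls A E E' (\<lambda>n. map (\<lambda>(x, y). (lact E a x, y)) (cls_rep P n))"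
    by (simp add: itensor_def)
  show "lact T a P \<in> carrier T" "realize (lact T a P) = lact G a (realize P)"
    unfolding eq
    by (rule tcls_map_realize[where h = "lact G a"];
        use assms in \<open>auto simp: lact_closed lact_add_right lact_closed' ev_lact intro: converges_lact\<close>)+
qed

lemma itensor_ip:
  assumes "P \<in> carrier T" "Q \<in> carrier T"
  shows "ip T P Q = ip G (realize P) (realize Q)"
proof -
  have "ip T P Q = nlim A (\<lambda>n. pre_ip A E E' (cls_rep P n) (cls_rep Q n))"
    by (simp add: itensor_def)
  also have "\<dots> = nlim A (\<lambda>n. ip G (ev_sum (cls_rep P n)) (ev_sum (cls_rep Q n)))"
    by (simp add: pre_ip_eq cls_rep_sums assms)
  also have "\<dots> = ip G (realize P) (realize Q)"
    by (intro nlim_eq cstar_algebra_axioms converges_ip converges_realize assms)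
  finally show ?thesis .
qed

lemma elem_tensor_realize:
  assumes "x \<in> carrier E" "y \<in> carrier E'"
  shows "elem_tensor A E E' x y \<in> carrier T" "realize (elem_tensor A E E' x y) = ev x y"
  unfolding elem_tensor_def
  by (rule tcls_realize[where g = "ev x y"];
      use assms mod.converges_const[OF ev_closed] in \<open>simp add: ev_sum_Cons ev_sum_Nil ev_closed\<close>)+

lemma bimodule_map_realize: "bimodule_map A T G realize"
  unfolding bimodule_map_def
  using realize_closed itensor_add itensor_smult itensor_ract itensor_lact by auto

lemma isometric_realize: "isometric T G realize"
  by (simp add: isometric_def itensor_ip)

text \<open>Each axiom becomes an equation in \<open>G\<close> after applying the injective
  \<open>realize\<close>. The optional rule in the closing steps serves these equations; closure
  goals skip it.\<close>

lemma module_itensor: "Module.module complex_ring T"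
proof -
  have neg: "(-1) \<odot>\<^bsub>T\<^esub> P \<oplus>\<^bsub>T\<^esub> P = \<zero>\<^bsub>T\<^esub>" if "P \<in> carrier T" for P
    using that
    by (intro realize_inj)
      (simp_all add: itensor_add itensor_smult itensor_zero realize_closed mod.l_neg flip: mod.minus_eq_smult)
  note ops = itensor_add itensor_smult itensor_zero realize_closed
  have ab: "abelian_group T"
  proof (rule abelian_groupI)
    show "\<exists>Q\<in>carrier T. Q \<oplus>\<^bsub>T\<^esub> P = \<zero>\<^bsub>T\<^esub>" if "P \<in> carrier T" for P
      using neg[OF that] itensor_smult(1)[OF that] by blast
  qed ((rule realize_inj)?; simp add: ops mod.a_ac)+
  show ?thesis
  proof (rule moduleI[OF cring_complex_ring ab])
  qed ((rule realize_inj)?; simp add: complex_ring_def ops mod.add_smult mod.smult_add mod.mult_smult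
      mod.smult_one mod.smult_closed)+
qed

text \<open>The terms of the sequence are realizations and not finite sums, so the n-th one is
  replaced by an evaluated formal sum at distance below 1/(n+1). The limit is unchanged, and the
  class of these sums realizes it.\<close>

lemma closed_submonoid_realize: "closed_submonoid (realize ` carrier T)"
  unfolding closed_submonoid_def
proof (intro conjI ballI allI impI)
  show "\<zero> \<in> realize ` carrier T"
    using itensor_zero by (metis imageI)
  show "g \<oplus> g' \<in> realize ` carrier T"
    if "g \<in> realize ` carrier T" "g' \<in> realize ` carrier T" for g g'
    using that itensor_add by (auto simp flip: itensor_add(2))
next
  fix s g assume s: "(\<forall>n. s n \<in> realize ` carrier T) \<and> mod.converges s g"
  have "\<exists>ts. ts \<in> formal_sums \<and> hnorm A G (s n \<ominus> ev_sum ts) < inverse (real (Suc n))" for n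
  proof -
    obtain P where P: "P \<in> carrier T" "s n = realize P" using s by blast
    then have "(\<lambda>k. hnorm A G (ev_sum (cls_rep P k) \<ominus> s n)) \<longlonglongrightarrow> 0"
      using converges_realize by (simp add: mod.converges_def)
    then have "\<forall>\<^sub>F k in sequentially. hnorm A G (ev_sum (cls_rep P k) \<ominus> s n) < inverse (real (Suc n))"
      by (rule order_tendstoD) simp
    then obtain k where "hnorm A G (ev_sum (cls_rep P k) \<ominus> s n) < inverse (real (Suc n))"
      by (auto simp: eventually_sequentially)
    then show ?thesis
      using P cls_rep_sums[of P k] realize_closed mod.N_minus_commute[of "ev_sum (cls_rep P k)" "s n"]
        ev_sum_closed by auto
  qed
  then obtain t where t: "\<And>n. t n \<in> formal_sums"
    "\<And>n. hnorm A G (s n \<ominus> ev_sum (t n)) < inverse (real (Suc n))" by metis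
  have sc: "s n \<in> carrier G" for n using s mod.convergesD by blast
  have lim: "(\<lambda>n. hnorm A G (s n \<ominus> ev_sum (t n))) \<longlonglongrightarrow> 0"
  proof (rule tendsto_sandwich[OF _ _ tendsto_const LIMSEQ_inverse_real_of_nat])
    show "\<forall>\<^sub>F n in sequentially. 0 \<le> hnorm A G (s n \<ominus> ev_sum (t n))"
      using t(1) sc by (intro always_eventually allI mod.N_nonneg mod.minus_closed ev_sum_closed)
    show "\<forall>\<^sub>F n in sequentially. hnorm A G (s n \<ominus> ev_sum (t n)) \<le> inverse (real (Suc n))"
      using t(2) by (intro always_eventually allI less_imp_le)
  qed
  have "mod.converges (\<lambda>n. ev_sum (t n)) g"
    by (rule mod.converges_close[OF conjunct2[OF s] ev_sum_closed[OF t(1)] lim])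
  from tcls_realize[OF t(1) this] show "g \<in> realize ` carrier T"
    by (metis imageI)
qed

text \<open>The induction principle for completed tensor products: membership has to be checked on
  elementary tensors only.\<close>

lemma realize_in_closed_submonoid:
  assumes S: "closed_submonoid S"
    and ev: "\<And>x y. \<lbrakk>x \<in> carrier E; y \<in> carrier E'\<rbrakk> \<Longrightarrow> ev x y \<in> S"
    and P: "P \<in> carrier T"
  shows "realize P \<in> S"
proof -
  have "ev_sum ts \<in> S" if "ts \<in> formal_sums" for ts
    using that S ev by (induction ts) (auto simp: ev_sum_Nil ev_sum_Cons closed_submonoid_def)
  then show ?thesis
    by (rule closed_submonoid_limit[OF S _ converges_realize[OF P]]) (rule cls_rep_sums[OF P])
qed

text \<open>Additivity forces h on finite sums of elementary tensors, and being isometric makes it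
  continuous.\<close>

lemma realize_unique:
  assumes bim: "bimodule_map A T G h" and iso: "isometric T G h"
    and elem: "\<And>x y. \<lbrakk>x \<in> carrier E; y \<in> carrier E'\<rbrakk> \<Longrightarrow> h (elem_tensor A E E' x y) = ev x y"
    and P: "P \<in> carrier T"
  shows "h P = realize P"
proof -
  have h: "h \<in> carrier T \<rightarrow> carrier G"
    "\<And>Q R. \<lbrakk>Q \<in> carrier T; R \<in> carrier T\<rbrakk> \<Longrightarrow> h (Q \<oplus>\<^bsub>T\<^esub> R) = h Q \<oplus> h R"
    using bim by (auto simp: bimodule_map_def)
  note diff = additive_diff[OF module_itensor complex_module h]
  have rdiff: "realize (Q \<ominus>\<^bsub>T\<^esub> R) = realize Q \<ominus> realize R" if "Q \<in> carrier T" "R \<in> carrier T" for Q R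
    using additive_diff(3)[OF module_itensor complex_module, of realize] realize_closed itensor_add(2) that
    by auto
  \<comment> \<open>h acts on classes, so a formal sum is rebuilt as a sum of elementary tensors
    inside \<open>T\<close>, with both images tracked along the way.\<close>
  have fin: "\<exists>Q\<in>carrier T. realize Q = ev_sum ts \<and> h Q = ev_sum ts" if "ts \<in> formal_sums" for ts
    using that
  proof (induction ts)
    case Nil
    then show ?case using diff(1) itensor_zero by (auto simp: ev_sum_Nil)
  next
    case (Cons t ts)
    then obtain x y Q where Q: "t = (x, y)" "x \<in> carrier E" "y \<in> carrier E'"
      "Q \<in> carrier T" "realize Q = ev_sum ts" "h Q = ev_sum ts" by auto
    then show ?case
      using elem_tensor_realize[OF Q(2,3)] elem[OF Q(2,3)]
      by (intro bexI[of _ "elem_tensor A E E' x y \<oplus>\<^bsub>T\<^esub> Q"])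
        (auto simp: itensor_add h(2) ev_sum_Cons)
  qed
  define approx where "approx n R \<longleftrightarrow> R \<in> carrier T \<and> realize R = ev_sum (cls_rep P n) \<and>
      h R = ev_sum (cls_rep P n)" for n R
  have "\<exists>R. approx n R" for n
    using fin[OF cls_rep_sums[OF P, of n]] by (auto simp: approx_def)
  then obtain Q where "\<And>n. approx n (Q n)" by metis
  then have Q: "\<And>n. Q n \<in> carrier T"
    "\<And>n. realize (Q n) = ev_sum (cls_rep P n)" "\<And>n. h (Q n) = ev_sum (cls_rep P n)"
    by (auto simp: approx_def)
  interpret T: abelian_group T by (rule module_complex_ringD(1)[OF module_itensor])
  \<comment> \<open>Both maps are additive and preserve inner products, so both distances equal the
    one between \<open>Q n\<close> and P in \<open>T\<close>.\<close>
  have "hnorm A G (h (Q n) \<ominus> h P) = hnorm A G (realize (Q n) \<ominus> realize P)" for n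
  proof -
    have D: "Q n \<ominus>\<^bsub>T\<^esub> P \<in> carrier T" using Q(1) P by auto
    have "hnorm A G (h (Q n) \<ominus> h P) = hnorm A G (h (Q n \<ominus>\<^bsub>T\<^esub> P))"
      by (simp add: diff(3) Q(1) P)
    also have "\<dots> = hnorm A G (realize (Q n \<ominus>\<^bsub>T\<^esub> P))"
      using iso D itensor_ip[OF D D] by (simp add: hnorm_def isometric_def)
    finally show ?thesis by (simp add: rdiff Q(1) P)
  qed
  then have "mod.converges (\<lambda>n. h (Q n)) (h P)"
    using converges_realize[OF P] h(1) P Q(1) by (auto simp: mod.converges_def Q(2))
  then show ?thesis
    using mod.converges_unique converges_realize[OF P] by (simp add: Q(3))
qed

end

text \<open>\<open>tensor_map\<close> changes the entries of a representative. When a bounded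
  additive h between the ambient correspondences induces this change, limits are respected and the
  tensor map turns into h. Naturality, associativity and the adjoint condition each supply their own
  h.\<close>

lemma tensor_map_realize:
  assumes "tensor_realization A G1 E1 E1' ev1" "tensor_realization A G2 E2 E2' ev2"
    and f: "f \<in> carrier E1 \<rightarrow> carrier E2" "f' \<in> carrier E1' \<rightarrow> carrier E2'"
    and h: "h \<in> carrier G1 \<rightarrow> carrier G2"
    and hadd: "\<And>g g'. \<lbrakk>g \<in> carrier G1; g' \<in> carrier G1\<rbrakk> \<Longrightarrow> h (g \<oplus>\<^bsub>G1\<^esub> g') = h g \<oplus>\<^bsub>G2\<^esub> h g'"
    and hbound: "\<And>g. g \<in> carrier G1 \<Longrightarrow> hnorm A G2 (h g) \<le> K * hnorm A G1 g"
    and hev: "\<And>x y. \<lbrakk>x \<in> carrier E1; y \<in> carrier E1'\<rbrakk> \<Longrightarrow> h (ev1 x y) = ev2 (f x) (f' y)"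
    and P: "P \<in> carrier (itensor A E1 E1')"
  shows "tensor_map A E2 E2' f f' P \<in> carrier (itensor A E2 E2')"
    and "tensor_realization.realize A G2 ev2 (tensor_map A E2 E2' f f' P) =
      h (tensor_realization.realize A G1 ev1 P)"
proof -
  interpret R1: tensor_realization A G1 E1 E1' ev1 by fact
  interpret R2: tensor_realization A G2 E2 E2' ev2 by fact
  have hdiff: "h \<zero>\<^bsub>G1\<^esub> = \<zero>\<^bsub>G2\<^esub>"
    "\<And>x y. \<lbrakk>x \<in> carrier G1; y \<in> carrier G1\<rbrakk> \<Longrightarrow> h (x \<ominus>\<^bsub>G1\<^esub> y) = h x \<ominus>\<^bsub>G2\<^esub> h y"
    by (rule additive_diff[OF R1.complex_module R2.complex_module h hadd]; assumption)+
  have sums: "map (map_prod f f') (cls_rep P n) \<in> R2.formal_sums" for n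
    using R1.cls_rep_sums[OF P, of n] f by (force simp: in_lists_conv_set)
  have "R2.ev_sum (map (map_prod f f') ts) = h (R1.ev_sum ts)" if "ts \<in> R1.formal_sums" for ts
    using that
    by (induction ts)
      (auto simp: R1.ev_sum_Nil R2.ev_sum_Nil R1.ev_sum_Cons R2.ev_sum_Cons hdiff(1) hadd hev
        R1.ev_closed R1.ev_sum_closed)
  then have "R2.mod.converges (\<lambda>n. R2.ev_sum (map (map_prod f f') (cls_rep P n))) (h (R1.realize P))"
    using converges_image[OF R1.mod.normed_vector_space_on_axioms R2.mod.normed_vector_space_on_axioms
        h hdiff(2) hbound R1.converges_realize[OF P]] R1.cls_rep_sums[OF P] by simp
  then show "tensor_map A E2 E2' f f' P \<in> carrier (itensor A E2 E2')"
    "R2.realize (tensor_map A E2 E2' f f' P) = h (R1.realize P)"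
    unfolding tensor_map_def using sums by (intro R2.tcls_realize[where g = "h (R1.realize P)"]; simp)+
qed

text \<open>Used to let one tensor factor vary: h is evaluation with the other factor fixed, and its
  boundedness makes the preimage closed.\<close>

lemma closed_submonoid_vimage:
  assumes "normed_correspondence A G1" "normed_correspondence A G2"
    and h: "h \<in> carrier G1 \<rightarrow> carrier G2"
    and hadd: "\<And>g g'. \<lbrakk>g \<in> carrier G1; g' \<in> carrier G1\<rbrakk> \<Longrightarrow> h (g \<oplus>\<^bsub>G1\<^esub> g') = h g \<oplus>\<^bsub>G2\<^esub> h g'"
    and hbound: "\<And>g. g \<in> carrier G1 \<Longrightarrow> hnorm A G2 (h g) \<le> K * hnorm A G1 g"
    and S: "normed_correspondence.closed_submonoid A G2 S"
  shows "normed_correspondence.closed_submonoid A G1 {g \<in> carrier G1. h g \<in> S}"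
proof -
  interpret G1: normed_correspondence A G1 by fact
  interpret G2: normed_correspondence A G2 by fact
  have hdiff: "h \<zero>\<^bsub>G1\<^esub> = \<zero>\<^bsub>G2\<^esub>"
    "\<And>x y. \<lbrakk>x \<in> carrier G1; y \<in> carrier G1\<rbrakk> \<Longrightarrow> h (x \<ominus>\<^bsub>G1\<^esub> y) = h x \<ominus>\<^bsub>G2\<^esub> h y"
    by (rule additive_diff[OF G1.complex_module G2.complex_module h hadd]; assumption)+
  have mem: "g \<in> carrier G1 \<and> h g \<in> S"
    if s: "\<forall>n. s n \<in> carrier G1 \<and> h (s n) \<in> S" and g: "G1.mod.converges s g" for s g
  proof
    show "g \<in> carrier G1" using g by (rule G1.mod.convergesD)
    show "h g \<in> S"
      by (rule G2.closed_submonoid_limit[OF S _ converges_image[OF G1.mod.normed_vector_space_on_axioms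
          G2.mod.normed_vector_space_on_axioms h hdiff(2) hbound g]]) (use s in auto)
  qed
  have zero: "\<zero>\<^bsub>G2\<^esub> \<in> S" and add: "\<And>x y. \<lbrakk>x \<in> S; y \<in> S\<rbrakk> \<Longrightarrow> x \<oplus>\<^bsub>G2\<^esub> y \<in> S"
    using S by (simp_all add: G2.closed_submonoid_def)
  show ?thesis
    unfolding G1.closed_submonoid_def
  proof (intro conjI ballI allI impI)
    show "g \<in> {g \<in> carrier G1. h g \<in> S}"
      if "(\<forall>n. s n \<in> {g \<in> carrier G1. h g \<in> S}) \<and> G1.mod.converges s g" for s g
      by (intro CollectI mem[of s]) (use that in simp_all)
  qed (simp_all add: hdiff(1) hadd zero add)
qed

section \<open>Associators from realizations\<close>

lemma bimodule_map_minus: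
  assumes "bimodule_map A E G T" "Module.module complex_ring E" "Module.module complex_ring G"
    and "x \<in> carrier E"
  shows "T (\<ominus>\<^bsub>E\<^esub> x) = \<ominus>\<^bsub>G\<^esub> T x"
  using assms(1) by (intro additive_diff(2)[OF assms(2,3) _ _ assms(4)]) (auto simp: bimodule_map_def)

text \<open>With \<open>F2 U V\<close> as \<open>\<kappa>\<close> this realizes the triple product
  bracketed to the left. The first factor enters the inner product only through <x, x'>, which an
  isometry preserves.\<close>

lemma tensor_realization_precompose_left:
  assumes "tensor_realization A G E E' ev" "Module.module complex_ring E"
    and bim: "bimodule_map A K E \<kappa>" and iso: "isometric K E \<kappa>" and K: "Module.module complex_ring K"
    and lact: "\<And>P a. \<lbrakk>P \<in> carrier K; a \<in> carrier A\<rbrakk> \<Longrightarrow> lact K a P \<in> carrier K"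
  shows "tensor_realization A G K E' (\<lambda>P y. ev (\<kappa> P) y)"
proof -
  interpret tensor_realization A G E E' ev by fact
  interpret K: abelian_group K by (rule module_complex_ringD(1)[OF K])
  have [simp]: "\<kappa> P \<in> carrier E" if "P \<in> carrier K" for P
    using bim that by (auto simp: bimodule_map_def)
  show ?thesis
  proof (intro tensor_realization.intro tensor_realization_axioms.intro)
    show "ip G (ev (\<kappa> P) y) (ev (\<kappa> P') y') = ip E' y (lact E' (ip K P P') y')"
      if "P \<in> carrier K" "y \<in> carrier E'" "P' \<in> carrier K" "y' \<in> carrier E'" for P y P' y'
      using iso that by (simp add: ev_ip isometric_def)
    show "ev (\<kappa> (\<ominus>\<^bsub>K\<^esub> P)) y = \<ominus>\<^bsub>G\<^esub> ev (\<kappa> P) y" if "P \<in> carrier K" "y \<in> carrier E'" for P y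
      using that by (simp add: bimodule_map_minus[OF bim K assms(2)] ev_minus)
    show "ev (\<kappa> (c \<odot>\<^bsub>K\<^esub> P)) y = c \<odot>\<^bsub>G\<^esub> ev (\<kappa> P) y" if "P \<in> carrier K" "y \<in> carrier E'" for c P y
      using bim that by (simp add: bimodule_map_def ev_smult)
    show "ev (\<kappa> (lact K a P)) y = lact G a (ev (\<kappa> P) y)"
      if "P \<in> carrier K" "y \<in> carrier E'" "a \<in> carrier A" for a P y
      using bim that by (simp add: bimodule_map_def ev_lact)
  qed (simp_all add: normed_correspondence_axioms ev_closed module_complex_ringD(2)[OF K]
      lact ract_closed' ev_ract)
qed

text \<open>The counterpart for the bracketing to the right. Since <x, x'> acts on the second entry,
  it also matters that \<open>\<kappa>\<close> intertwines the left actions.\<close>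

lemma tensor_realization_precompose_right:
  assumes "tensor_realization A G E E' ev"
    and ip: "\<And>x x'. \<lbrakk>x \<in> carrier E; x' \<in> carrier E\<rbrakk> \<Longrightarrow> ip E x x' \<in> carrier A"
    and bim: "bimodule_map A K E' \<kappa>" and iso: "isometric K E' \<kappa>"
    and ract: "\<And>Q a. \<lbrakk>Q \<in> carrier K; a \<in> carrier A\<rbrakk> \<Longrightarrow> ract K Q a \<in> carrier K"
    and lact: "\<And>Q a. \<lbrakk>Q \<in> carrier K; a \<in> carrier A\<rbrakk> \<Longrightarrow> lact K a Q \<in> carrier K"
  shows "tensor_realization A G E K (\<lambda>x Q. ev x (\<kappa> Q))"
proof -
  interpret tensor_realization A G E E' ev by fact
  have [simp]: "\<kappa> Q \<in> carrier E'" if "Q \<in> carrier K" for Q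
    using bim that by (auto simp: bimodule_map_def)
  show ?thesis
  proof (intro tensor_realization.intro tensor_realization_axioms.intro)
    show "ip G (ev x (\<kappa> Q)) (ev x' (\<kappa> Q')) = ip K Q (lact K (ip E x x') Q')"
      if "x \<in> carrier E" "Q \<in> carrier K" "x' \<in> carrier E" "Q' \<in> carrier K" for x Q x' Q'
    proof -
      have "ip K Q (lact K (ip E x x') Q') = ip E' (\<kappa> Q) (\<kappa> (lact K (ip E x x') Q'))"
        using iso that ip lact by (simp add: isometric_def)
      then show ?thesis
        using bim that ip by (simp add: bimodule_map_def ev_ip)
    qed
    show "ev x (\<kappa> (ract K Q a)) = ract G (ev x (\<kappa> Q)) a"
      if "x \<in> carrier E" "Q \<in> carrier K" "a \<in> carrier A" for a x Q
      using bim that by (simp add: bimodule_map_def ev_ract)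
  qed (simp_all add: normed_correspondence_axioms ev_closed minus_closed smult_closed ract
      lact_closed' ev_minus ev_smult ev_lact)
qed

text \<open>The associator is the first realization followed by the inverse of the second; equality
  of the images makes it total and onto. The final clause keeps this description available, because
  \<open>is_associator\<close> does not mention realizations.\<close>

lemma associator_exists:
  assumes "tensor_realization A G (itensor A E E') E'' ev1"
    and "tensor_realization A G E (itensor A E' E'') ev2"
    and elem1: "\<And>x y. \<lbrakk>x \<in> carrier E; y \<in> carrier E'\<rbrakk> \<Longrightarrow> elem_tensor A E E' x y \<in> carrier (itensor A E E')"
    and elem2: "\<And>y z. \<lbrakk>y \<in> carrier E'; z \<in> carrier E''\<rbrakk> \<Longrightarrow> elem_tensor A E' E'' y z \<in> carrier (itensor A E' E'')"
    and elem: "\<And>x y z. \<lbrakk>x \<in> carrier E; y \<in> carrier E'; z \<in> carrier E''\<rbrakk> \<Longrightarrow>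
      ev1 (elem_tensor A E E' x y) z = ev2 x (elem_tensor A E' E'' y z)"
    and image: "tensor_realization.realize A G ev1 ` carrier (itensor A (itensor A E E') E'') =
      tensor_realization.realize A G ev2 ` carrier (itensor A E (itensor A E' E''))"
  shows "\<exists>\<alpha>. is_associator A E E' E'' \<alpha> \<and>
    (\<forall>t\<in>carrier (itensor A (itensor A E E') E'').
      \<alpha> t \<in> carrier (itensor A E (itensor A E' E'')) \<and>
      tensor_realization.realize A G ev2 (\<alpha> t) = tensor_realization.realize A G ev1 t)"
proof -
  interpret R1: tensor_realization A G "itensor A E E'" E'' ev1 by fact
  interpret R2: tensor_realization A G E "itensor A E' E''" ev2 by fact
  define \<alpha> where "\<alpha> t = (SOME u. u \<in> carrier R2.T \<and> R2.realize u = R1.realize t)" for t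
  have \<alpha>: "\<alpha> t \<in> carrier R2.T \<and> R2.realize (\<alpha> t) = R1.realize t" if "t \<in> carrier R1.T" for t
  proof -
    have "R1.realize t \<in> R2.realize ` carrier R2.T"
      unfolding image[symmetric] using that by (rule imageI)
    then obtain u where u: "R1.realize t = R2.realize u" "u \<in> carrier R2.T" by (rule imageE)
    show ?thesis
      unfolding \<alpha>_def by (rule someI[of _ u]) (simp add: u)
  qed
  have eqI: "\<alpha> t = u" if "t \<in> carrier R1.T" "u \<in> carrier R2.T" "R2.realize u = R1.realize t" for t u
    by (rule R2.realize_inj) (simp_all add: that \<alpha>)
  have "bimodule_map A R1.T R2.T \<alpha>"
    unfolding bimodule_map_def
  proof (intro conjI ballI allI)
    show "\<alpha> \<in> carrier R1.T \<rightarrow> carrier R2.T" using \<alpha> by simp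
  qed (rule eqI; simp add: \<alpha> R1.itensor_add R1.itensor_smult R1.itensor_ract R1.itensor_lact
      R2.itensor_add R2.itensor_smult R2.itensor_ract R2.itensor_lact)+
  moreover have "isometric R1.T R2.T \<alpha>"
    by (simp add: isometric_def R1.itensor_ip R2.itensor_ip \<alpha>)
  moreover have "\<alpha> ` carrier R1.T = carrier R2.T"
  proof (intro equalityI subsetI)
    fix u assume u: "u \<in> carrier R2.T"
    have "R2.realize u \<in> R1.realize ` carrier R1.T"
      unfolding image using u by (rule imageI)
    then obtain t where t: "R2.realize u = R1.realize t" "t \<in> carrier R1.T" by (rule imageE)
    show "u \<in> \<alpha> ` carrier R1.T"
      by (rule image_eqI[of _ _ t]) (simp_all add: eqI[OF t(2) u t(1)] t)
  next
    show "u \<in> carrier R2.T" if "u \<in> \<alpha> ` carrier R1.T" for u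
      using that by (elim imageE) (simp add: \<alpha>)
  qed
  moreover have "\<alpha> (elem_tensor A (itensor A E E') E'' (elem_tensor A E E' x y) z) =
      elem_tensor A E (itensor A E' E'') x (elem_tensor A E' E'' y z)"
    if "x \<in> carrier E" "y \<in> carrier E'" "z \<in> carrier E''" for x y z
    by (rule eqI) (simp_all add: that elem1 elem2 elem R1.elem_tensor_realize R2.elem_tensor_realize)
  ultimately show ?thesis
    using \<alpha> unfolding is_associator_def by (intro exI[of _ \<alpha>]) simp
qed

text \<open>Inverses are defined by a description over carrier, zero and addition, so records
  sharing these fields share subtraction.\<close>

lemma a_minus_cong:
  assumes "carrier R = carrier S" "\<zero>\<^bsub>R\<^esub> = \<zero>\<^bsub>S\<^esub>" "add R = add S"
  shows "a_minus R x y = a_minus S x y"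
  using assms by (simp add: a_minus_def a_inv_def m_inv_def)

text \<open>\<open>End_alg\<close> and \<open>module_functor_ob\<close> copy the linear structure of
  a morphism space into records of other types; this carries the module axioms over.\<close>

lemma module_complex_ring_cong:
  assumes "Module.module complex_ring V" "carrier W = carrier V" "\<zero>\<^bsub>W\<^esub> = \<zero>\<^bsub>V\<^esub>" "add W = add V"
    "smult W = smult V"
  shows "Module.module complex_ring W"
proof -
  note V = module_complex_ringD[OF assms(1)]
  interpret V: abelian_group V by (rule V(1))
  have "abelian_group W"
  proof (rule abelian_groupI)
    show "\<exists>y\<in>carrier W. y \<oplus>\<^bsub>W\<^esub> x = \<zero>\<^bsub>W\<^esub>" if "x \<in> carrier W" for x
      using that V.l_neg V.a_inv_closed by (auto simp: assms)
  qed (simp_all add: assms V.a_ac)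
  then show ?thesis
    by (rule moduleI[OF cring_complex_ring]) (simp_all add: assms complex_ring_def V)
qed

text \<open>Meant for \<open>hnorm\<close> and the norm of a morphism space, whose agreement is
  known on the carrier only.\<close>

lemma cauchy_complete_cong:
  fixes S :: "'x set"
  assumes "\<And>x y. \<lbrakk>x \<in> S; y \<in> S\<rbrakk> \<Longrightarrow> d x y = d' x y"
  shows "cauchy_complete S d \<longleftrightarrow> cauchy_complete S d'"
proof -
  have imp: "cauchy_complete S f" if g: "cauchy_complete S g" and eq: "\<And>x y. \<lbrakk>x \<in> S; y \<in> S\<rbrakk> \<Longrightarrow> f x y = g x y"
    for f g :: "'x \<Rightarrow> 'x \<Rightarrow> real"
    unfolding cauchy_complete_def
  proof (intro allI impI)
    fix s :: "nat \<Rightarrow> 'x"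
    assume s: "(\<forall>n. s n \<in> S) \<and> (\<forall>e>0. \<exists>N. \<forall>m\<ge>N. \<forall>n\<ge>N. f (s m) (s n) < e)"
    then obtain x where "x \<in> S" "(\<lambda>n. g (s n) x) \<longlonglongrightarrow> 0"
      using g[unfolded cauchy_complete_def, THEN spec[of _ s]] by (auto simp: eq)
    then show "\<exists>x\<in>S. (\<lambda>n. f (s n) x) \<longlonglongrightarrow> 0"
      using s by (auto simp: eq)
  qed
  show ?thesis using imp[of d d'] imp[of d' d] assms by auto
qed

section \<open>Norms and endomorphism algebras in a C*-category\<close>

context cstar_category
begin

lemma nrm_nonneg: "\<lbrakk>U \<in> Ob C; V \<in> Ob C; T \<in> mors C U V\<rbrakk> \<Longrightarrow> 0 \<le> nrm (Mor C U V) T"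
  using banach_space_on.nrm_nonneg[OF banach] .

lemma nrm_dag:
  assumes "U \<in> Ob C" "V \<in> Ob C" "T \<in> mors C U V"
  shows "nrm (Mor C V U) (dag C T) = nrm (Mor C U V) T"
proof -
  have le: "nrm (Mor C U V) T \<le> nrm (Mor C V U) (dag C T)"
    if "U \<in> Ob C" "V \<in> Ob C" "T \<in> mors C U V" for U V T
  proof (cases "nrm (Mor C U V) T = 0")
    case True
    then show ?thesis using nrm_nonneg[of V U "dag C T"] dag_closed that by simp
  next
    case False
    have "nrm (Mor C U V) T * nrm (Mor C U V) T \<le> nrm (Mor C V U) (dag C T) * nrm (Mor C U V) T"
      using nrm_cmp[of U V U "dag C T" T] cstar_identity[of U V T] dag_closed that
      by (simp add: power2_eq_square)
    then show ?thesis using False nrm_nonneg[of U V T] that by simp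
  qed
  show ?thesis
    using le[of U V T] le[of V U "dag C T"] dag_closed[of U V T] dag_dag[of U V T] assms by simp
qed

lemma dag_id:
  assumes "U \<in> Ob C"
  shows "dag C (idm C U) = idm C U"
proof -
  have d: "dag C (idm C U) \<in> mors C U U"
    using assms by (intro dag_closed id_closed)
  have "dag C (dag C (idm C U) \<diamondop> idm C U) = dag C (idm C U) \<diamondop> dag C (dag C (idm C U))"
    using assms d by (intro dag_cmp[of U U U] id_closed)
  then show ?thesis
    using assms d by (simp add: id_right[of U U] dag_dag[of U U] id_closed)
qed

lemma cstar_algebra_End_alg:
  assumes U: "U \<in> Ob C"
  shows "cstar_algebra (End_alg C U)"
proof -
  interpret B: banach_space_on "Mor C U U" using banach U U by blast
  let ?A = "End_alg C U"
  have sel: "carrier ?A = mors C U U" "\<zero>\<^bsub>?A\<^esub> = \<zero>\<^bsub>Mor C U U\<^esub>" "add ?A = add (Mor C U U)"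
    "smult ?A = smult (Mor C U U)" "nrm ?A = nrm (Mor C U U)" "monoid.mult ?A = cmp C"
    "one ?A = idm C U" "star ?A = dag C"
    by (simp_all add: End_alg_def)
  have mod: "Module.module complex_ring ?A"
    by (rule module_complex_ring_cong[OF B.complex_module]) (simp_all add: sel)
  have minus: "a_minus ?A x y = a_minus (Mor C U U) x y" for x y
    by (rule a_minus_cong) (simp_all add: sel)
  have "banach_space_on ?A"
    by (rule banach_space_on.intro) (simp_all add: mod minus sel B.nrm_nonneg B.nrm_eq_0_iff B.nrm_triangle
        B.nrm_smult B.complete)
  moreover have "ring ?A"
  proof (rule ringI[OF module_complex_ringD(1)[OF mod]])
    show "Group.monoid ?A"
      by (rule monoidI) (use U in \<open>auto simp: sel id_closed id_left[of U U] id_right[of U U]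
          intro: cmp_closed[of U U U] cmp_assoc[of U U U U]\<close>)
  qed (use U in \<open>auto simp: sel intro: cmp_add_left[of U U U] cmp_add_right[of U U U]\<close>)
  ultimately show ?thesis
    by (intro cstar_algebra.intro)
      (use U in \<open>simp_all add: sel cmp_smult_left[of U U U] cmp_smult_right[of U U U]
        dag_dag[of U U] dag_add[of U U] dag_smult[of U U] dag_cmp[of U U U] nrm_cmp[of U U U]
        cstar_identity[of U U] dag_closed[of U U]\<close>)
qed

end

section \<open>The functor of a module category\<close>

lemma End_alg_sel:
  "carrier (End_alg C U) = mors C U U" "\<zero>\<^bsub>End_alg C U\<^esub> = \<zero>\<^bsub>Mor C U U\<^esub>"
  "add (End_alg C U) = add (Mor C U U)" "smult (End_alg C U) = smult (Mor C U U)"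
  "nrm (End_alg C U) = nrm (Mor C U U)" "monoid.mult (End_alg C U) = cmp C"
  "one (End_alg C U) = idm C U" "star (End_alg C U) = dag C"
  by (simp_all add: End_alg_def)

lemma module_functor_ob_sel:
  "carrier (module_functor_ob \<M> C M U) = mors \<M> M (actob \<M> M U)"
  "\<zero>\<^bsub>module_functor_ob \<M> C M U\<^esub> = \<zero>\<^bsub>Mor \<M> M (actob \<M> M U)\<^esub>"
  "add (module_functor_ob \<M> C M U) = add (Mor \<M> M (actob \<M> M U))"
  "smult (module_functor_ob \<M> C M U) = smult (Mor \<M> M (actob \<M> M U))"
  "ip (module_functor_ob \<M> C M U) X Y = dag \<M> X \<diamondop>\<^bsub>\<M>\<^esub> Y"
  "ract (module_functor_ob \<M> C M U) X a = X \<diamondop>\<^bsub>\<M>\<^esub> a"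
  "lact (module_functor_ob \<M> C M U) a X = actmor \<M> a (idm C U) \<diamondop>\<^bsub>\<M>\<^esub> X"
  by (simp_all add: module_functor_ob_def)

section \<open>The amplification X \<mapsto> X \<otimes> \<iota>\<close>

context strict_right_module_cstar_category
begin

abbreviation amp :: "'o \<Rightarrow> 'n \<Rightarrow> 'n" where
  "amp V X \<equiv> actmor \<M> X (idm C V)"

sublocale am: bilinear_unitary_functor \<M> C \<M> "actob \<M>" "actmor \<M>"
  by (rule act)

sublocale tm: bilinear_unitary_functor C C C "tob C" "tmor C"
  by (rule tensor_cat.tensor)

lemma amp_closed:
  "\<lbrakk>N \<in> Ob \<M>; N' \<in> Ob \<M>; V \<in> Ob C; X \<in> mors \<M> N N'\<rbrakk>
    \<Longrightarrow> amp V X \<in> mors \<M> (actob \<M> N V) (actob \<M> N' V)"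
  by (intro am.mor_closed tensor_cat.id_closed)

lemma amp_cmp:
  assumes "N \<in> Ob \<M>" "N' \<in> Ob \<M>" "N'' \<in> Ob \<M>" "V \<in> Ob C" "X' \<in> mors \<M> N' N''" "X \<in> mors \<M> N N'"
  shows "amp V (X' \<diamondop>\<^bsub>\<M>\<^esub> X) = amp V X' \<diamondop>\<^bsub>\<M>\<^esub> amp V X"
  using am.mor_cmp[of N N' N'' V V V X' X "idm C V" "idm C V"] assms
  by (simp add: tensor_cat.id_closed tensor_cat.id_left[of V V])

lemma amp_dag:
  assumes "N \<in> Ob \<M>" "N' \<in> Ob \<M>" "V \<in> Ob C" "X \<in> mors \<M> N N'"
  shows "amp V (dag \<M> X) = dag \<M> (amp V X)"
  using am.mor_dag[of N N' V V X "idm C V"] assms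
  by (simp add: tensor_cat.id_closed tensor_cat.dag_id)

lemma amp_amp:
  assumes "N \<in> Ob \<M>" "N' \<in> Ob \<M>" "V \<in> Ob C" "W \<in> Ob C" "X \<in> mors \<M> N N'"
  shows "amp W (amp V X) = amp (tob C V W) X"
  using actmor_assoc[of N N' V V W W X "idm C V" "idm C W"] assms
  by (simp add: tensor_cat.id_closed tm.mor_id)

text \<open>Together with \<open>interchange_right\<close>: both composites are X \<otimes> T, so X
  \<otimes> \<iota> and \<iota> \<otimes> T can be exchanged.\<close>

lemma interchange_left:
  assumes "N \<in> Ob \<M>" "N' \<in> Ob \<M>" "V \<in> Ob C" "V' \<in> Ob C" "X \<in> mors \<M> N N'" "T \<in> mors C V V'"
  shows "amp V' X \<diamondop>\<^bsub>\<M>\<^esub> actmor \<M> (idm \<M> N) T = actmor \<M> X T"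
  using am.mor_cmp[of N N N' V V' V' X "idm \<M> N" "idm C V'" T] assms
  by (simp add: tensor_cat.id_closed id_closed tensor_cat.id_left[of V V'] id_right[of N N'])

lemma interchange_right:
  assumes "N \<in> Ob \<M>" "N' \<in> Ob \<M>" "V \<in> Ob C" "V' \<in> Ob C" "X \<in> mors \<M> N N'" "T \<in> mors C V V'"
  shows "actmor \<M> (idm \<M> N') T \<diamondop>\<^bsub>\<M>\<^esub> amp V X = actmor \<M> X T"
  using am.mor_cmp[of N N' N' V V V' "idm \<M> N'" X T "idm C V"] assms
  by (simp add: tensor_cat.id_closed id_closed tensor_cat.id_right[of V V'] id_left[of N N'])

lemma nrm_amp:
  assumes N: "N \<in> Ob \<M>" "N' \<in> Ob \<M>" and V: "V \<in> Ob C" and X: "X \<in> mors \<M> N N'"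
  shows "nrm (Mor \<M> (actob \<M> N V) (actob \<M> N' V)) (amp V X) \<le> nrm (Mor \<M> N N') X"
proof -
  note ob = am.ob_closed[OF N(1) V] am.ob_closed[OF N(2) V]
  have XX: "dag \<M> X \<diamondop>\<^bsub>\<M>\<^esub> X \<in> mors \<M> N N"
    using N X by (intro cmp_closed[of N N' N] dag_closed)
  have "nrm (End_alg \<M> (actob \<M> N V)) (amp V (dag \<M> X \<diamondop>\<^bsub>\<M>\<^esub> X))
      \<le> nrm (End_alg \<M> N) (dag \<M> X \<diamondop>\<^bsub>\<M>\<^esub> X)"
  proof (rule star_homomorphism_contractive)
    show "cstar_algebra (End_alg \<M> N)" "cstar_algebra (End_alg \<M> (actob \<M> N V))"
      using N ob by (intro cstar_algebra_End_alg; simp)+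
    show "amp V \<in> carrier (End_alg \<M> N) \<rightarrow> carrier (End_alg \<M> (actob \<M> N V))"
      using N V by (auto simp: End_alg_sel intro: amp_closed)
  qed (use N V XX in \<open>simp_all add: End_alg_sel am.mor_add_left[of N N V V] am.mor_smult_left[of N N V V]
      tensor_cat.id_closed am.mor_id amp_cmp[of N N N] amp_dag[of N N]\<close>)
  moreover have "amp V (dag \<M> X \<diamondop>\<^bsub>\<M>\<^esub> X) = dag \<M> (amp V X) \<diamondop>\<^bsub>\<M>\<^esub> amp V X"
    using N V X by (simp add: amp_cmp[of N N' N] amp_dag[of N N'] dag_closed)
  ultimately have "(nrm (Mor \<M> (actob \<M> N V) (actob \<M> N' V)) (amp V X))\<^sup>2 \<le> (nrm (Mor \<M> N N') X)\<^sup>2"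
    using N V X ob amp_closed[of N N' V X]
    by (simp add: End_alg_sel cstar_identity[of N N'] cstar_identity[of "actob \<M> N V" "actob \<M> N' V"])
  then show ?thesis
    using nrm_nonneg[of N N' X] N X by (rule_tac power2_le_imp_le) simp_all
qed

end

locale module_functor = strict_right_module_cstar_category C \<M>
  for C :: "('o, 'm, 'z) tensor_category_scheme"
    and \<M> :: "('p, 'n, 'o, 'm, 'y) module_category_scheme" +
  fixes M :: 'p
  assumes M: "M \<in> Ob \<M>"
begin

abbreviation A :: "'n star_algebra" where
  "A \<equiv> End_alg \<M> M"

abbreviation F :: "'o \<Rightarrow> ('n, 'n) corr" where
  "F \<equiv> module_functor_ob \<M> C M"

abbreviation Fm :: "'m \<Rightarrow> 'n \<Rightarrow> 'n" where
  "Fm \<equiv> module_functor_mor \<M> M"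

abbreviation ev :: "'o \<Rightarrow> 'n \<Rightarrow> 'n \<Rightarrow> 'n" where
  "ev V X Y \<equiv> amp V X \<diamondop>\<^bsub>\<M>\<^esub> Y"

lemmas sel = End_alg_sel module_functor_ob_sel

lemma ob: "U \<in> Ob C \<Longrightarrow> actob \<M> M U \<in> Ob \<M>"
  using M by (rule am.ob_closed)

lemma ev_closed':
  assumes "N \<in> Ob \<M>" "N' \<in> Ob \<M>" "V \<in> Ob C" "X \<in> mors \<M> N N'" "Y \<in> mors \<M> M (actob \<M> N V)"
  shows "ev V X Y \<in> mors \<M> M (actob \<M> N' V)"
  using assms M amp_closed[of N N' V X] am.ob_closed
  by (intro cmp_closed[of M "actob \<M> N V" "actob \<M> N' V"]) simp_all

lemma ev_in:
  assumes "U \<in> Ob C" "V \<in> Ob C" "X \<in> mors \<M> M (actob \<M> M U)" "Y \<in> mors \<M> M (actob \<M> M V)"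
  shows "ev V X Y \<in> mors \<M> M (actob \<M> M (tob C U V))"
  using ev_closed'[of M "actob \<M> M U" V X Y] assms M ob by (simp add: actob_assoc)

text \<open>By strictness the double amplification of X is a single one. The lemma yields
  associativity for X in F(U), compatibility with the left action for X in A, and the adjoint
  condition for the adjoint of an element of F(U).\<close>

lemma ev_assoc:
  assumes N: "N \<in> Ob \<M>" "N' \<in> Ob \<M>" and V: "V \<in> Ob C" "W \<in> Ob C"
    and X: "X \<in> mors \<M> N N'" and Y: "Y \<in> mors \<M> M (actob \<M> N V)"
    and Z: "Z \<in> mors \<M> M (actob \<M> M W)"
  shows "ev W (ev V X Y) Z = ev (tob C V W) X (ev W Y Z)"
proof -
  note obs = am.ob_closed[OF N(1) V(1)] am.ob_closed[OF N(2) V(1)] am.ob_closed[OF M V(2)]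
  note obs2 = am.ob_closed[OF obs(1) V(2)] am.ob_closed[OF obs(2) V(2)]
  have "amp W (ev V X Y) = amp W (amp V X) \<diamondop>\<^bsub>\<M>\<^esub> amp W Y"
    by (rule amp_cmp[OF M obs(1,2) V(2) amp_closed[OF N V(1) X] Y])
  then have "ev W (ev V X Y) Z = amp W (amp V X) \<diamondop>\<^bsub>\<M>\<^esub> amp W Y \<diamondop>\<^bsub>\<M>\<^esub> Z"
    by simp
  also have "\<dots> = amp W (amp V X) \<diamondop>\<^bsub>\<M>\<^esub> (amp W Y \<diamondop>\<^bsub>\<M>\<^esub> Z)"
    by (rule cmp_assoc[OF M obs(3) obs2 amp_closed[OF obs(1,2) V(2) amp_closed[OF N V(1) X]]
        amp_closed[OF M obs(1) V(2) Y] Z])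
  finally show ?thesis
    by (simp add: amp_amp[OF N V X])
qed

text \<open>Amplification commutes with \<open>dag\<close>, so the two middle factors merge into one
  amplification. Taking X' to be the identity gives the adjoint of the left action.\<close>

lemma ev_ip':
  assumes N: "N \<in> Ob \<M>" "N' \<in> Ob \<M>" and V: "V \<in> Ob C"
    and X: "X \<in> mors \<M> N N'" "X' \<in> mors \<M> N N'"
    and Y: "Y \<in> mors \<M> M (actob \<M> N V)" "Y' \<in> mors \<M> M (actob \<M> N V)"
  shows "dag \<M> (ev V X Y) \<diamondop>\<^bsub>\<M>\<^esub> ev V X' Y' = dag \<M> Y \<diamondop>\<^bsub>\<M>\<^esub> ev V (dag \<M> X \<diamondop>\<^bsub>\<M>\<^esub> X') Y'"
proof -
  note obs = am.ob_closed[OF N(1) V] am.ob_closed[OF N(2) V]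
  note c = amp_closed[OF N V X(1)] amp_closed[OF N V X(2)]
  note d = dag_closed[OF obs c(1)] dag_closed[OF M obs(1) Y(1)]
  have e: "amp V X' \<diamondop>\<^bsub>\<M>\<^esub> Y' \<in> mors \<M> M (actob \<M> N' V)"
    by (rule ev_closed'[OF N V X(2) Y(2)])
  have "dag \<M> (ev V X Y) \<diamondop>\<^bsub>\<M>\<^esub> ev V X' Y' = dag \<M> Y \<diamondop>\<^bsub>\<M>\<^esub> dag \<M> (amp V X) \<diamondop>\<^bsub>\<M>\<^esub> ev V X' Y'"
    by (simp add: dag_cmp[OF M obs c(1) Y(1)])
  also have "\<dots> = dag \<M> Y \<diamondop>\<^bsub>\<M>\<^esub> (dag \<M> (amp V X) \<diamondop>\<^bsub>\<M>\<^esub> ev V X' Y')"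
    by (rule cmp_assoc[OF M obs(2,1) M d(2,1) e])
  also have "dag \<M> (amp V X) \<diamondop>\<^bsub>\<M>\<^esub> ev V X' Y' = dag \<M> (amp V X) \<diamondop>\<^bsub>\<M>\<^esub> amp V X' \<diamondop>\<^bsub>\<M>\<^esub> Y'"
    by (rule cmp_assoc[OF M obs(1,2) obs(1) d(1) c(2) Y(2), symmetric])
  also have "dag \<M> (amp V X) \<diamondop>\<^bsub>\<M>\<^esub> amp V X' = amp V (dag \<M> X \<diamondop>\<^bsub>\<M>\<^esub> X')"
    by (simp add: amp_cmp[OF N N(1) V dag_closed[OF N X(1)] X(2)] amp_dag[OF N V X(1)])
  finally show ?thesis .
qed

lemma nrm_ev:
  assumes "N \<in> Ob \<M>" "N' \<in> Ob \<M>" "V \<in> Ob C" "X \<in> mors \<M> N N'" "Y \<in> mors \<M> M (actob \<M> N V)"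
  shows "nrm (Mor \<M> M (actob \<M> N' V)) (ev V X Y) \<le> nrm (Mor \<M> N N') X * nrm (Mor \<M> M (actob \<M> N V)) Y"
proof -
  note obs = am.ob_closed[OF assms(1,3)] am.ob_closed[OF assms(2,3)]
  have "nrm (Mor \<M> M (actob \<M> N' V)) (ev V X Y)
      \<le> nrm (Mor \<M> (actob \<M> N V) (actob \<M> N' V)) (amp V X) * nrm (Mor \<M> M (actob \<M> N V)) Y"
    by (rule nrm_cmp[OF M obs amp_closed[OF assms(1-4)] assms(5)])
  also have "\<dots> \<le> nrm (Mor \<M> N N') X * nrm (Mor \<M> M (actob \<M> N V)) Y"
    by (rule mult_right_mono[OF nrm_amp[OF assms(1-4)] nrm_nonneg[OF M obs(1) assms(5)]])
  finally show ?thesis .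
qed

section \<open>The correspondences F(U)\<close>

lemma cstar_algebra_A: "cstar_algebra A"
  using M by (rule cstar_algebra_End_alg)

lemma module_F: "U \<in> Ob C \<Longrightarrow> Module.module complex_ring (F U)"
  by (rule module_complex_ring_cong[OF banach_space_on.complex_module[OF banach[OF M ob]]])
    (simp_all add: sel)

lemma minus_F: "a_minus (F U) X Y = a_minus (Mor \<M> M (actob \<M> M U)) X Y"
  by (rule a_minus_cong) (simp_all add: sel)

text \<open>This is the C*-identity; through it completeness and the norm estimates are inherited
  from the morphism spaces.\<close>

lemma hnorm_F:
  assumes "U \<in> Ob C" "X \<in> carrier (F U)"
  shows "hnorm A (F U) X = nrm (Mor \<M> M (actob \<M> M U)) X"
  using assms cstar_identity[OF M ob, of U X] nrm_nonneg[OF M ob, of U X]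
  by (simp add: hnorm_def sel)

lemma lact_adjoint_F:
  assumes U: "U \<in> Ob C" and a: "a \<in> carrier A"
  shows "is_adjoint (F U) (F U) (lact (F U) a) (lact (F U) (star A a))"
proof -
  have a': "a \<in> mors \<M> M M" "dag \<M> a \<in> mors \<M> M M" "idm \<M> M \<in> mors \<M> M M"
    using a M by (simp_all add: sel dag_closed id_closed)
  have "dag \<M> (ev U a X) \<diamondop>\<^bsub>\<M>\<^esub> Y = dag \<M> X \<diamondop>\<^bsub>\<M>\<^esub> ev U (dag \<M> a) Y"
    if "X \<in> mors \<M> M (actob \<M> M U)" "Y \<in> mors \<M> M (actob \<M> M U)" for X Y
    using ev_ip'[OF M M U a'(1,3) that] that M U ob a'(2)
    by (simp add: am.mor_id id_left[of M "actob \<M> M U"] id_right[of M M])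
  then show ?thesis
    using ev_closed'[OF M M U a'(1)] ev_closed'[OF M M U a'(2)] by (auto simp: is_adjoint_def sel)
qed

lemma cauchy_complete_F:
  assumes U: "U \<in> Ob C"
  shows "cauchy_complete (carrier (F U)) (\<lambda>x y. hnorm A (F U) (x \<ominus>\<^bsub>F U\<^esub> y))"
proof -
  interpret F: abelian_group "F U"
    by (rule module_complex_ringD(1)[OF module_F[OF U]])
  have eq: "hnorm A (F U) (x \<ominus>\<^bsub>F U\<^esub> y) = nrm (Mor \<M> M (actob \<M> M U)) (x \<ominus>\<^bsub>Mor \<M> M (actob \<M> M U)\<^esub> y)"
    if "x \<in> carrier (F U)" "y \<in> carrier (F U)" for x y
    using hnorm_F[OF U F.minus_closed[OF that]] by (simp add: minus_F)
  show ?thesis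
  proof (rule iffD2[OF cauchy_complete_cong[OF eq]])
    show "cauchy_complete (carrier (F U))
        (\<lambda>x y. nrm (Mor \<M> M (actob \<M> M U)) (x \<ominus>\<^bsub>Mor \<M> M (actob \<M> M U)\<^esub> y))"
      unfolding sel by (rule banach_space_on.complete[OF banach[OF M ob[OF U]]])
  qed
qed

text \<open>Positivity of the inner product is an axiom of C*-categories, definiteness comes from
  the C*-identity, and the algebraic axioms are those of composition.\<close>

lemma right_hilbert_module_F:
  assumes U: "U \<in> Ob C"
  shows "right_hilbert_module A (F U)"
proof (intro right_hilbert_module.intro right_hilbert_module_axioms.intro cstar_algebra_A module_F U
    cauchy_complete_F)
  note o = M ob[OF U]
  show "X = \<zero>\<^bsub>F U\<^esub>" if "X \<in> carrier (F U)" "ip (F U) X X = \<zero>\<^bsub>A\<^esub>" for X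
  proof -
    have c: "dag \<M> X \<diamondop>\<^bsub>\<M>\<^esub> X \<in> mors \<M> M M"
      using that(1) by (intro cmp_closed[OF M ob[OF U] M dag_closed[OF o]]) (simp_all add: sel)
    have "nrm (Mor \<M> M M) (dag \<M> X \<diamondop>\<^bsub>\<M>\<^esub> X) = 0"
      by (rule iffD2[OF banach_space_on.nrm_eq_0_iff[OF banach[OF M M] c]]) (use that(2) in \<open>simp add: sel\<close>)
    then have "nrm (Mor \<M> M (actob \<M> M U)) X = 0"
      using cstar_identity[OF o] that(1) by (simp add: sel)
    then show ?thesis
      using banach_space_on.nrm_eq_0_iff[OF banach[OF o]] that(1) by (simp add: sel)
  qed
qed (use M ob[OF U] in \<open>simp_all add: sel dag_closed[OF M ob[OF U]] cmp_closed[OF M M ob[OF U]]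
  cmp_add_left[OF M M ob[OF U]] cmp_add_right[OF M M ob[OF U]] cmp_smult_left[OF M M ob[OF U]]
  cmp_smult_right[OF M M ob[OF U]] id_right[of M "actob \<M> M U"] cmp_assoc[OF M M M ob[OF U]]
  cmp_closed[OF M ob[OF U] M] cmp_add_right[OF M ob[OF U] M] cmp_smult_right[OF M ob[OF U] M]
  cmp_assoc[OF M M ob[OF U] M] dag_cmp[OF M ob[OF U] M] dag_dag[OF M ob[OF U]]
  dag_cmp_positive\<close>)


text \<open>Cauchy-Schwarz is submultiplicativity of the norm, as \<open>dag\<close> is isometric;
  the bound for the left action is contractivity of amplification, used through
  \<open>nrm_ev\<close>.\<close>

lemma normed_correspondence_F:
  assumes U: "U \<in> Ob C"
  shows "normed_correspondence A (F U)"
proof -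
  note o = M ob[OF U]
  note nrm_0 = banach_space_on.nrm_eq_0_iff[OF banach[OF o]]
  interpret right_hilbert_module A "F U" using U by (rule right_hilbert_module_F)
  interpret F: abelian_group "F U"
    by (rule module_complex_ringD(1)[OF module_F[OF U]])
  have amp: "\<And>a. a \<in> mors \<M> M M \<Longrightarrow> amp U a \<in> mors \<M> (actob \<M> M U) (actob \<M> M U)"
    by (rule amp_closed[OF M M U])
  show ?thesis
  proof (intro normed_correspondence.intro correspondence.intro normed_correspondence_axioms.intro
      correspondence_axioms.intro right_hilbert_module_axioms)
    show "is_adjoint (F U) (F U) (lact (F U) a) (lact (F U) (star A a))" if "a \<in> carrier A" for a
      using U that by (rule lact_adjoint_F)
    show "lact (F U) (a \<oplus>\<^bsub>A\<^esub> b) X = lact (F U) a X \<oplus>\<^bsub>F U\<^esub> lact (F U) b X"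
      if "a \<in> carrier A" "b \<in> carrier A" "X \<in> carrier (F U)" for a b X
      using that by (simp add: sel am.mor_add_left[OF M M U U] tensor_cat.id_closed[OF U]
          cmp_add_left[OF o(1,2,2)] amp)
    show "lact (F U) (c \<odot>\<^bsub>A\<^esub> a) X = c \<odot>\<^bsub>F U\<^esub> lact (F U) a X"
      if "a \<in> carrier A" "X \<in> carrier (F U)" for c a X
      using that by (simp add: sel am.mor_smult_left[OF M M U U] tensor_cat.id_closed[OF U]
          cmp_smult_left[OF o(1,2,2)] amp)
    show "lact (F U) (a \<otimes>\<^bsub>A\<^esub> b) X = lact (F U) a (lact (F U) b X)"
      if "a \<in> carrier A" "b \<in> carrier A" "X \<in> carrier (F U)" for a b X
      using that by (simp add: sel amp_cmp[OF M M M U] cmp_assoc[OF o(1,2,2,2)] amp)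
    show "\<exists>ts\<in>lists (carrier A \<times> carrier (F U)).
        hnorm A (F U) (X \<ominus>\<^bsub>F U\<^esub> lsum (F U) (\<lambda>(a, y). lact (F U) a y) ts) < e"
      if X: "X \<in> carrier (F U)" and "0 < e" for X e
    \<comment> \<open>The unit of A acts as the identity, so a single term gives X exactly.\<close>
    proof (intro bexI[of _ "[(\<one>\<^bsub>A\<^esub>, X)]"])
      have "lact (F U) \<one>\<^bsub>A\<^esub> X = X"
        using X by (simp add: sel am.mor_id[OF M U] id_left[OF o])
      then have "X \<ominus>\<^bsub>F U\<^esub> lsum (F U) (\<lambda>(a, y). lact (F U) a y) [(\<one>\<^bsub>A\<^esub>, X)] = \<zero>\<^bsub>F U\<^esub>"
        using X by (simp add: lsum_Cons lsum_Nil F.minus_eq F.r_neg)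
      moreover have "hnorm A (F U) \<zero>\<^bsub>F U\<^esub> = 0"
        using nrm_0 F.zero_closed hnorm_F[OF U F.zero_closed]
        by (simp add: sel)
      ultimately show "hnorm A (F U) (X \<ominus>\<^bsub>F U\<^esub> lsum (F U) (\<lambda>(a, y). lact (F U) a y) [(\<one>\<^bsub>A\<^esub>, X)]) < e"
        using \<open>0 < e\<close> by simp
    qed (use X alg.one_closed in simp)
    show "nrm A (ip (F U) X Y) \<le> hnorm A (F U) X * hnorm A (F U) Y"
      if "X \<in> carrier (F U)" "Y \<in> carrier (F U)" for X Y
      using that nrm_cmp[OF M ob[OF U] M dag_closed[OF o], of X Y]
      by (simp add: hnorm_F[OF U]) (simp add: sel nrm_dag[OF o])
    show "hnorm A (F U) (lact (F U) a X) \<le> nrm A a * hnorm A (F U) X"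
      if "a \<in> carrier A" "X \<in> carrier (F U)" for a X
      using that nrm_ev[OF M M U, of a X] ev_closed'[OF M M U, of a X]
      by (simp add: hnorm_F[OF U] sel)
  qed
qed

section \<open>Evaluation as a realization of the tensor product of F(U) and F(V)\<close>

lemma tob_closed: "\<lbrakk>U \<in> Ob C; V \<in> Ob C\<rbrakk> \<Longrightarrow> tob C U V \<in> Ob C"
  by (rule tm.ob_closed)

lemma ev_F:
  assumes UV: "U \<in> Ob C" "V \<in> Ob C"
  shows "\<lbrakk>X \<in> carrier (F U); Y \<in> carrier (F V)\<rbrakk> \<Longrightarrow> ev V X Y \<in> carrier (F (tob C U V))"
    and "\<lbrakk>X \<in> carrier (F U); X' \<in> carrier (F U); Y \<in> carrier (F V)\<rbrakk>
      \<Longrightarrow> ev V (X \<oplus>\<^bsub>F U\<^esub> X') Y = ev V X Y \<oplus>\<^bsub>F (tob C U V)\<^esub> ev V X' Y"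
    and "\<lbrakk>X \<in> carrier (F U); Y \<in> carrier (F V); Y' \<in> carrier (F V)\<rbrakk>
      \<Longrightarrow> ev V X (Y \<oplus>\<^bsub>F V\<^esub> Y') = ev V X Y \<oplus>\<^bsub>F (tob C U V)\<^esub> ev V X Y'"
    and "\<lbrakk>X \<in> carrier (F U); Y \<in> carrier (F V)\<rbrakk>
      \<Longrightarrow> ev V (c \<odot>\<^bsub>F U\<^esub> X) Y = c \<odot>\<^bsub>F (tob C U V)\<^esub> ev V X Y"
    and "\<lbrakk>X \<in> carrier (F U); Y \<in> carrier (F V)\<rbrakk>
      \<Longrightarrow> hnorm A (F (tob C U V)) (ev V X Y) \<le> hnorm A (F U) X * hnorm A (F V) Y"
proof -
  note o = ob[OF UV(1)] ob[OF UV(2)] ob[OF tob_closed[OF UV]]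
  \<comment> \<open>Equality of the objects, and not just isomorphism, places the values in F(U
    \<otimes> V) itself.\<close>
  have assoc: "actob \<M> (actob \<M> M U) V = actob \<M> M (tob C U V)"
    using M UV by (rule actob_assoc)
  have amp: "\<And>X. X \<in> mors \<M> M (actob \<M> M U) \<Longrightarrow> amp V X \<in> mors \<M> (actob \<M> M V) (actob \<M> M (tob C U V))"
    using amp_closed[OF M o(1) UV(2)] by (simp add: assoc)
  show closed: "ev V X Y \<in> carrier (F (tob C U V))" if "X \<in> carrier (F U)" "Y \<in> carrier (F V)" for X Y
    using that by (simp add: sel ev_in[OF UV])
  show "\<lbrakk>X \<in> carrier (F U); X' \<in> carrier (F U); Y \<in> carrier (F V)\<rbrakk>
      \<Longrightarrow> ev V (X \<oplus>\<^bsub>F U\<^esub> X') Y = ev V X Y \<oplus>\<^bsub>F (tob C U V)\<^esub> ev V X' Y"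
    by (simp add: sel am.mor_add_left[OF M o(1) UV(2,2)] tensor_cat.id_closed UV(2) assoc
        cmp_add_left[OF M o(2,3)] amp)
  show "\<lbrakk>X \<in> carrier (F U); Y \<in> carrier (F V); Y' \<in> carrier (F V)\<rbrakk>
      \<Longrightarrow> ev V X (Y \<oplus>\<^bsub>F V\<^esub> Y') = ev V X Y \<oplus>\<^bsub>F (tob C U V)\<^esub> ev V X Y'"
    by (simp add: sel cmp_add_right[OF M o(2,3)] amp)
  show "\<lbrakk>X \<in> carrier (F U); Y \<in> carrier (F V)\<rbrakk>
      \<Longrightarrow> ev V (c \<odot>\<^bsub>F U\<^esub> X) Y = c \<odot>\<^bsub>F (tob C U V)\<^esub> ev V X Y"
    by (simp add: sel am.mor_smult_left[OF M o(1) UV(2,2)] tensor_cat.id_closed UV(2) assoc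
        cmp_smult_left[OF M o(2,3)] amp)
  show "\<lbrakk>X \<in> carrier (F U); Y \<in> carrier (F V)\<rbrakk>
      \<Longrightarrow> hnorm A (F (tob C U V)) (ev V X Y) \<le> hnorm A (F U) X * hnorm A (F V) Y"
    using nrm_ev[OF M o(1) UV(2), of X Y] closed[of X Y]
    by (simp add: hnorm_F[OF UV(1)] hnorm_F[OF UV(2)] hnorm_F[OF tob_closed[OF UV]]) (simp add: sel assoc)
qed

text \<open>The inner product formula is \<open>ev_ip'\<close>; compatibility with the left action
  is \<open>ev_assoc\<close> with an element of A in the place of X.\<close>

lemma tensor_realization_ev:
  assumes UV: "U \<in> Ob C" "V \<in> Ob C"
  shows "tensor_realization A (F (tob C U V)) (F U) (F V) (ev V)"
proof -
  interpret FU: normed_correspondence A "F U" using UV(1) by (rule normed_correspondence_F)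
  interpret FV: normed_correspondence A "F V" using UV(2) by (rule normed_correspondence_F)
  interpret FUV: normed_correspondence A "F (tob C U V)"
    using tob_closed[OF UV] by (rule normed_correspondence_F)
  note o = ob[OF UV(1)] ob[OF UV(2)] ob[OF tob_closed[OF UV]]
  show ?thesis
  proof (intro tensor_realization.intro tensor_realization_axioms.intro FUV.normed_correspondence_axioms)
    show "ip (F (tob C U V)) (ev V X Y) (ev V X' Y') = ip (F V) Y (lact (F V) (ip (F U) X X') Y')"
      if "X \<in> carrier (F U)" "Y \<in> carrier (F V)" "X' \<in> carrier (F U)" "Y' \<in> carrier (F V)" for X Y X' Y'
      using that ev_ip'[OF M o(1) UV(2)] by (simp add: sel)
    show "ev V (\<ominus>\<^bsub>F U\<^esub> X) Y = \<ominus>\<^bsub>F (tob C U V)\<^esub> ev V X Y"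
      if "X \<in> carrier (F U)" "Y \<in> carrier (F V)" for X Y
      using that ev_F[OF UV]
      by (intro additive_diff(2)[OF module_F[OF UV(1)] module_F[OF tob_closed[OF UV]], where T = "\<lambda>X. ev V X Y"])
        auto
    show "ev V X (ract (F V) Y a) = ract (F (tob C U V)) (ev V X Y) a"
      if "X \<in> carrier (F U)" "Y \<in> carrier (F V)" "a \<in> carrier A" for X Y a
    proof -
      have "amp V X \<in> mors \<M> (actob \<M> M V) (actob \<M> M (tob C U V))"
        using amp_closed[OF M o(1) UV(2)] that by (simp add: sel actob_assoc[OF M UV])
      then show ?thesis
        using that cmp_assoc[OF M M o(2,3), of "amp V X" Y a] by (simp add: sel)
    qed
    show "ev V (lact (F U) a X) Y = lact (F (tob C U V)) a (ev V X Y)"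
      if "X \<in> carrier (F U)" "Y \<in> carrier (F V)" "a \<in> carrier A" for X Y a
      using that ev_assoc[OF M M UV, of a X Y] by (simp add: sel)
  qed (simp_all add: ev_F[OF UV] FU.mod.a_inv_closed FU.mod.smult_closed FV.ract_closed FU.lact_closed)
qed

section \<open>The maps F_2 and the action of F on morphisms\<close>

definition F2 :: "'o \<Rightarrow> 'o \<Rightarrow> ('n, 'n) tens \<Rightarrow> 'n" where
  "F2 U V = tensor_realization.realize A (F (tob C U V)) (ev V)"

lemma F2_elem:
  assumes "U \<in> Ob C" "V \<in> Ob C" "X \<in> carrier (F U)" "Y \<in> carrier (F V)"
  shows "F2 U V (elem_tensor A (F U) (F V) X Y) = ev V X Y"
  unfolding F2_def
  by (rule tensor_realization.elem_tensor_realize(2)[OF tensor_realization_ev[OF assms(1,2)] assms(3,4)])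

lemma Fm_F:
  assumes UV: "U \<in> Ob C" "V \<in> Ob C" and T: "T \<in> mors C U V"
  shows "X \<in> carrier (F U) \<Longrightarrow> Fm T X \<in> carrier (F V)"
    and "\<lbrakk>X \<in> carrier (F U); Y \<in> carrier (F U)\<rbrakk> \<Longrightarrow> Fm T (X \<oplus>\<^bsub>F U\<^esub> Y) = Fm T X \<oplus>\<^bsub>F V\<^esub> Fm T Y"
    and "X \<in> carrier (F U) \<Longrightarrow> Fm T (c \<odot>\<^bsub>F U\<^esub> X) = c \<odot>\<^bsub>F V\<^esub> Fm T X"
    and "X \<in> carrier (F U) \<Longrightarrow>
      hnorm A (F V) (Fm T X) \<le> nrm (Mor \<M> (actob \<M> M U) (actob \<M> M V)) (actmor \<M> (idm \<M> M) T) * hnorm A (F U) X"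
    and "\<lbrakk>X \<in> carrier (F U); a \<in> carrier A\<rbrakk> \<Longrightarrow> Fm T (ract (F U) X a) = ract (F V) (Fm T X) a"
    and "\<lbrakk>X \<in> carrier (F U); a \<in> carrier A\<rbrakk> \<Longrightarrow> Fm T (lact (F U) a X) = lact (F V) a (Fm T X)"
    and "is_adjoint (F U) (F V) (Fm T) (Fm (dag C T))"
proof -
  note o = ob[OF UV(1)] ob[OF UV(2)]
  have i: "actmor \<M> (idm \<M> M) T \<in> mors \<M> (actob \<M> M U) (actob \<M> M V)"
    by (rule am.mor_closed[OF M M UV id_closed[OF M] T])
  show closed: "Fm T X \<in> carrier (F V)" if "X \<in> carrier (F U)" for X
    using that by (simp add: module_functor_mor_def sel cmp_closed[OF M o i])
  show "\<lbrakk>X \<in> carrier (F U); Y \<in> carrier (F U)\<rbrakk> \<Longrightarrow> Fm T (X \<oplus>\<^bsub>F U\<^esub> Y) = Fm T X \<oplus>\<^bsub>F V\<^esub> Fm T Y"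
    by (simp add: module_functor_mor_def sel cmp_add_right[OF M o i])
  show "X \<in> carrier (F U) \<Longrightarrow> Fm T (c \<odot>\<^bsub>F U\<^esub> X) = c \<odot>\<^bsub>F V\<^esub> Fm T X"
    by (simp add: module_functor_mor_def sel cmp_smult_right[OF M o i])
  show "hnorm A (F V) (Fm T X)
      \<le> nrm (Mor \<M> (actob \<M> M U) (actob \<M> M V)) (actmor \<M> (idm \<M> M) T) * hnorm A (F U) X"
    if "X \<in> carrier (F U)"
    using nrm_cmp[OF M o i, of X] that
    by (simp add: hnorm_F[OF UV(1) that] hnorm_F[OF UV(2) closed[OF that]])
      (simp add: module_functor_mor_def sel)
  show "\<lbrakk>X \<in> carrier (F U); a \<in> carrier A\<rbrakk> \<Longrightarrow> Fm T (ract (F U) X a) = ract (F V) (Fm T X) a"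
    by (simp add: module_functor_mor_def sel cmp_assoc[OF M M o i])
  show "Fm T (lact (F U) a X) = lact (F V) a (Fm T X)" if "X \<in> carrier (F U)" "a \<in> carrier A"
  proof -
    have a: "a \<in> mors \<M> M M" using that by (simp add: sel)
    have X: "X \<in> mors \<M> M (actob \<M> M U)" using that by (simp add: sel)
    have "Fm T (lact (F U) a X) = (actmor \<M> (idm \<M> M) T \<diamondop>\<^bsub>\<M>\<^esub> amp U a) \<diamondop>\<^bsub>\<M>\<^esub> X"
      by (simp add: module_functor_mor_def sel cmp_assoc[OF M o(1) o i amp_closed[OF M M UV(1) a] X])
    \<comment> \<open>The left action and F(T) are composition with a \<otimes> \<iota> and \<iota>
      \<otimes> T, which can be exchanged.\<close>
    also have "\<dots> = (amp V a \<diamondop>\<^bsub>\<M>\<^esub> actmor \<M> (idm \<M> M) T) \<diamondop>\<^bsub>\<M>\<^esub> X"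
      by (simp add: interchange_left[OF M M UV a T] interchange_right[OF M M UV a T])
    also have "\<dots> = lact (F V) a (Fm T X)"
      by (simp add: module_functor_mor_def sel cmp_assoc[OF M o o(2) amp_closed[OF M M UV(2) a] i X])
    finally show ?thesis .
  qed
  have d: "actmor \<M> (idm \<M> M) (dag C T) = dag \<M> (actmor \<M> (idm \<M> M) T)"
    using am.mor_dag[OF M M UV id_closed[OF M] T] by (simp add: dag_id[OF M])
  have di: "dag \<M> (actmor \<M> (idm \<M> M) T) \<in> mors \<M> (actob \<M> M V) (actob \<M> M U)"
    by (rule dag_closed[OF o i])
  show "is_adjoint (F U) (F V) (Fm T) (Fm (dag C T))"
    using closed
    by (simp add: is_adjoint_def sel module_functor_mor_def d cmp_closed[OF M o(2,1) di] dag_cmp[OF M o i]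
        cmp_assoc[OF M o(2,1) M _ di] dag_closed[OF M o(1)])
qed

text \<open>Naturality on elementary tensors. Moving \<iota> \<otimes> T to the left past X
  \<otimes> \<iota> turns it into the action of T on M \<otimes> U; there it joins the amplified
  \<iota> \<otimes> S, and strictness rewrites (\<iota> \<otimes> S) \<otimes> T as \<iota>
  \<otimes> (S \<otimes> T).\<close>

lemma Fm_ev:
  assumes "U \<in> Ob C" "U' \<in> Ob C" "V \<in> Ob C" "V' \<in> Ob C"
    and S: "S \<in> mors C U U'" and T: "T \<in> mors C V V'"
    and X: "X \<in> carrier (F U)" and Y: "Y \<in> carrier (F V)"
  shows "Fm (tmor C S T) (ev V X Y) = ev V' (Fm S X) (Fm T Y)"
proof -
  note oU = ob[OF assms(1)] and oU' = ob[OF assms(2)] and oV = ob[OF assms(3)] and oV' = ob[OF assms(4)]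
  note oUV = am.ob_closed[OF oU assms(3)] and oUV' = am.ob_closed[OF oU assms(4)]
    and oU'V' = am.ob_closed[OF oU' assms(4)]
  have X': "X \<in> mors \<M> M (actob \<M> M U)" and Y': "Y \<in> mors \<M> M (actob \<M> M V)"
    using X Y by (simp_all add: sel)
  let ?s = "actmor \<M> (idm \<M> M) S" and ?t = "actmor \<M> (idm \<M> M) T"
  have s: "?s \<in> mors \<M> (actob \<M> M U) (actob \<M> M U')"
    by (rule am.mor_closed[OF M M assms(1,2) id_closed[OF M] S])
  have t: "?t \<in> mors \<M> (actob \<M> M V) (actob \<M> M V')"
    by (rule am.mor_closed[OF M M assms(3,4) id_closed[OF M] T])
  let ?T = "actmor \<M> (idm \<M> (actob \<M> M U)) T"
  have T': "?T \<in> mors \<M> (actob \<M> (actob \<M> M U) V) (actob \<M> (actob \<M> M U) V')"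
    by (rule am.mor_closed[OF oU oU assms(3,4) id_closed[OF oU] T])
  note aX = amp_closed[OF M oU assms(3) X'] and aX' = amp_closed[OF M oU assms(4) X']
    and as = amp_closed[OF oU oU' assms(4) s]
  have "ev V' (Fm S X) (Fm T Y) = (amp V' ?s \<diamondop>\<^bsub>\<M>\<^esub> amp V' X) \<diamondop>\<^bsub>\<M>\<^esub> (?t \<diamondop>\<^bsub>\<M>\<^esub> Y)"
    by (simp add: module_functor_mor_def amp_cmp[OF M oU oU' assms(4) s X'])
  also have "\<dots> = amp V' ?s \<diamondop>\<^bsub>\<M>\<^esub> (amp V' X \<diamondop>\<^bsub>\<M>\<^esub> (?t \<diamondop>\<^bsub>\<M>\<^esub> Y))"
    by (rule cmp_assoc[OF M oV' oUV' oU'V' as aX' cmp_closed[OF M oV oV' t Y']])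
  also have "amp V' X \<diamondop>\<^bsub>\<M>\<^esub> (?t \<diamondop>\<^bsub>\<M>\<^esub> Y) = (amp V' X \<diamondop>\<^bsub>\<M>\<^esub> ?t) \<diamondop>\<^bsub>\<M>\<^esub> Y"
    by (rule cmp_assoc[OF M oV oV' oUV' aX' t Y', symmetric])
  also have "amp V' X \<diamondop>\<^bsub>\<M>\<^esub> ?t = ?T \<diamondop>\<^bsub>\<M>\<^esub> amp V X"
    by (simp add: interchange_left[OF M oU assms(3,4) X' T] interchange_right[OF M oU assms(3,4) X' T])
  also have "(?T \<diamondop>\<^bsub>\<M>\<^esub> amp V X) \<diamondop>\<^bsub>\<M>\<^esub> Y = ?T \<diamondop>\<^bsub>\<M>\<^esub> ev V X Y"
    by (rule cmp_assoc[OF M oV oUV oUV' T' aX Y'])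
  also have "amp V' ?s \<diamondop>\<^bsub>\<M>\<^esub> (?T \<diamondop>\<^bsub>\<M>\<^esub> ev V X Y) = (amp V' ?s \<diamondop>\<^bsub>\<M>\<^esub> ?T) \<diamondop>\<^bsub>\<M>\<^esub> ev V X Y"
    by (rule cmp_assoc[OF M oUV oUV' oU'V' as T' ev_closed'[OF M oU assms(3) X' Y'], symmetric])
  also have "amp V' ?s \<diamondop>\<^bsub>\<M>\<^esub> ?T = actmor \<M> ?s T"
    by (rule interchange_left[OF oU oU' assms(3,4) s T])
  also have "\<dots> = actmor \<M> (idm \<M> M) (tmor C S T)"
    by (rule actmor_assoc[OF M M assms(1-4) id_closed[OF M] S T])
  finally show ?thesis by (simp add: module_functor_mor_def)
qed

text \<open>The map Y \<mapsto> (X \<otimes> \<iota>)Y has as adjoint the composition with the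
  amplified \<open>dag \<M> X\<close>. It is stated for any T with these values because condition
  (v) writes the map through \<open>F2\<close> on elementary tensors, where the formula is known on
  the carrier only.\<close>

lemma ev_adjoint:
  assumes UV: "U \<in> Ob C" "V \<in> Ob C" and X: "X \<in> carrier (F U)"
    and T: "\<And>Y. Y \<in> carrier (F V) \<Longrightarrow> T Y = ev V X Y"
  shows "is_adjoint (F V) (F (tob C U V)) T (ev V (dag \<M> X))"
proof -
  note o = ob[OF UV(1)] ob[OF UV(2)] ob[OF tob_closed[OF UV]]
  have assoc: "actob \<M> (actob \<M> M U) V = actob \<M> M (tob C U V)"
    using M UV by (rule actob_assoc)
  have X': "X \<in> mors \<M> M (actob \<M> M U)" using X by (simp add: sel)
  have a: "amp V X \<in> mors \<M> (actob \<M> M V) (actob \<M> M (tob C U V))"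
    using amp_closed[OF M o(1) UV(2) X'] by (simp add: assoc)
  have da: "amp V (dag \<M> X) \<in> mors \<M> (actob \<M> M (tob C U V)) (actob \<M> M V)"
    using amp_closed[OF o(1) M UV(2) dag_closed[OF M o(1) X']] by (simp add: assoc)
  show ?thesis
    using da amp_dag[OF M o(1) UV(2) X', symmetric]
    by (simp add: is_adjoint_def Pi_iff T ev_F[OF UV X])
      (simp add: sel cmp_closed[OF M o(3,2) da] dag_cmp[OF M o(2,3) a] cmp_assoc[OF M o(3,2) M _ da]
        dag_closed[OF M o(2)])
qed

end

section \<open>Verification of the axioms and uniqueness\<close>

context module_functor
begin

text \<open>The facts about the realization in the form in which the precomposition lemmas take
  them.\<close>

lemma F2_props:
  assumes UV: "U \<in> Ob C" "V \<in> Ob C"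
  shows "bimodule_map A (itensor A (F U) (F V)) (F (tob C U V)) (F2 U V)"
    and "isometric (itensor A (F U) (F V)) (F (tob C U V)) (F2 U V)"
    and "t \<in> carrier (itensor A (F U) (F V)) \<Longrightarrow> F2 U V t \<in> carrier (F (tob C U V))"
    and "Module.module complex_ring (itensor A (F U) (F V))"
    and "\<lbrakk>t \<in> carrier (itensor A (F U) (F V)); a \<in> carrier A\<rbrakk>
      \<Longrightarrow> lact (itensor A (F U) (F V)) a t \<in> carrier (itensor A (F U) (F V))"
    and "\<lbrakk>t \<in> carrier (itensor A (F U) (F V)); a \<in> carrier A\<rbrakk>
      \<Longrightarrow> ract (itensor A (F U) (F V)) t a \<in> carrier (itensor A (F U) (F V))"
    and "\<lbrakk>X \<in> carrier (F U); Y \<in> carrier (F V)\<rbrakk>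
      \<Longrightarrow> elem_tensor A (F U) (F V) X Y \<in> carrier (itensor A (F U) (F V))"
proof -
  interpret tensor_realization A "F (tob C U V)" "F U" "F V" "ev V"
    using UV by (rule tensor_realization_ev)
  show "bimodule_map A (itensor A (F U) (F V)) (F (tob C U V)) (F2 U V)"
    unfolding F2_def by (rule bimodule_map_realize)
  show "isometric (itensor A (F U) (F V)) (F (tob C U V)) (F2 U V)"
    unfolding F2_def by (rule isometric_realize)
  show "t \<in> carrier (itensor A (F U) (F V)) \<Longrightarrow> F2 U V t \<in> carrier (F (tob C U V))"
    unfolding F2_def by (rule realize_closed)
qed (rule tensor_realization.module_itensor[OF tensor_realization_ev[OF UV]]
    tensor_realization.itensor_lact(1)[OF tensor_realization_ev[OF UV]]
    tensor_realization.itensor_ract(1)[OF tensor_realization_ev[OF UV]]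
    tensor_realization.elem_tensor_realize(1)[OF tensor_realization_ev[OF UV]]; assumption)+

lemma F2_associative:
  assumes U: "U \<in> Ob C" and V: "V \<in> Ob C" and W: "W \<in> Ob C"
  shows "\<exists>\<alpha>. is_associator A (F U) (F V) (F W) \<alpha> \<and>
    (\<forall>t\<in>carrier (itensor A (itensor A (F U) (F V)) (F W)).
      F2 (tob C U V) W (tensor_map A (F (tob C U V)) (F W) (F2 U V) (\<lambda>z. z) t) =
      F2 U (tob C V W) (tensor_map A (F U) (F (tob C V W)) (\<lambda>x. x) (F2 V W) (\<alpha> t)))"
proof -
  note UV = tob_closed[OF U V] and VW = tob_closed[OF V W]
  \<comment> \<open>One name for the common target of both bracketings, so that the two realizations
    can be compared.\<close>
  define G where "G = F (tob C U (tob C V W))"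
  have G': "F (tob C (tob C U V) W) = G"
    by (simp add: G_def tensor_cat.tob_assoc U V W)
  let ?UV = "itensor A (F U) (F V)" and ?VW = "itensor A (F V) (F W)"
  define ev1 where "ev1 P Z = ev W (F2 U V P) Z" for P Z
  define ev2 where "ev2 X Q = ev (tob C V W) X (F2 V W Q)" for X Q
  have L: "tensor_realization A G (F (tob C U V)) (F W) (ev W)"
    using tensor_realization_ev[OF UV W] by (simp add: G')
  have R: "tensor_realization A G (F U) (F (tob C V W)) (ev (tob C V W))"
    unfolding G_def by (rule tensor_realization_ev[OF U VW])
  have R1: "tensor_realization A G ?UV (F W) ev1"
    unfolding ev1_def
    by (rule tensor_realization_precompose_left[OF L module_F[OF UV] F2_props(1,2,4,5)[OF U V]])
  have R2: "tensor_realization A G (F U) ?VW ev2"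
    unfolding ev2_def
    by (rule tensor_realization_precompose_right[OF R _ F2_props(1,2,6,5)[OF V W]])
      (rule right_hilbert_module.ip_closed[OF right_hilbert_module_F[OF U]])
  interpret R1: tensor_realization A G ?UV "F W" ev1 by (rule R1)
  interpret R2: tensor_realization A G "F U" ?VW ev2 by (rule R2)
  have elem: "ev1 (elem_tensor A (F U) (F V) X Y) Z = ev2 X (elem_tensor A (F V) (F W) Y Z)"
    if "X \<in> carrier (F U)" "Y \<in> carrier (F V)" "Z \<in> carrier (F W)" for X Y Z
    using that ev_assoc[OF M ob[OF U] V W, of X Y Z]
    by (simp add: ev1_def ev2_def F2_elem[OF U V] F2_elem[OF V W]) (simp add: sel)
  have evG: "ev W P Z \<in> carrier G" "\<And>P'. P' \<in> carrier (F (tob C U V)) \<Longrightarrow>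
      ev W (P \<oplus>\<^bsub>F (tob C U V)\<^esub> P') Z = ev W P Z \<oplus>\<^bsub>G\<^esub> ev W P' Z"
    "hnorm A G (ev W P Z) \<le> hnorm A (F W) Z * hnorm A (F (tob C U V)) P"
    if "P \<in> carrier (F (tob C U V))" "Z \<in> carrier (F W)" for P Z
    using that ev_F[OF UV W] by (simp_all add: G' mult.commute)
  have evG': "ev (tob C V W) X Q \<in> carrier G" "\<And>Q'. Q' \<in> carrier (F (tob C V W)) \<Longrightarrow>
      ev (tob C V W) X (Q \<oplus>\<^bsub>F (tob C V W)\<^esub> Q') = ev (tob C V W) X Q \<oplus>\<^bsub>G\<^esub> ev (tob C V W) X Q'"
    "hnorm A G (ev (tob C V W) X Q) \<le> hnorm A (F U) X * hnorm A (F (tob C V W)) Q"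
    if "X \<in> carrier (F U)" "Q \<in> carrier (F (tob C V W))" for X Q
    using that ev_F[OF U VW] by (simp_all add: G_def)
  let ?I1 = "R1.realize ` carrier R1.T" and ?I2 = "R2.realize ` carrier R2.T"
  \<comment> \<open>P is a limit of finite sums, so Z is fixed and the first factor varies: those g
    with (g \<otimes> \<iota>)Z in the second image form a closed submonoid that contains all (X
    \<otimes> \<iota>)Y.\<close>
  have in2: "ev1 P Z \<in> ?I2" if P: "P \<in> carrier ?UV" and Z: "Z \<in> carrier (F W)" for P Z
  proof -
    have "F2 U V P \<in> {g \<in> carrier (F (tob C U V)). ev W g Z \<in> ?I2}"
      unfolding F2_def
    proof (rule tensor_realization.realize_in_closed_submonoid[OF tensor_realization_ev[OF U V] _ _ P])
      show "normed_correspondence.closed_submonoid A (F (tob C U V)) {g \<in> carrier (F (tob C U V)). ev W g Z \<in> ?I2}"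
        by (rule closed_submonoid_vimage[OF normed_correspondence_F[OF UV] R1.normed_correspondence_axioms
            _ _ _ R2.closed_submonoid_realize, where K = "hnorm A (F W) Z"])
          (use evG Z in auto)
      show "ev V X Y \<in> {g \<in> carrier (F (tob C U V)). ev W g Z \<in> ?I2}"
        if XY: "X \<in> carrier (F U)" "Y \<in> carrier (F V)" for X Y
      proof -
        have "ev W (ev V X Y) Z = ev2 X (elem_tensor A (F V) (F W) Y Z)"
          using elem[OF XY Z] by (simp add: ev1_def F2_elem[OF U V XY])
        also have "\<dots> = R2.realize (elem_tensor A (F U) ?VW X (elem_tensor A (F V) (F W) Y Z))"
          by (rule R2.elem_tensor_realize(2)[OF XY(1) F2_props(7)[OF V W XY(2) Z], symmetric])
        also have "\<dots> \<in> ?I2"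
          by (intro imageI R2.elem_tensor_realize(1)[OF XY(1) F2_props(7)[OF V W XY(2) Z]])
        finally show ?thesis using ev_F(1)[OF U V XY] by simp
      qed
    qed
    then show ?thesis by (simp add: ev1_def)
  qed
  \<comment> \<open>The mirror image: X is fixed and the completed second factor varies.\<close>
  have in1: "ev2 X Q \<in> ?I1" if X: "X \<in> carrier (F U)" and Q: "Q \<in> carrier ?VW" for X Q
  proof -
    have "F2 V W Q \<in> {g \<in> carrier (F (tob C V W)). ev (tob C V W) X g \<in> ?I1}"
      unfolding F2_def
    proof (rule tensor_realization.realize_in_closed_submonoid[OF tensor_realization_ev[OF V W] _ _ Q])
      show "normed_correspondence.closed_submonoid A (F (tob C V W))
          {g \<in> carrier (F (tob C V W)). ev (tob C V W) X g \<in> ?I1}"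
        by (rule closed_submonoid_vimage[OF normed_correspondence_F[OF VW] R1.normed_correspondence_axioms
            _ _ _ R1.closed_submonoid_realize, where K = "hnorm A (F U) X"])
          (use evG' X in auto)
      show "ev W Y Z \<in> {g \<in> carrier (F (tob C V W)). ev (tob C V W) X g \<in> ?I1}"
        if YZ: "Y \<in> carrier (F V)" "Z \<in> carrier (F W)" for Y Z
      proof -
        have "ev (tob C V W) X (ev W Y Z) = ev1 (elem_tensor A (F U) (F V) X Y) Z"
          using elem[OF X YZ] by (simp add: ev2_def F2_elem[OF V W YZ])
        also have "\<dots> = R1.realize (elem_tensor A ?UV (F W) (elem_tensor A (F U) (F V) X Y) Z)"
          by (rule R1.elem_tensor_realize(2)[OF F2_props(7)[OF U V X YZ(1)] YZ(2), symmetric])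
        also have "\<dots> \<in> ?I1"
          by (intro imageI R1.elem_tensor_realize(1)[OF F2_props(7)[OF U V X YZ(1)] YZ(2)])
        finally show ?thesis using ev_F(1)[OF V W YZ] by simp
      qed
    qed
    then show ?thesis by (simp add: ev2_def)
  qed
  have image: "?I1 = ?I2"
  proof (intro equalityI image_subsetI)
    show "R1.realize t \<in> ?I2" if "t \<in> carrier R1.T" for t
      by (rule R1.realize_in_closed_submonoid[OF R2.closed_submonoid_realize in2 that])
    show "R2.realize t \<in> ?I1" if "t \<in> carrier R2.T" for t
      by (rule R2.realize_in_closed_submonoid[OF R1.closed_submonoid_realize in1 that])
  qed
  obtain \<alpha> where \<alpha>: "is_associator A (F U) (F V) (F W) \<alpha>"
    "\<forall>t\<in>carrier R1.T. \<alpha> t \<in> carrier R2.T \<and> R2.realize (\<alpha> t) = R1.realize t"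
    using associator_exists[OF R1 R2 F2_props(7)[OF U V] F2_props(7)[OF V W] elem image] by blast
  \<comment> \<open>Since \<open>ev1\<close> already contains \<open>F2 U V\<close>, the map
    \<open>F2 \<otimes> \<iota>\<close> is the identity on the ambient correspondence; hence this h
    and K = 1.\<close>
  have "F2 (tob C U V) W (tensor_map A (F (tob C U V)) (F W) (F2 U V) (\<lambda>z. z) t) = R1.realize t"
    if "t \<in> carrier R1.T" for t
    unfolding F2_def[of "tob C U V"] G'
    by (rule tensor_map_realize(2)[OF R1 L, where h = "\<lambda>g. g" and K = 1])
      (use that F2_props(3)[OF U V] in \<open>auto simp: ev1_def\<close>)
  moreover have "F2 U (tob C V W) (tensor_map A (F U) (F (tob C V W)) (\<lambda>x. x) (F2 V W) (\<alpha> t)) = R1.realize t"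
    if "t \<in> carrier R1.T" for t
  proof -
    have "F2 U (tob C V W) (tensor_map A (F U) (F (tob C V W)) (\<lambda>x. x) (F2 V W) (\<alpha> t)) = R2.realize (\<alpha> t)"
      unfolding F2_def[of U "tob C V W"] G_def[symmetric]
      by (rule tensor_map_realize(2)[OF R2 R, where h = "\<lambda>g. g" and K = 1])
        (use that \<alpha>(2) F2_props(3)[OF V W] in \<open>auto simp: ev2_def\<close>)
    then show ?thesis using \<alpha>(2) that by simp
  qed
  ultimately show ?thesis using \<alpha>(1) by auto
qed

text \<open>In realized form both sides are composition with the amplified
  \<open>dag \<M> X\<close>. On elementary tensors this is \<open>ev_assoc\<close> for the adjoint
  of X, and the norm of the amplified adjoint is the bound that extends it to the
  completion.\<close>

lemma F2_left_adjoint: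
  assumes U: "U \<in> Ob C" and V: "V \<in> Ob C" and W: "W \<in> Ob C" and X: "X \<in> carrier (F U)"
    and t: "t \<in> carrier (itensor A (F (tob C U V)) (F W))"
  shows "adjoint_of (F (tob C V W)) (F (tob C U (tob C V W)))
      (\<lambda>y. F2 U (tob C V W) (elem_tensor A (F U) (F (tob C V W)) X y)) (F2 (tob C U V) W t) =
    F2 V W (tensor_map A (F V) (F W)
      (adjoint_of (F V) (F (tob C U V)) (\<lambda>y. F2 U V (elem_tensor A (F U) (F V) X y))) (\<lambda>z. z) t)"
proof -
  note UV = tob_closed[OF U V] and VW = tob_closed[OF V W]
  have assoc: "tob C (tob C U V) W = tob C U (tob C V W)"
    by (rule tensor_cat.tob_assoc[OF U V W])
  have X': "dag \<M> X \<in> mors \<M> (actob \<M> M U) M"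
    using X by (simp add: sel dag_closed[OF M ob[OF U]])
  have adj: "is_adjoint (F Z) (F (tob C U Z)) (\<lambda>y. F2 U Z (elem_tensor A (F U) (F Z) X y)) (ev Z (dag \<M> X))"
    if "Z \<in> Ob C" for Z
    by (rule ev_adjoint[OF U that X F2_elem[OF U that X]])
  have G: "normed_correspondence A (F (tob C V W))" "normed_correspondence A (F V)"
    using V VW normed_correspondence_F by auto
  let ?S = "adjoint_of (F V) (F (tob C U V)) (\<lambda>y. F2 U V (elem_tensor A (F U) (F V) X y))"
  have S: "?S Y = ev V (dag \<M> X) Y" if "Y \<in> carrier (F (tob C U V))" for Y
    by (rule normed_correspondence.adjoint_of_eq[OF G(2) adj[OF V] that])
  have S_closed: "?S \<in> carrier (F (tob C U V)) \<rightarrow> carrier (F V)"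
    using adj[OF V] by (auto simp: S is_adjoint_def)
  have da: "amp (tob C V W) (dag \<M> X)
      \<in> mors \<M> (actob \<M> M (tob C U (tob C V W))) (actob \<M> M (tob C V W))"
    using amp_closed[OF ob[OF U] M VW X'] by (simp add: actob_assoc[OF M U VW])
  note o = M ob[OF tob_closed[OF U VW]] ob[OF VW]
  have "adjoint_of (F (tob C V W)) (F (tob C U (tob C V W)))
      (\<lambda>y. F2 U (tob C V W) (elem_tensor A (F U) (F (tob C V W)) X y)) (F2 (tob C U V) W t) =
      ev (tob C V W) (dag \<M> X) (F2 (tob C U V) W t)"
    using F2_props(3)[OF UV W t]
    by (intro normed_correspondence.adjoint_of_eq[OF G(1) adj[OF VW]]) (simp add: assoc)
  also have "\<dots> = F2 V W (tensor_map A (F V) (F W) ?S (\<lambda>z. z) t)"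
    unfolding F2_def[of V] F2_def[of "tob C U V"]
  proof (rule tensor_map_realize(2)[OF tensor_realization_ev[OF UV W] tensor_realization_ev[OF V W], symmetric,
        where K = "nrm (Mor \<M> (actob \<M> M (tob C U (tob C V W))) (actob \<M> M (tob C V W)))
          (amp (tob C V W) (dag \<M> X))"])
    show "ev (tob C V W) (dag \<M> X) \<in> carrier (F (tob C (tob C U V) W)) \<rightarrow> carrier (F (tob C V W))"
      using cmp_closed[OF o da] by (simp add: sel assoc)
    show "ev (tob C V W) (dag \<M> X) (g \<oplus>\<^bsub>F (tob C (tob C U V) W)\<^esub> g') =
        ev (tob C V W) (dag \<M> X) g \<oplus>\<^bsub>F (tob C V W)\<^esub> ev (tob C V W) (dag \<M> X) g'"
      if "g \<in> carrier (F (tob C (tob C U V) W))" "g' \<in> carrier (F (tob C (tob C U V) W))" for g g'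
      using that by (simp add: sel assoc cmp_add_right[OF o da])
    show "hnorm A (F (tob C V W)) (ev (tob C V W) (dag \<M> X) g) \<le>
        nrm (Mor \<M> (actob \<M> M (tob C U (tob C V W))) (actob \<M> M (tob C V W)))
          (amp (tob C V W) (dag \<M> X)) * hnorm A (F (tob C (tob C U V) W)) g"
      if "g \<in> carrier (F (tob C (tob C U V) W))" for g
      using that nrm_cmp[OF o da, of g] cmp_closed[OF o da, of g]
      by (simp add: hnorm_F[OF VW] hnorm_F[OF tob_closed[OF U VW]] assoc sel)
    show "ev (tob C V W) (dag \<M> X) (ev W Y Z) = ev W (?S Y) Z"
      if "Y \<in> carrier (F (tob C U V))" "Z \<in> carrier (F W)" for Y Z
      using that ev_assoc[OF ob[OF U] M V W X', of Y Z] by (simp add: S sel actob_assoc[OF M U V])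
  qed (use t S_closed in auto)
  finally show ?thesis .
qed

lemma weak_unitary_tensor_functor_F2: "weak_unitary_tensor_functor C A F Fm F2"
proof (intro weak_unitary_tensor_functor.intro weak_unitary_tensor_functor_axioms.intro
    tensor_cat.strict_cstar_tensor_category_axioms cstar_algebra_A F2_associative F2_left_adjoint)
  have unit: "unit C \<in> Ob C" by (rule tensor_cat.unit_closed)
  show "correspondence A (F U)" if "U \<in> Ob C" for U
    using normed_correspondence_F[OF that] by (rule normed_correspondence.axioms)
  show "corr_morphism A (F U) (F V) (Fm T)" if "U \<in> Ob C" "V \<in> Ob C" "T \<in> mors C U V" for U V T
    using Fm_F[OF that] by (auto simp: corr_morphism_def bimodule_map_def adjointable_def)
  show "Fm (idm C U) x = x" if "U \<in> Ob C" "x \<in> carrier (F U)" for U x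
    using that by (simp add: module_functor_mor_def sel am.mor_id[OF M] id_left[OF M ob])
  show "Fm (S \<diamondop>\<^bsub>C\<^esub> T) x = Fm S (Fm T x)"
    if "U \<in> Ob C" "V \<in> Ob C" "W \<in> Ob C" "S \<in> mors C V W" "T \<in> mors C U V" "x \<in> carrier (F U)"
    for U V W S T x
  proof -
    have "actmor \<M> (idm \<M> M) (S \<diamondop>\<^bsub>C\<^esub> T) = actmor \<M> (idm \<M> M) S \<diamondop>\<^bsub>\<M>\<^esub> actmor \<M> (idm \<M> M) T"
      using am.mor_cmp[OF M M M that(1-3) id_closed[OF M] id_closed[OF M] that(4,5)]
      by (simp add: id_left[OF M M id_closed[OF M]])
    then show ?thesis
      using that(6) cmp_assoc[OF M ob[OF that(1)] ob[OF that(2)] ob[OF that(3)]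
          am.mor_closed[OF M M that(2,3) id_closed[OF M] that(4)]
          am.mor_closed[OF M M that(1,2) id_closed[OF M] that(5)], of x]
      by (simp add: module_functor_mor_def sel)
  qed
  show "Fm (S \<oplus>\<^bsub>Mor C U V\<^esub> T) x = Fm S x \<oplus>\<^bsub>F V\<^esub> Fm T x"
    if "U \<in> Ob C" "V \<in> Ob C" "S \<in> mors C U V" "T \<in> mors C U V" "x \<in> carrier (F U)" for U V S T x
    using that(3-5)
    by (simp add: module_functor_mor_def sel am.mor_add_right[OF M M that(1,2) id_closed[OF M]]
        cmp_add_left[OF M ob[OF that(1)] ob[OF that(2)]] am.mor_closed[OF M M that(1,2) id_closed[OF M]])
  show "Fm (c \<odot>\<^bsub>Mor C U V\<^esub> T) x = c \<odot>\<^bsub>F V\<^esub> Fm T x"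
    if "U \<in> Ob C" "V \<in> Ob C" "T \<in> mors C U V" "x \<in> carrier (F U)" for U V T x c
    using that(3-4)
    by (simp add: module_functor_mor_def sel am.mor_smult_right[OF M M that(1,2) id_closed[OF M]]
        cmp_smult_left[OF M ob[OF that(1)] ob[OF that(2)]] am.mor_closed[OF M M that(1,2) id_closed[OF M]])
  show "bimodule_map A (itensor A (F U) (F V)) (F (tob C U V)) (F2 U V)"
    "isometric (itensor A (F U) (F V)) (F (tob C U V)) (F2 U V)" if "U \<in> Ob C" "V \<in> Ob C" for U V
    using that by (rule F2_props)+
  show "F2 U' V' (tensor_map A (F U') (F V') (Fm S) (Fm T) t) = Fm (tmor C S T) (F2 U V t)"
    if "U \<in> Ob C" "U' \<in> Ob C" "V \<in> Ob C" "V' \<in> Ob C" "S \<in> mors C U U'" "T \<in> mors C V V'"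
      "t \<in> carrier (itensor A (F U) (F V))" for U U' V V' S T t
    unfolding F2_def
  \<comment> \<open>The map h is F(S \<otimes> T), and \<open>Fm_ev\<close> says that it induces
    F(S) \<otimes> F(T).\<close>
  proof (rule tensor_map_realize(2)[OF tensor_realization_ev[OF that(1,3)] tensor_realization_ev[OF that(2,4)]])
    have ST: "tmor C S T \<in> mors C (tob C U V) (tob C U' V')"
      by (rule tm.mor_closed[OF that(1-6)])
    note F = Fm_F[OF tob_closed[OF that(1,3)] tob_closed[OF that(2,4)] ST]
    show "Fm S \<in> carrier (F U) \<rightarrow> carrier (F U')" "Fm T \<in> carrier (F V) \<rightarrow> carrier (F V')"
      using Fm_F(1)[OF that(1,2,5)] Fm_F(1)[OF that(3,4,6)] by auto
    show "Fm (tmor C S T) \<in> carrier (F (tob C U V)) \<rightarrow> carrier (F (tob C U' V'))"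
      using F(1) by auto
    show "Fm (tmor C S T) (ev V X Y) = ev V' (Fm S X) (Fm T Y)"
      if "X \<in> carrier (F U)" "Y \<in> carrier (F V)" for X Y
      using Fm_ev \<open>U \<in> Ob C\<close> \<open>U' \<in> Ob C\<close> \<open>V \<in> Ob C\<close> \<open>V' \<in> Ob C\<close> \<open>S \<in> mors C U U'\<close> \<open>T \<in> mors C V V'\<close> that
      by blast
  qed (rule Fm_F[OF tob_closed[OF that(1,3)] tob_closed[OF that(2,4)] tm.mor_closed[OF that(1-6)]] that; assumption)+
  \<comment> \<open>Over the unit object M \<otimes> \<one> = M and a \<otimes> \<iota> = a, so left
    action and carrier are those of A.\<close>
  show "corr_eq A (F (unit C)) (corr_of_algebra A)"
    using M actmor_unit[OF M M] by (auto simp: corr_eq_def corr_of_algebra_def sel actob_unit)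
  show "is_adjoint (F U) (F V) (Fm T) (Fm (dag C T))" if "U \<in> Ob C" "V \<in> Ob C" "T \<in> mors C U V" for U V T
    using that by (rule Fm_F)
  have A: "carrier A = carrier (F (unit C))"
    by (simp add: sel actob_unit[OF M])
  show "F2 (unit C) U (elem_tensor A (F (unit C)) (F U) a x) = lact (F U) a x"
    if "U \<in> Ob C" "a \<in> carrier A" "x \<in> carrier (F U)" for U a x
    using F2_elem[OF unit that(1) that(2)[unfolded A] that(3)] by (simp add: sel)
  show "F2 U (unit C) (elem_tensor A (F U) (F (unit C)) x a) = ract (F U) x a"
    if "U \<in> Ob C" "x \<in> carrier (F U)" "a \<in> carrier A" for U x a
    using F2_elem[OF that(1) unit that(2) that(3)[unfolded A]] that(2) actmor_unit[OF M ob[OF that(1)]]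
    by (simp add: sel)
  show "adjointable (F V) (F (tob C U V)) (\<lambda>y. F2 U V (elem_tensor A (F U) (F V) x y))"
    if "U \<in> Ob C" "V \<in> Ob C" "x \<in> carrier (F U)" for U V x
    unfolding adjointable_def using ev_adjoint[OF that F2_elem[OF that]] by blast
qed

text \<open>The axioms make any competitor an isometric bimodule map, so
  \<open>realize_unique\<close> applies.\<close>

lemma F2_unique:
  assumes "weak_unitary_tensor_functor C A F Fm F2'" and UV: "U \<in> Ob C" "V \<in> Ob C"
    and elem: "\<And>X Y. \<lbrakk>X \<in> carrier (F U); Y \<in> carrier (F V)\<rbrakk> \<Longrightarrow> F2' U V (elem_tensor A (F U) (F V) X Y) = ev V X Y"
    and t: "t \<in> carrier (itensor A (F U) (F V))"
  shows "F2' U V t = F2 U V t"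
  unfolding F2_def
  by (rule tensor_realization.realize_unique[OF tensor_realization_ev[OF UV]
      weak_unitary_tensor_functor.F2_bimodule_map[OF assms(1) UV]
      weak_unitary_tensor_functor.F2_isometric[OF assms(1) UV] elem t])

end

text \<open>The formula prescribes F_2 on elementary tensors only. Existence together with
  uniqueness on the carriers expresses that this prescription defines it.\<close>

theorem proposition3p1:
  fixes C :: "('o, 'm, 'z) tensor_category_scheme"
    and \<M> :: "('p, 'n, 'o, 'm, 'y) module_category_scheme"
    and M :: 'p
  assumes "strict_cstar_tensor_category C"
    and "strict_right_module_cstar_category C \<M>"
    and "M \<in> Ob \<M>"
  defines "A \<equiv> End_alg \<M> M"
    and "F \<equiv> module_functor_ob \<M> C M"
    and "Fm \<equiv> module_functor_mor \<M> M"
  shows "\<exists>F2. weak_unitary_tensor_functor C A F Fm F2 \<and>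
    (\<forall>U\<in>Ob C. \<forall>V\<in>Ob C. \<forall>X\<in>carrier (F U). \<forall>Y\<in>carrier (F V).
      F2 U V (elem_tensor A (F U) (F V) X Y) = actmor \<M> X (idm C V) \<diamondop>\<^bsub>\<M>\<^esub> Y) \<and>
    (\<forall>F2'. weak_unitary_tensor_functor C A F Fm F2' \<and>
      (\<forall>U\<in>Ob C. \<forall>V\<in>Ob C. \<forall>X\<in>carrier (F U). \<forall>Y\<in>carrier (F V).
        F2' U V (elem_tensor A (F U) (F V) X Y) = actmor \<M> X (idm C V) \<diamondop>\<^bsub>\<M>\<^esub> Y) \<longrightarrow>
      (\<forall>U\<in>Ob C. \<forall>V\<in>Ob C. \<forall>t\<in>carrier (itensor A (F U) (F V)). F2' U V t = F2 U V t))"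
proof -
  interpret P: module_functor C \<M> M
    by (intro module_functor.intro module_functor_axioms.intro assms)
  show ?thesis
    unfolding A_def F_def Fm_def
  proof (intro exI[of _ P.F2] conjI ballI allI impI P.weak_unitary_tensor_functor_F2 P.F2_elem)
    fix F2' U V t
    assume F2': "weak_unitary_tensor_functor C P.A P.F P.Fm F2' \<and>
      (\<forall>U\<in>Ob C. \<forall>V\<in>Ob C. \<forall>X\<in>carrier (P.F U). \<forall>Y\<in>carrier (P.F V).
        F2' U V (elem_tensor P.A (P.F U) (P.F V) X Y) = P.ev V X Y)"
      and UV: "U \<in> Ob C" "V \<in> Ob C" and t: "t \<in> carrier (itensor P.A (P.F U) (P.F V))"
    show "F2' U V t = P.F2 U V t"
      by (rule P.F2_unique[OF conjunct1[OF F2'] UV _ t]) (use F2' UV in simp)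
  qed
qed

end
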